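(* Let $\chi = \left(\frac{\cdot}{5}\right)$ be the unique nontrivial quadratic Dirichlet character modulo $5$, and let $\alpha = -\sqrt{-44}$, a root of $x^2+44$. Let $f_\chi \in S_6(\Gamma_0(5),\chi)$ be the cusp form with Fourier expansion $$f_\chi(z) = q + \alpha q^{2} - 3\alpha q^{3} - 12 q^{4} + (5\alpha - 45) q^{5} + 132 q^{6} - 9\alpha q^{7} + 20\alpha q^{8} - 153 q^{9} + (-45\alpha - 220) q^{10} + O(q^{11}),$$ and let $E^\circ_{6,\chi} \in M_6(\Gamma_0(5),\chi)$ be the normalized Hecke--Eisenstein series with Fourier expansion $$E^\circ_{6,\chi}(z) = -\frac{67}{5} + q - 31 q^{2} - 242 q^{3} + 993 q^{4} + q^{5} + 7502 q^{6} - 16806 q^{7} - 31775 q^{8} + 58807 q^{9} - 31 q^{10} + O(q^{11}).$$ Then we have the congruence $$f_\chi \equiv E^\circ_{6,\chi} \pmod{67}.$$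
   Context: Here $q = e^{2\pi i z}$ with $z$ in the upper half-plane, and $a_n(g)$ denotes the $n$-th Fourier coefficient of a modular form $g$. $M_6(\Gamma_0(5),\chi)$ is the space of holomorphic modular forms of weight $6$ on $\Gamma_0(5)$ with nebentypus character $\chi$, and $S_6(\Gamma_0(5),\chi)$ is its subspace of cusp forms. A congruence between two modular forms means the congruence of their $n$-th Fourier coefficients for all $n$. The space $S_6(\Gamma_0(5),\chi)$ is two-dimensional, with a basis of two eigenforms, normalized to have first Fourier coefficient $1$, with coefficients in $\mathbb{Q}(\alpha)$ and conjugate to each other under $\mathrm{Gal}(\mathbb{Q}(\alpha)/\mathbb{Q})$. The form $f_\chi$ is the one with $a_2(f_\chi) = \alpha$; it is the nontrivial Galois conjugate of the newform with LMFDB label 5.6.b.a. The Eisenstein series is defined by $$E^\circ_{6,\chi}(z) = \left(\frac{2\sqrt{5}\,(-2\pi i)^6}{5^6\cdot 5!}\right)^{-1} \sum_{(m,n)\in\mathbb{Z}^2\setminus\{(0,0)\}} \frac{\chi(n)}{(5mz+n)^6},$$ and its full Fourier expansion is $E^\circ_{6,\chi}(z) = -\frac{B_{6,\chi}}{12} + \sum_{n=1}^\infty \big(\sum_{d\mid n} \chi(d)\, d^{5}\big) q^n$, where the generalized Bernoulli numbers $B_{n,\chi}$ are defined by $\sum_{a=1}^{5} \chi(a) \frac{t e^{at}}{e^{5t}-1} = \sum_{n\ge 0} B_{n,\chi}\frac{t^n}{n!}$, and $5\cdot B_{6,\chi} = 804 = 2^2\cdot 3\cdot 67$. The prime $67$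 splits in $\mathbb{Q}(\alpha)$, say as $\mathfrak{p}_1\mathfrak{p}_2$. The congruence is checked by verifying that $67$ divides the norm $N_{\mathbb{Q}(\alpha)/\mathbb{Q}}\big(a_n(f_\chi) - a_n(E^\circ_{6,\chi})\big)$ (as a test for divisibility of the difference by a $\mathfrak{p}_j$) for the initial coefficients, and then applying Sturm's criterion, by which it suffices to check $n < 3$.
   Formalization: The congruence "mod 67" is read modulo one prime ideal of Q(α) above 67, the same for all n, with denominators prime to it allowed (constant term −67/5); modulo the ideal (67) it fails at n = 2, where the difference α+31 has norm 1005 = 15·67. *)

theory Defs
  imports
    "HOL-Complex_Analysis.Complex_Analysis"
    "HOL-Number_Theory.Number_Theory"
    "HOL-Algebra.Generated_Fields"
    "HOL-Algebra.Algebraic_Closure_Type"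
begin

section \<open>Modular forms with nebentypus\<close>

definition upper_half_plane :: "complex set" where
  "upper_half_plane = {z. Im z > 0}"

text \<open>A tuple \<open>(a, b, c, d)\<close> stands for the matrix with rows \<open>(a, b)\<close> and \<open>(c, d)\<close>.\<close>

definition SL2Z :: "(int \<times> int \<times> int \<times> int) set" where
  "SL2Z = {(a, b, c, d). a * d - b * c = 1}"

definition Gamma0 :: "nat \<Rightarrow> (int \<times> int \<times> int \<times> int) set" where
  "Gamma0 N = {(a, b, c, d). (a, b, c, d) \<in> SL2Z \<and> int N dvd c}"

definition slash ::
  "nat \<Rightarrow> int \<times> int \<times> int \<times> int \<Rightarrow> (complex \<Rightarrow> complex) \<Rightarrow> complex \<Rightarrow> complex" where
  "slash k = (\<lambda>(a, b, c, d) f z.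
     f ((of_int a * z + of_int b) / (of_int c * z + of_int d)) / (of_int c * z + of_int d) ^ k)"

definition at_i_infinity :: "complex filter" where
  "at_i_infinity = filtercomap Im at_top"

text \<open>
  Every cusp is of the form \<open>\<gamma>\<close>(i\<open>\<infinity>\<close>) with \<open>\<gamma>\<close> in \<open>SL2Z\<close>, so holomorphy (vanishing) at all cusps
  means that every \<open>slash k \<gamma> f\<close> is bounded (tends to 0) as the imaginary part tends to infinity.
  The values of a form outside the upper half-plane are irrelevant.
\<close>

definition modular_forms :: "nat \<Rightarrow> nat \<Rightarrow> (int \<Rightarrow> complex) \<Rightarrow> (complex \<Rightarrow> complex) set" where
  "modular_forms N k \<psi> = {f.
     f holomorphic_on upper_half_plane \<and>
     (\<forall>(a, b, c, d) \<in> Gamma0 N. \<forall>z \<in> upper_half_plane. slash k (a, b, c, d) f z = \<psi> d * f z) \<and>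
     (\<forall>\<gamma> \<in> SL2Z. Bfun (slash k \<gamma> f) at_i_infinity)}"

definition cusp_forms :: "nat \<Rightarrow> nat \<Rightarrow> (int \<Rightarrow> complex) \<Rightarrow> (complex \<Rightarrow> complex) set" where
  "cusp_forms N k \<psi> =
     {f \<in> modular_forms N k \<psi>. \<forall>\<gamma> \<in> SL2Z. (slash k \<gamma> f \<longlongrightarrow> 0) at_i_infinity}"

definition has_fourier_expansion :: "(complex \<Rightarrow> complex) \<Rightarrow> (nat \<Rightarrow> complex) \<Rightarrow> bool" where
  "has_fourier_expansion g a \<longleftrightarrow>
     (\<forall>z \<in> upper_half_plane. (\<lambda>n. a n * exp (2 * of_real pi * \<i> * z) ^ n) sums g z)"

text \<open>The coefficients are unique when an expansion exists, as it does for every modular form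
  for \<open>Gamma0 N\<close> whose character satisfies \<open>\<psi> 1 = 1\<close>.\<close>

definition fourier_coeff :: "(complex \<Rightarrow> complex) \<Rightarrow> nat \<Rightarrow> complex" where
  "fourier_coeff g = (THE a. has_fourier_expansion g a)"


section \<open>The character and the Eisenstein series\<close>

definition chi5 :: "int \<Rightarrow> complex" where
  "chi5 n = of_int (Legendre n 5)"

definition eisenstein6_chi5 :: "complex \<Rightarrow> complex" where
  "eisenstein6_chi5 z =
     inverse (2 * of_real (sqrt 5) * (- 2 * of_real pi * \<i>) ^ 6 / (5 ^ 6 * fact 5)) *
     (\<Sum>\<^sub>\<infinity>(m, n) \<in> UNIV - {(0, 0)}. chi5 n / (5 * of_int m * z + of_int n) ^ 6)"


section \<open>The number field and congruences\<close>

definition alpha :: complex where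
  "alpha = - csqrt (- 44)"

text \<open>The subfield of the complex numbers generated by \<open>x\<close>, and its ring of integers.\<close>

definition rat_adjoin :: "complex \<Rightarrow> complex set" where
  "rat_adjoin x = generate_field ring_of_type_algebra {x}"

definition ring_of_integers :: "complex set \<Rightarrow> complex ring" where
  "ring_of_integers K = ring_of_type_algebra \<lparr>carrier := {x \<in> K. algebraic_int x}\<rparr>"

text \<open>
  Congruence modulo a prime ideal \<open>P\<close> of \<open>R\<close> for elements of the fraction field that need not be
  integral: the difference lies in the maximal ideal of the localization of \<open>R\<close> at \<open>P\<close>.
  This is needed since the constant term of the Eisenstein series has denominator 5.
\<close>

definition cong_mod_prime :: "complex ring \<Rightarrow> complex set \<Rightarrow> complex \<Rightarrow> complex \<Rightarrow> bool" where
  "cong_mod_prime R P x y \<longleftrightarrow> (\<exists>s \<in> carrier R - P. s * (x - y) \<in> P)"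

text \<open>A congruence of forms uses one and the same \<open>P\<close> for all coefficients.\<close>

definition forms_cong_mod_prime ::
  "complex ring \<Rightarrow> complex set \<Rightarrow> (complex \<Rightarrow> complex) \<Rightarrow> (complex \<Rightarrow> complex) \<Rightarrow> bool" where
  "forms_cong_mod_prime R P f g \<longleftrightarrow>
     (\<forall>n. cong_mod_prime R P (fourier_coeff f n) (fourier_coeff g n))"

end

theory Submission
  imports Defs "HOL-Real_Asymp.Real_Asymp"
begin

text \<open>
  Besides the Eisenstein series there are forms \<open>X1\<close>, \<open>X2\<close>, \<open>X3\<close> of weight 6 and character
  \<open>chi5\<close> with integral Fourier coefficients, vanishing at infinity to order exactly 1, 2, 3:
  a weight 6 Eisenstein series and quadratic expressions in two weight 3 Eisenstein series.
  Multiplying \<open>D = 5 (f - E)\<close> by \<open>X3\<close> pushes the order at infinity up to 3, so a Sturm bound in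
  weight 12 identifies \<open>D * X3\<close> with a linear combination of \<open>X1 * X2\<close>, \<open>X2\<^sup>2\<close>, \<open>X2 * X3\<close>, \<open>X3\<^sup>2\<close>.
  Its four coefficients lie in the prime above 67 that contains \<open>alpha + 31\<close>, hence so do all Fourier
  coefficients of \<open>D * X3\<close>, and since \<open>X3\<close> has leading coefficient 1, so do those of \<open>D\<close>.

  The expansions come from the Lipschitz formula, which also evaluates the constant term of the
  Eisenstein series. The Sturm bound is Siegel's argument: for the norm \<open>F\<close> of the form to level 1,
  the invariant function \<open>\<bar>F\<bar>\<^sup>2 y\<^sup>k\<close> attains its maximum at height at least \<open>sqrt 3 / 2\<close>, and
  the maximum principle for \<open>F\<close> divided by a power of \<open>q\<close> contradicts this if \<open>F\<close> vanishes to high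
  order at infinity.
\<close>


text \<open>Every identity used is exact, in characteristic 0; the prime enters only when four
  constants are reduced. In weight 6 a nonzero form of character \<open>chi5\<close> vanishes at
  infinity to order at most 3, so \<open>D\<close> itself could be expanded along forms of orders 0,
  1, 2, 3. The obstacle is order 0: the form at hand is the Eisenstein series, and normalising its
  constant term -67/5 divides by 67, which destroys exactly the integrality that matters.
  Multiplication by \<open>X3\<close> avoids order 0, since 3 = 1 + 2 is already the order of
  \<open>X1 * X2\<close>; the products have orders 3, 4, 5, 6 and leading coefficient 1, so the
  system for the constants is triangular over Z[alpha].

  By the valence formula a nonzero form of weight 12 has order at most 6. Siegel's argument gives
  only the bound 36 / (pi * sqrt 3), about 6.62, but the next integer is 7 in both cases, so nothing
  is lost.

  The prime is forced by the second coefficients, alpha against -31, and it lies above 67 because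
  31^2 + 44 = 15 * 67.\<close>

definition nome :: "complex \<Rightarrow> complex" where
  "nome z = exp (2 * of_real pi * \<i> * z)"

lemma nome_neq_0 [simp]: "nome z \<noteq> 0"
  by (simp add: nome_def)

lemma norm_nome: "norm (nome z) = exp (- 2 * pi * Im z)"
  by (simp add: nome_def norm_exp_eq_Re)

lemma norm_nome_less_1: "Im z > 0 \<Longrightarrow> norm (nome z) < 1"
  by (simp add: norm_nome)

lemma nome_add: "nome (z + w) = nome z * nome w"
  by (simp add: nome_def ring_distribs exp_add)

lemma nome_of_nat_mult: "nome (of_nat n * z) = nome z ^ n"
  unfolding nome_def by (subst exp_of_nat_mult [symmetric]) (simp add: mult_ac)

lemma nome_eq_1_iff: "nome z = 1 \<longleftrightarrow> z \<in> \<int>"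
proof
  assume "nome z = 1"
  then obtain n :: int where n: "Im (2 * of_real pi * \<i> * z) = of_int (2 * n) * pi"
      and re: "Re (2 * of_real pi * \<i> * z) = 0"
    by (auto simp: nome_def exp_eq_1)
  have "z = of_int n"
    using n re by (simp add: complex_eq_iff)
  thus "z \<in> \<int>" by simp
next
  assume "z \<in> \<int>"
  then obtain n :: int where "z = of_int n" by (elim Ints_cases)
  thus "nome z = 1"
    using exp_eq_1 [of "2 * of_real pi * \<i> * z"] by (auto simp: nome_def intro!: exI[of _ n])
qed

lemma has_field_derivative_nome [derivative_intros]:
  "(nome has_field_derivative 2 * of_real pi * \<i> * nome z) (at z within A)"
  unfolding nome_def [abs_def] by (auto intro!: derivative_eq_intros)

lemma holomorphic_on_nome: "nome holomorphic_on A"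
  unfolding nome_def [abs_def] by (intro holomorphic_intros)


section \<open>The Lipschitz summation formula\<close>

text \<open>With \<open>w = 1 / (1 - q)\<close> one has \<open>q dw/dq = w\<^sup>2 - w\<close>, so these polynomials
  express the iterates of \<open>q d/dq\<close> applied to the geometric series.\<close>

fun lipschitz_poly :: "nat \<Rightarrow> complex poly" where
  "lipschitz_poly 0 = [:0, 1:]"
| "lipschitz_poly (Suc n) = [:0, -1, 1:] * pderiv (lipschitz_poly n)"

lemma sums_lipschitz_poly:
  fixes q :: complex
  assumes "norm q < 1"
  shows "(\<lambda>d. of_nat d ^ n * q ^ d) sums poly (lipschitz_poly n) (1 / (1 - q))"
  using assms
proof (induction n arbitrary: q)
  \<comment> \<open>Here 0 ^ 0 = 1, so the index 0 term is that of the geometric series.\<close>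
  case 0
  then show ?case using geometric_sums [OF 0] by simp
next
  case (Suc n)
  let ?f = "\<lambda>q. poly (lipschitz_poly n) (1 / (1 - q))"
  have "q \<noteq> 1" using Suc.prems by auto
  have 2: "(?f has_field_derivative poly (pderiv (lipschitz_poly n)) (1 / (1 - q)) * (1 / (1 - q)^2)) (at q)"
    using \<open>q \<noteq> 1\<close> by (auto intro!: derivative_eq_intros simp: power2_eq_square)
  have "(\<lambda>d. diffs (\<lambda>d. of_nat d ^ n) d * q ^ d) sums
          (poly (pderiv (lipschitz_poly n)) (1 / (1 - q)) * (1 / (1 - q)^2))"
    by (rule termdiffs_sums_strong [OF Suc.IH 2 Suc.prems])
  hence "(\<lambda>d. q * (diffs (\<lambda>d. of_nat d ^ n) d * q ^ d)) sums
          (q * (poly (pderiv (lipschitz_poly n)) (1 / (1 - q)) * (1 / (1 - q)^2)))"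
    by (rule sums_mult)
  hence "(\<lambda>d. of_nat (Suc d) ^ Suc n * q ^ Suc d) sums
          (q * (poly (pderiv (lipschitz_poly n)) (1 / (1 - q)) * (1 / (1 - q)^2)))"
    by (simp add: diffs_def mult_ac del: of_nat_Suc)
  \<comment> \<open>With a positive exponent the index 0 term is 0, so it can be put back.\<close>
  hence "(\<lambda>d. of_nat d ^ Suc n * q ^ d) sums
          (q * (poly (pderiv (lipschitz_poly n)) (1 / (1 - q)) * (1 / (1 - q)^2)) + of_nat 0 ^ Suc n * q ^ 0)"
    by (rule sums_Suc)
  also have "q * (poly (pderiv (lipschitz_poly n)) (1 / (1 - q)) * (1 / (1 - q)^2)) + of_nat 0 ^ Suc n * q ^ 0
     = poly (lipschitz_poly (Suc n)) (1 / (1 - q))"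
  proof -
    define w where "w = 1 / (1 - q)"
    have "q * (1 / (1 - q)^2) = w * w - w"
      unfolding w_def
      using \<open>q \<noteq> 1\<close> by (simp add: divide_simps) (simp add: power2_eq_square algebra_simps)
    hence "q * (poly (pderiv (lipschitz_poly n)) w * (1 / (1 - q)^2)) =
             poly (pderiv (lipschitz_poly n)) w * (w * w - w)"
      by (metis mult.left_commute)
    thus ?thesis unfolding w_def [symmetric] by (simp add: algebra_simps)
  qed
  finally show ?case .
qed

text \<open>The logarithmic derivative of Euler's reflection formula: both sides are -pi cot(pi z),
  written in terms of the nome. Working with the entire function \<open>rGamma\<close> allows
  differentiating the product before anything is divided.\<close>

lemma Digamma_reflection:
  fixes z :: complex
  assumes "z \<notin> \<int>"
  shows "Digamma z - Digamma (1 - z) = \<i> * of_real pi * (2 / (1 - nome z) - 1)"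
proof -
  have z: "z \<notin> \<int>\<^sub>\<le>\<^sub>0" "1 - z \<notin> \<int>\<^sub>\<le>\<^sub>0"
    using assms nonpos_Ints_subset_Ints Ints_diff [of 1 "1 - z"] by auto
  have 1: "((\<lambda>z. rGamma z * rGamma (1 - z)) has_field_derivative
     - rGamma z * Digamma z * rGamma (1 - z) + rGamma z * (rGamma (1 - z) * Digamma (1 - z))) (at z)"
    using z by (auto intro!: derivative_eq_intros)
  have 2: "((\<lambda>z. rGamma z * rGamma (1 - z)) has_field_derivative cos (of_real pi * z)) (at z)"
    unfolding rGamma_reflection_complex by (auto intro!: derivative_eq_intros)
  have "rGamma z * rGamma (1 - z) * (Digamma z - Digamma (1 - z)) = - cos (of_real pi * z)"
    using DERIV_unique [OF 1 2] by (simp add: algebra_simps)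
  hence sD: "sin (of_real pi * z) * (Digamma z - Digamma (1 - z)) = - of_real pi * cos (of_real pi * z)"
    unfolding rGamma_reflection_complex by (simp add: field_simps)
  have "nome z \<noteq> 1" using assms by (simp add: nome_eq_1_iff)
  have ee: "exp (\<i> * (of_real pi * z)) ^ 2 = nome z"
    unfolding nome_def by (subst exp_of_nat_mult [symmetric]) (simp add: mult_ac)
  define e where "e = exp (\<i> * (of_real pi * z))"
  have [simp]: "e \<noteq> 0" by (simp add: e_def)
  have s: "sin (of_real pi * z) = (e - inverse e) / (2 * \<i>)"
    and c: "cos (of_real pi * z) = (e + inverse e) / 2"
    by (simp_all add: sin_exp_eq cos_exp_eq e_def exp_minus)
  have e2: "e * e = nome z" using ee by (simp add: e_def power2_eq_square)
  have sn: "2 * \<i> * e * sin (of_real pi * z) = nome z - 1"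
    unfolding s e2 [symmetric] by (simp add: field_simps)
  have cn: "2 * e * cos (of_real pi * z) = nome z + 1"
    unfolding c e2 [symmetric] by (simp add: ring_distribs)
  have "(nome z - 1) * (Digamma z - Digamma (1 - z)) = - \<i> * of_real pi * (nome z + 1)"
    unfolding sn [symmetric] cn [symmetric] mult.assoc [of _ "sin (of_real pi * z)"] sD by simp
  thus ?thesis using \<open>nome z \<noteq> 1\<close> by (simp add: field_simps)
qed

text \<open>Differentiate the Digamma formula n times. Each derivative in z is 2 pi i times q d/dq,
  the operation that \<open>lipschitz_poly\<close> iterates, and the inner derivative of 1 - z
  produces the alternating sign.\<close>

lemma Polygamma_reflection:
  fixes z :: complex
  assumes "z \<notin> \<int>" "n > 0"
  shows "Polygamma n z + (-1) ^ Suc n * Polygamma n (1 - z) =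
           (2 * of_real pi * \<i>) ^ Suc n * poly (lipschitz_poly n) (1 / (1 - nome z))"
proof -
  \<comment> \<open>The induction has to start at Digamma, whose formula carries the extra constant
    - i pi; one differentiation removes it, hence the correction term for n = 0 only.\<close>
  have "Polygamma n z + (-1) ^ Suc n * Polygamma n (1 - z) =
           (2 * of_real pi * \<i>) ^ Suc n * poly (lipschitz_poly n) (1 / (1 - nome z))
           - (if n = 0 then \<i> * of_real pi else 0)"
    using assms(1)
  proof (induction n arbitrary: z)
    case 0
    then show ?case using Digamma_reflection [of z] by (simp add: algebra_simps)
  next
    case (Suc n)
    have z: "z \<notin> \<int>\<^sub>\<le>\<^sub>0" "1 - z \<notin> \<int>\<^sub>\<le>\<^sub>0"
      using Suc.prems nonpos_Ints_subset_Ints Ints_diff [of 1 "1 - z"] by auto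
    have q: "nome z \<noteq> 1" using Suc.prems by (simp add: nome_eq_1_iff)
    have op: "open (- \<int> :: complex set)" by (simp add: open_Compl)
    let ?w = "1 / (1 - nome z)"
    have 1: "((\<lambda>z. Polygamma n z + (-1) ^ Suc n * Polygamma n (1 - z)) has_field_derivative
      Polygamma (Suc n) z + (-1) ^ Suc (Suc n) * Polygamma (Suc n) (1 - z)) (at z)"
      using z by (auto intro!: derivative_eq_intros)
    have 2: "((\<lambda>z. (2 * of_real pi * \<i>) ^ Suc n * poly (lipschitz_poly n) (1 / (1 - nome z))
           - (if n = 0 then \<i> * of_real pi else 0)) has_field_derivative
        (2 * of_real pi * \<i>) ^ Suc n * (poly (pderiv (lipschitz_poly n)) ?w *
            ((2 * of_real pi * \<i> * nome z) / (1 - nome z)^2))) (at z)"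
      using q by (auto intro!: derivative_eq_intros simp: power2_eq_square pderiv_pCons)
    have 3: "((\<lambda>z. Polygamma n z + (-1) ^ Suc n * Polygamma n (1 - z)) has_field_derivative
        (2 * of_real pi * \<i>) ^ Suc n * (poly (pderiv (lipschitz_poly n)) ?w *
            ((2 * of_real pi * \<i> * nome z) / (1 - nome z)^2))) (at z)"
      by (rule has_field_derivative_transform_within_open [OF 2 op])
         (use Suc in auto)
    define w where "w = 1 / (1 - nome z)"
    have w: "(2 * of_real pi * \<i> * nome z) / (1 - nome z)^2 = 2 * of_real pi * \<i> * (w * w - w)"
      unfolding w_def
      using q by (simp add: divide_simps) (simp add: power2_eq_square algebra_simps)
    show ?case
      unfolding DERIV_unique [OF 1 3] w unfolding w_def [symmetric] by (simp add: algebra_simps)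
  qed
  thus ?thesis using assms by simp
qed

lemma summable_norm_inverse_power_shift:
  fixes z :: complex
  assumes "n > 0"
  shows "summable (\<lambda>k. norm (inverse ((z + of_nat k) ^ Suc n)))"
proof (rule summable_comparison_test_ev)
  show "summable (\<lambda>k. 2 ^ Suc n * inverse (real k ^ Suc n))"
    using inverse_power_summable [of "Suc n", where ?'a = real] assms by (intro summable_mult) auto
  show "\<forall>\<^sub>F k in sequentially. norm (norm (inverse ((z + of_nat k) ^ Suc n)))
          \<le> 2 ^ Suc n * inverse (real k ^ Suc n)"
    using eventually_gt_at_top [of "nat \<lceil>2 * norm z\<rceil> + 1"]
  proof eventually_elim
    case (elim k)
    hence k: "real k > 2 * norm z" "k > 0" by linarith+
    have "norm (of_nat k :: complex) \<le> norm (z + of_nat k) + norm z"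
      using norm_triangle_ineq4 [of "z + of_nat k" z] by simp
    hence "norm (z + of_nat k) \<ge> real k / 2" using k by simp
    hence "inverse (norm (z + of_nat k) ^ Suc n) \<le> inverse ((real k / 2) ^ Suc n)"
      using k by (intro le_imp_inverse_le power_mono) auto
    moreover have "norm (norm (inverse ((z + of_nat k) ^ Suc n))) = inverse (norm (z + of_nat k) ^ Suc n)"
      by (simp add: norm_inverse norm_power del: power_Suc)
    moreover have "inverse ((real k / 2) ^ Suc n) = 2 ^ Suc n * inverse (real k ^ Suc n)"
      by (simp add: power_divide inverse_eq_divide del: power_Suc)
    ultimately show ?case by (simp only:)
  qed
qed

text \<open>The negative integers run as -1, -2, ...; in the Lipschitz sum this half becomes a
  series in 1 - z + k.\<close>

lemma has_sum_int_split:
  fixes f :: "int \<Rightarrow> 'a :: {comm_monoid_add, topological_comm_monoid_add}"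
  assumes "((\<lambda>k. f (int k)) has_sum S) UNIV" "((\<lambda>k. f (- int k - 1)) has_sum T) UNIV"
  shows "(f has_sum (S + T)) UNIV"
proof -
  have "(f has_sum S) (range int)"
    using assms(1) by (subst has_sum_reindex) (auto simp: o_def)
  moreover have "(f has_sum T) (range (\<lambda>k. - int k - 1))"
    using assms(2) by (subst has_sum_reindex) (auto simp: o_def inj_on_def)
  moreover have "range int \<inter> range (\<lambda>k. - int k - 1) = {}" by auto
  moreover have "x \<in> range int \<or> x \<in> range (\<lambda>k. - int k - 1)" for x
    by (cases x rule: int_cases) (auto simp: image_iff intro: exI[of _ "nat (- x - 1)"])
  hence "range int \<union> range (\<lambda>k. - int k - 1) = UNIV" by auto
  ultimately show ?thesis using has_sum_Un_disjoint by metis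
qed

text \<open>The halves j >= 0 and j < 0 are the series of \<open>Polygamma n\<close> at z and at 1 -
  z, up to sign and factorial, so the two-sided sum is the left side of the reflection formula. The
  weight is \<open>Suc n\<close>: n = 5 and n = 2 are the cases used later.\<close>

theorem lipschitz_has_sum:
  fixes z :: complex
  assumes "z \<notin> \<int>" "n > 0"
  shows "((\<lambda>j::int. inverse ((z + of_int j) ^ Suc n)) has_sum
     ((- 2 * of_real pi * \<i>) ^ Suc n / fact n * poly (lipschitz_poly n) (1 / (1 - nome z)))) UNIV"
proof -
  have z: "z \<noteq> 0" "1 - z \<noteq> 0" using assms by auto
  have 1: "((\<lambda>k. inverse ((z + of_int (int k)) ^ Suc n)) has_sum ((-1) ^ Suc n * Polygamma n z / fact n)) UNIV"
    using norm_summable_imp_has_sum [OF summable_norm_inverse_power_shift Polygamma_LIMSEQ] assms z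
    by simp
  have "((\<lambda>k. inverse ((1 - z + of_nat k) ^ Suc n)) has_sum ((-1) ^ Suc n * Polygamma n (1 - z) / fact n)) UNIV"
    using norm_summable_imp_has_sum [OF summable_norm_inverse_power_shift Polygamma_LIMSEQ] assms z
    by simp
  hence "((\<lambda>k. (-1) ^ Suc n * inverse ((1 - z + of_nat k) ^ Suc n)) has_sum
      ((-1) ^ Suc n * ((-1) ^ Suc n * Polygamma n (1 - z) / fact n))) UNIV"
    by (rule has_sum_cmult_right)
  also have "(\<lambda>k. (-1) ^ Suc n * inverse ((1 - z + of_nat k) ^ Suc n)) =
     (\<lambda>k. inverse ((z + of_int (- int k - 1)) ^ Suc n))"
  proof
    fix k
    have inv: "inverse ((-1) ^ Suc n) = ((-1) ^ Suc n :: complex)"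
      by (cases "even n") auto
    have "z + of_int (- int k - 1) = (-1) * (1 - z + of_nat k)" by simp
    hence "(z + of_int (- int k - 1)) ^ Suc n = ((-1) * (1 - z + of_nat k)) ^ Suc n" by (simp only:)
    also have "\<dots> = (-1) ^ Suc n * (1 - z + of_nat k) ^ Suc n" by (rule power_mult_distrib)
    finally show "(-1) ^ Suc n * inverse ((1 - z + of_nat k) ^ Suc n) = inverse ((z + of_int (- int k - 1)) ^ Suc n)"
      by (simp only: inverse_mult_distrib inv)
  qed
  finally have "((\<lambda>j::int. inverse ((z + of_int j) ^ Suc n)) has_sum
     ((-1) ^ Suc n * Polygamma n z / fact n +
     (-1) ^ Suc n * ((-1) ^ Suc n * Polygamma n (1 - z) / fact n))) UNIV"
    by (rule has_sum_int_split [OF 1])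
  also have "(-1) ^ Suc n * Polygamma n z / fact n +
     (-1) ^ Suc n * ((-1) ^ Suc n * Polygamma n (1 - z) / fact n) =
     (-1) ^ Suc n / fact n * (Polygamma n z + (-1) ^ Suc n * Polygamma n (1 - z))"
    by (simp add: field_simps)
  also have "\<dots> = (- 2 * of_real pi * \<i>) ^ Suc n / fact n * poly (lipschitz_poly n) (1 / (1 - nome z))"
    unfolding Polygamma_reflection [OF assms]
    using power_mult_distrib [of "-1" "2 * of_real pi * \<i>" "Suc n"] by simp
  finally show ?thesis .
qed

section \<open>Fourier expansions\<close>

lemma has_fourier_expansion_nome:
  "has_fourier_expansion g a \<longleftrightarrow> (\<forall>z. Im z > 0 \<longrightarrow> (\<lambda>n. a n * nome z ^ n) sums g z)"
  by (auto simp: has_fourier_expansion_def upper_half_plane_def nome_def)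

lemma nome_Ln: "q \<noteq> 0 \<Longrightarrow> nome (Ln q / (2 * of_real pi * \<i>)) = q"
  by (simp add: nome_def)

lemma Im_Ln_pos:
  assumes "q \<noteq> 0" "norm q < 1"
  shows "Im (Ln q / (2 * of_real pi * \<i>)) > 0"
proof -
  have "norm q = exp (- 2 * pi * Im (Ln q / (2 * of_real pi * \<i>)))"
    using norm_nome [of "Ln q / (2 * of_real pi * \<i>)"] nome_Ln [OF assms(1)] by simp
  hence "exp (- 2 * pi * Im (Ln q / (2 * of_real pi * \<i>))) < 1" using assms(2) by simp
  thus ?thesis by (simp add: zero_less_mult_iff)
qed

text \<open>The nome never takes the value 0, so nothing is assumed at q = 0. Giving the sum its
  value \<open>c 0\<close> there keeps it holomorphic on the disc; continuity forces
  \<open>c 0 = 0\<close>, and a nonzero later coefficient would contradict the isolation of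
  zeros.\<close>

lemma powser_eq_0_punctured:
  fixes c :: "nat \<Rightarrow> complex"
  assumes "\<And>q. q \<noteq> 0 \<Longrightarrow> norm q < 1 \<Longrightarrow> (\<lambda>n. c n * q ^ n) sums 0"
  shows "c m = 0"
proof (rule ccontr)
  assume m: "c m \<noteq> 0"
  define f where "f = (\<lambda>q :: complex. if q = 0 then c 0 else 0)"
  have sums: "(\<lambda>n. c n * (q - 0) ^ n) sums f q" if "norm (q - 0) < 1" for q
    using assms [of q] that powser_sums_zero [of c] by (auto simp: f_def)
  have "f holomorphic_on ball 0 1"
    by (rule power_series_holomorphic) (use sums in auto)
  hence "isCont f 0"
    using holomorphic_on_imp_continuous_on continuous_on_eq_continuous_at open_ball
    by (metis centre_in_ball zero_less_one)
  hence "f \<midarrow>0\<rightarrow> f 0" by (simp add: isCont_def)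
  moreover have "eventually (\<lambda>q. f q = 0) (at 0)"
    unfolding f_def by (auto simp: eventually_at_filter)
  hence "f \<midarrow>0\<rightarrow> 0" by (simp add: tendsto_eventually)
  ultimately have "f 0 = 0" by (rule LIM_unique)
  hence "\<And>q. f q = 0" by (simp add: f_def)
  have "m > 0" using m \<open>f 0 = 0\<close> by (cases "m = 0") (auto simp: f_def)
  then obtain s where "0 < s" "\<And>z. z \<in> cball 0 s - {0} \<Longrightarrow> f z \<noteq> 0"
    using powser_0_nonzero [of 1 0 c f m, OF _ sums \<open>f 0 = 0\<close> m] by auto
  moreover have "of_real s \<in> cball 0 s - {0 :: complex}" using \<open>0 < s\<close> by auto
  ultimately show False using \<open>\<And>q. f q = 0\<close> by blast
qed

lemma fourier_expansion_unique:
  assumes "has_fourier_expansion g a" "has_fourier_expansion g b"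
  shows "a = b"
proof
  fix m
  have "a m - b m = 0"
  proof (rule powser_eq_0_punctured)
    fix q :: complex assume q: "q \<noteq> 0" "norm q < 1"
    let ?z = "Ln q / (2 * of_real pi * \<i>)"
    have "(\<lambda>n. a n * nome ?z ^ n - b n * nome ?z ^ n) sums (g ?z - g ?z)"
      using assms Im_Ln_pos [OF q] unfolding has_fourier_expansion_nome by (intro sums_diff) blast+
    thus "(\<lambda>n. (a n - b n) * q ^ n) sums 0"
      unfolding nome_Ln [OF q(1)] by (simp add: algebra_simps)
  qed
  thus "a m = b m" by simp
qed

lemma fourier_coeff_eq:
  assumes "has_fourier_expansion g a"
  shows "fourier_coeff g = a"
  unfolding fourier_coeff_def using assms fourier_expansion_unique by blast

text \<open>The expansion also converges at half the height, where the nome is larger in norm;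
  inside that radius convergence is absolute.\<close>

lemma fourier_norm_summable:
  assumes "has_fourier_expansion g a" "Im z > 0"
  shows "summable (\<lambda>n. norm (a n * nome z ^ n))"
proof (rule powser_insidea)
  let ?w = "z - \<i> * of_real (Im z / 2)"
  show "summable (\<lambda>n. a n * nome ?w ^ n)"
    using assms unfolding has_fourier_expansion_nome by (intro sums_summable [of _ "g ?w"]) auto
  show "norm (nome z) < norm (nome ?w)"
    using assms by (simp add: norm_nome)
qed

lemma fourier_mult:
  assumes "has_fourier_expansion f a" "has_fourier_expansion g b"
  shows "has_fourier_expansion (\<lambda>z. f z * g z) (\<lambda>n. \<Sum>i\<le>n. a i * b (n - i))"
  unfolding has_fourier_expansion_nome
proof (intro allI impI)
  fix z assume z: "Im z > 0"
  have "(\<lambda>n. \<Sum>i\<le>n. (a i * nome z ^ i) * (b (n - i) * nome z ^ (n - i))) sums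
          ((\<Sum>n. a n * nome z ^ n) * (\<Sum>n. b n * nome z ^ n))"
    by (intro Cauchy_product_sums fourier_norm_summable [OF assms(1) z] fourier_norm_summable [OF assms(2) z])
  moreover have "(\<Sum>n. a n * nome z ^ n) = f z" "(\<Sum>n. b n * nome z ^ n) = g z"
    using assms z by (auto simp: has_fourier_expansion_nome sums_iff)
  moreover have "(\<Sum>i\<le>n. (a i * nome z ^ i) * (b (n - i) * nome z ^ (n - i))) =
          (\<Sum>i\<le>n. a i * b (n - i)) * nome z ^ n" for n
    unfolding sum_distrib_right
    by (intro sum.cong refl) (auto simp: mult_ac simp flip: power_add)
  ultimately show "(\<lambda>n. (\<Sum>i\<le>n. a i * b (n - i)) * nome z ^ n) sums (f z * g z)" by simp
qed

lemma fourier_add: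
  assumes "has_fourier_expansion f a" "has_fourier_expansion g b"
  shows "has_fourier_expansion (\<lambda>z. f z + g z) (\<lambda>n. a n + b n)"
  using assms sums_add unfolding has_fourier_expansion_nome by (fastforce simp: ring_distribs)

lemma fourier_cmult:
  assumes "has_fourier_expansion f a"
  shows "has_fourier_expansion (\<lambda>z. c * f z) (\<lambda>n. c * a n)"
  using assms sums_mult [of _ _ c] unfolding has_fourier_expansion_nome by (simp add: mult.assoc)

lemma fourier_diff:
  assumes "has_fourier_expansion f a" "has_fourier_expansion g b"
  shows "has_fourier_expansion (\<lambda>z. f z - g z) (\<lambda>n. a n - b n)"
  using fourier_add [OF assms(1) fourier_cmult [OF assms(2), of "-1"]] by simp

text \<open>\<open>r\<close> is the norm of the nome at height 1/2. For terms of index at least m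
  the quotient (t / r)^m can be pulled out of the series, leaving the convergent majorant at height
  1/2. The case m = 0 is boundedness.\<close>

lemma fourier_expansion_decay:
  assumes "has_fourier_expansion g a" "\<And>n. n < m \<Longrightarrow> a n = 0"
  obtains C where "\<And>z. Im z \<ge> 1 / 2 \<Longrightarrow> norm (g z) \<le> C * exp (- 2 * pi * real m * Im z)"
proof -
  define r where "r = exp (- pi)"
  define S where "S = (\<Sum>n. norm (a n) * r ^ n)"
  have "summable (\<lambda>n. norm (a n * nome (\<i> / 2) ^ n))"
    by (rule fourier_norm_summable [OF assms(1)]) auto
  hence sm: "summable (\<lambda>n. norm (a n) * r ^ n)"
    by (simp add: norm_mult norm_power norm_nome r_def)
  have "norm (g z) \<le> (S / r ^ m) * exp (- 2 * pi * real m * Im z)" if z: "Im z \<ge> 1 / 2" for z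
  proof -
    define t where "t = norm (nome z)"
    have t: "0 < t" "t \<le> r" using z by (auto simp: t_def norm_nome r_def)
    have rpos: "r > 0" by (simp add: r_def)
    have sn: "summable (\<lambda>n. norm (a n * nome z ^ n))"
      by (rule fourier_norm_summable [OF assms(1)]) (use z in auto)
    have "g z = (\<Sum>n. a n * nome z ^ n)"
      using assms(1) z by (simp add: has_fourier_expansion_nome sums_iff)
    also have "norm \<dots> \<le> (\<Sum>n. norm (a n * nome z ^ n))"
      by (rule summable_norm [OF sn])
    also have "\<dots> \<le> (\<Sum>n. (norm (a n) * r ^ n) * (t / r) ^ m)"
    proof (rule suminf_le [OF _ sn])
      show "summable (\<lambda>n. (norm (a n) * r ^ n) * (t / r) ^ m)" by (rule summable_mult2 [OF sm])
      fix n
      show "norm (a n * nome z ^ n) \<le> (norm (a n) * r ^ n) * (t / r) ^ m"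
      proof (cases "n < m")
        case False
        hence "(t / r) ^ n \<le> (t / r) ^ m"
          using t rpos by (intro power_decreasing) auto
        hence "t ^ n \<le> r ^ n * (t / r) ^ m"
          using rpos by (simp add: power_divide field_simps)
        hence "norm (a n) * t ^ n \<le> norm (a n) * (r ^ n * (t / r) ^ m)"
          by (intro mult_left_mono) auto
        thus ?thesis by (simp add: norm_mult norm_power t_def mult_ac)
      qed (use assms in auto)
    qed
    also have "\<dots> = S * (t / r) ^ m"
      unfolding S_def by (rule suminf_mult2 [OF sm, symmetric])
    also have "\<dots> = (S / r ^ m) * t ^ m" by (simp add: power_divide)
    also have "t ^ m = exp (- 2 * pi * real m * Im z)"
      by (simp add: t_def norm_nome mult_ac flip: exp_of_nat_mult)
    finally show ?thesis .
  qed
  thus ?thesis using that by blast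
qed

section \<open>Behaviour at infinity and existence of Fourier expansions\<close>

lemma eventually_at_i_infinity:
  "eventually P at_i_infinity \<longleftrightarrow> (\<exists>B. \<forall>z. Im z \<ge> B \<longrightarrow> P z)"
  unfolding at_i_infinity_def eventually_filtercomap eventually_at_top_linorder by blast

lemma Bfun_at_i_infinity:
  fixes g :: "complex \<Rightarrow> complex"
  shows "Bfun g at_i_infinity \<longleftrightarrow> (\<exists>B K. \<forall>z. Im z \<ge> B \<longrightarrow> norm (g z) \<le> K)"
proof -
  have "(\<exists>B K. \<forall>z. Im z \<ge> B \<longrightarrow> norm (g z) \<le> K) \<Longrightarrow> \<exists>K>0. \<exists>B. \<forall>z. Im z \<ge> B \<longrightarrow> norm (g z) \<le> K"
    by (metis less_add_one order.trans max.cobounded1 max.cobounded2 zero_less_one max.strict_coboundedI2)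
  thus ?thesis unfolding Bfun_def eventually_at_i_infinity by blast
qed

lemma periodic_of_int:
  assumes "\<And>z. Im z > 0 \<Longrightarrow> g (z + 1) = g z" "Im z > 0"
  shows "g (z + of_int n) = g z"
proof -
  have nat: "g (z + of_nat n) = g z" if "Im z > 0" for z n
    using that
  proof (induction n)
    case (Suc n)
    have "g (z + of_nat (Suc n)) = g ((z + of_nat n) + 1)" by (simp add: add_ac)
    thus ?case using assms(1) [of "z + of_nat n"] Suc by simp
  qed simp
  show ?thesis
  proof (cases "n \<ge> 0")
    case True
    thus ?thesis using nat [OF assms(2), of "nat n"] by simp
  next
    case False
    thus ?thesis using nat [of "z + of_int n" "nat (- n)"] assms(2) by simp
  qed
qed

text \<open>Periodicity makes g factor through the nome. The factor is holomorphic on the punctured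
  disc, boundedness at infinity removes the singularity at 0, and the Taylor series there is the
  Fourier expansion.\<close>

lemma fourier_expansion_exists:
  assumes hol: "g holomorphic_on upper_half_plane"
    and per: "\<And>z. Im z > 0 \<Longrightarrow> g (z + 1) = g z"
    and bdd: "Bfun g at_i_infinity"
  obtains a where "has_fourier_expansion g a"
proof -
  define F where "F = (\<lambda>q. g (Ln q / (2 * of_real pi * \<i>)))"
  have F: "F (nome z) = g z" if "Im z > 0" for z
  proof -
    have "nome (Ln (nome z) / (2 * of_real pi * \<i>) - z) = 1"
      using nome_add [of z "Ln (nome z) / (2 * of_real pi * \<i>) - z"] nome_Ln [of "nome z"] by simp
    then obtain n where "Ln (nome z) / (2 * of_real pi * \<i>) - z = of_int n"
      by (auto simp: nome_eq_1_iff elim: Ints_cases)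
    hence "Ln (nome z) / (2 * of_real pi * \<i>) = z + of_int n" by (simp add: algebra_simps)
    thus ?thesis using periodic_of_int [of g z n] per that by (simp add: F_def)
  qed
  have "\<exists>f'. (F has_field_derivative f') (at q0)" if q0: "q0 \<in> ball 0 1" "q0 \<noteq> 0" for q0
  proof -
    \<comment> \<open>A branch of the inverse of the nome that is holomorphic near \<open>q0\<close>
      even when \<open>q0\<close> lies on the cut of \<open>Ln\<close>; it differs from the
      principal branch by an integer, to which g is insensitive.\<close>
    define L where "L = (\<lambda>q. (Ln q0 + Ln (q / q0)) / (2 * of_real pi * \<i>))"
    define U where "U = (\<lambda>q. q / q0) -` {w. Re w > 0} \<inter> (ball 0 1 - {0})"
    have nL: "nome (L q) = q" if "q \<noteq> 0" for q
      using that q0 by (simp add: L_def nome_def exp_add)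
    have "open U"
      unfolding U_def by (intro open_Int open_vimage open_halfspace_Re_gt continuous_intros) (use q0 in auto)
    have q0U: "q0 \<in> U" using q0 by (simp add: U_def)
    have ImL: "Im (L q) > 0" if "q \<in> U" for q
    proof -
      have "norm q < 1" "q \<noteq> 0" using that by (auto simp: U_def)
      hence "exp (- 2 * pi * Im (L q)) < 1" using norm_nome [of "L q"] nL [of q] by simp
      thus ?thesis by (simp add: zero_less_mult_iff)
    qed
    have "(\<lambda>q. g (L q)) holomorphic_on U"
    proof -
      have "L holomorphic_on U"
        unfolding L_def by (intro holomorphic_intros)
          (use q0 in \<open>auto simp: U_def complex_nonpos_Reals_iff\<close>)
      moreover have "L ` U \<subseteq> upper_half_plane" using ImL by (auto simp: upper_half_plane_def)
      ultimately show ?thesis using holomorphic_on_compose_gen [OF _ hol] by (simp add: o_def)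
    qed
    then obtain d where d: "((\<lambda>q. g (L q)) has_field_derivative d) (at q0)"
      using \<open>open U\<close> q0U by (auto simp: holomorphic_on_open)
    have "g (L q) = F q" if "q \<in> U" for q
      using F [OF ImL, of q] nL [of q] that by (auto simp: U_def)
    hence "(F has_field_derivative d) (at q0)"
      using has_field_derivative_transform_within_open [OF d \<open>open U\<close> q0U] by blast
    thus ?thesis by blast
  qed
  hence "F holomorphic_on (ball 0 1 - {0})"
    by (subst holomorphic_on_open) auto
  moreover have "\<exists>B. eventually (\<lambda>q. norm (F q) \<le> B) (at 0)"
  proof -
    obtain B K where BK: "\<And>z. Im z \<ge> B \<Longrightarrow> norm (g z) \<le> K"
      using bdd unfolding Bfun_at_i_infinity by blast
    have "norm (F q) \<le> K" if q: "q \<noteq> 0" "dist q 0 < exp (- 2 * pi * B)" for q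
      unfolding F_def
    proof (rule BK)
      have "exp (- 2 * pi * Im (Ln q / (2 * of_real pi * \<i>))) < exp (- 2 * pi * B)"
        using norm_nome [of "Ln q / (2 * of_real pi * \<i>)"] nome_Ln [OF q(1)] q(2) by simp
      thus "B \<le> Im (Ln q / (2 * of_real pi * \<i>))" by simp
    qed
    thus ?thesis unfolding eventually_at by (intro exI [of _ K] exI [of _ "exp (- 2 * pi * B)"]) auto
  qed
  ultimately obtain G where G: "G holomorphic_on ball 0 1" "\<And>q. q \<in> ball 0 1 - {0} \<Longrightarrow> G q = F q"
    using holomorphic_on_extend_bounded [of F "ball 0 1" 0] by auto
  have "has_fourier_expansion g (\<lambda>n. (deriv ^^ n) G 0 / fact n)"
    unfolding has_fourier_expansion_nome
  proof (intro allI impI)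
    fix z assume z: "Im z > 0"
    have "nome z \<in> ball 0 1" using norm_nome_less_1 [OF z] by simp
    from holomorphic_power_series [OF G(1) this] G(2) [of "nome z"] this F [OF z]
    show "(\<lambda>n. (deriv ^^ n) G 0 / fact n * nome z ^ n) sums g z" by simp
  qed
  thus ?thesis by (rule that)
qed

section \<open>A Sturm bound for \<open>Gamma0 5\<close>\<close>

lemma Im_moebius:
  fixes a b c d :: int
  assumes "a * d - b * c = 1"
  shows "Im ((of_int a * z + of_int b) / (of_int c * z + of_int d)) =
           Im z / norm (of_int c * z + of_int d) ^ 2"
proof -
  have "of_int a * of_int d - of_int b * of_int c = (1 :: real)"
    using assms by (metis of_int_1 of_int_diff of_int_mult)
  hence "Im (of_int a * z + of_int b) * Re (of_int c * z + of_int d) -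
        Re (of_int a * z + of_int b) * Im (of_int c * z + of_int d) = Im z"
    by (simp add: algebra_simps)
  thus ?thesis
    by (simp add: Im_divide cmod_power2)
qed

lemma moebius_denom_nonzero:
  fixes a b c d :: int
  assumes "a * d - b * c = 1" "Im z > 0"
  shows "of_int c * z + of_int d \<noteq> 0"
proof
  assume *: "of_int c * z + of_int d = 0"
  hence "Im (of_int c * z + of_int d) = 0" by simp
  hence "c = 0" using assms(2) by simp
  with * have "d = 0" by simp
  with \<open>c = 0\<close> assms(1) show False by simp
qed

lemma modular_forms_transform:
  assumes "f \<in> modular_forms N k \<psi>" "a * d - b * c = 1" "int N dvd c" "Im z > 0"
  shows "f ((of_int a * z + of_int b) / (of_int c * z + of_int d)) =
           \<psi> d * (of_int c * z + of_int d) ^ k * f z"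
proof -
  have "(a, b, c, d) \<in> Gamma0 N" "z \<in> upper_half_plane"
    using assms by (auto simp: Gamma0_def SL2Z_def upper_half_plane_def)
  hence "slash k (a, b, c, d) f z = \<psi> d * f z"
    using assms(1) unfolding modular_forms_def by blast
  thus ?thesis
    using moebius_denom_nonzero [OF assms(2,4)] by (simp add: slash_def field_simps)
qed

text \<open>Decay excludes large heights, where u stays below \<open>u z1\<close>, and translation
  confines the real part to a unit interval, so only a compact rectangle has to be searched. It
  serves twice: for \<open>Phi\<close>, and for its rescaled holomorphic companion
  \<open>G\<close>.\<close>

lemma periodic_attains_max:
  fixes u :: "complex \<Rightarrow> real"
  assumes cont: "continuous_on {z. c \<le> Im z} u"
    and per: "\<And>z. c \<le> Im z \<Longrightarrow> u (z + 1) = u z"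
    and decay: "\<And>e. e > 0 \<Longrightarrow> \<exists>B. \<forall>z. B \<le> Im z \<longrightarrow> u z < e"
    and z1: "c \<le> Im z1" "u z1 > 0"
  obtains z0 where "c \<le> Im z0" "\<bar>Re z0\<bar> \<le> 1 / 2" "u z0 > 0" "\<And>z. c \<le> Im z \<Longrightarrow> u z \<le> u z0"
proof -
  have nat: "u (z + of_nat n) = u z" if "c \<le> Im z" for z n
    using that
  proof (induction n)
    case (Suc n)
    have "u (z + of_nat (Suc n)) = u ((z + of_nat n) + 1)" by (simp add: add_ac)
    thus ?case using per [of "z + of_nat n"] Suc by simp
  qed simp
  have int: "u (z + of_int n) = u z" if "c \<le> Im z" for z n
  proof (cases "n \<ge> 0")
    case True
    thus ?thesis using nat [OF that, of "nat n"] by simp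
  next
    case False
    thus ?thesis using nat [of "z + of_int n" "nat (- n)"] that by simp
  qed
  obtain B where B: "\<And>z. B \<le> Im z \<Longrightarrow> u z < u z1" using decay z1 by blast
  define R where "R = cbox (Complex (-1/2) c) (Complex (1/2) B)"
  have R: "z \<in> R \<longleftrightarrow> \<bar>Re z\<bar> \<le> 1/2 \<and> c \<le> Im z \<and> Im z \<le> B" for z
    by (auto simp: R_def in_cbox_complex_iff)
  have shift: "\<exists>w. \<bar>Re w\<bar> \<le> 1/2 \<and> Im w = Im z \<and> u w = u z" if "c \<le> Im z" for z
    using int [OF that, of "- round (Re z)"] of_int_round_abs_le [of "Re z"]
    by (intro exI [of _ "z + of_int (- round (Re z))"]) (auto simp: abs_minus_commute)
  have "Im z1 < B" using B [of z1] by force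
  with shift [OF z1(1)] z1 obtain w1 where w1: "w1 \<in> R" "u w1 = u z1" unfolding R by force
  have "compact R" by (simp add: R_def)
  moreover have "continuous_on R u" by (rule continuous_on_subset [OF cont]) (auto simp: R)
  ultimately obtain z0 where z0: "z0 \<in> R" "\<And>z. z \<in> R \<Longrightarrow> u z \<le> u z0"
    using continuous_attains_sup [of R u] w1 by blast
  have "u z \<le> u z0" if z: "c \<le> Im z" for z
  proof (cases "Im z \<le> B")
    case True
    thus ?thesis using shift [OF z] z z0(2) unfolding R by metis
  next
    case False
    hence "u z < u z1" using B by force
    also have "u z1 \<le> u z0" using z0 w1 by metis
    finally show ?thesis by simp
  qed
  moreover have "u z0 > 0" using z0 w1 z1 by force
  ultimately show ?thesis using that z0(1) unfolding R by blast
qed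

text \<open>Holomorphic functions on a connected open set form an integral domain: where one factor
  is nonzero, an open set, the product of the others vanishes, hence it vanishes everywhere by
  analytic continuation.\<close>

lemma prod_holomorphic_eq_0:
  assumes "finite I" "open U" "connected U" "U \<noteq> {}"
    and "\<And>i. i \<in> I \<Longrightarrow> g i holomorphic_on U"
    and "\<And>z. z \<in> U \<Longrightarrow> (\<Prod>i\<in>I. g i z) = 0"
  shows "\<exists>i\<in>I. \<forall>z\<in>U. g i z = 0"
  using assms(1,5,6)
proof (induction I rule: finite_induct)
  case empty
  thus ?case using assms(4) by auto
next
  case (insert i I)
  show ?case
  proof (cases "\<forall>z\<in>U. g i z = 0")
    case False
    then obtain z1 where z1: "z1 \<in> U" "g i z1 \<noteq> 0" by blast
    have hol: "g i holomorphic_on U" using insert by blast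
    define V where "V = U \<inter> g i -` (- {0})"
    have "open V" unfolding V_def
      using continuous_open_preimage [OF holomorphic_on_imp_continuous_on [OF hol] assms(2), of "- {0}"] by (simp add: open_Compl)
    have "(\<Prod>i\<in>I. g i z) = 0" if "z \<in> U" for z
    proof (rule analytic_continuation_open [of V U "\<lambda>z. \<Prod>i\<in>I. g i z" "\<lambda>_. 0"])
      show "(\<lambda>z. \<Prod>i\<in>I. g i z) holomorphic_on U"
        by (intro holomorphic_on_prod) (use insert in auto)
      show "(\<Prod>i\<in>I. g i z) = 0" if "z \<in> V" for z
        using insert.prems(2) [of z] insert.hyps that by (auto simp: V_def)
    qed (use \<open>open V\<close> assms z1 that in \<open>auto simp: V_def\<close>)
    thus ?thesis using insert by auto
  qed auto
qed

section \<open>Siegel's maximum argument for the norm to level 1\<close>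

locale sturm5 =
  fixes f :: "complex \<Rightarrow> complex" and k :: nat and \<psi> :: "int \<Rightarrow> complex"
  assumes f: "f \<in> modular_forms 5 k \<psi>"
    and norm_psi: "\<And>d. \<not> 5 dvd d \<Longrightarrow> norm (\<psi> d) = 1"
begin

definition phi :: "complex \<Rightarrow> real" where
  "phi z = norm (f z) ^ 2 * Im z ^ k"

text \<open>The automorphy factor of f, squared in norm, cancels against the change of the imaginary
  part, and d is prime to 5, so the character contributes norm 1.\<close>

lemma phi_transform:
  assumes det: "a * d - b * c = 1" and c: "5 dvd c" and z: "Im z > 0"
  shows "phi ((of_int a * z + of_int b) / (of_int c * z + of_int d)) = phi z"
proof -
  have "\<not> 5 dvd d"
  proof
    assume "5 dvd d"
    hence "5 dvd a * d - b * c" using c by (intro dvd_diff dvd_mult)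
    thus False using det by simp
  qed
  hence "norm (\<psi> d) = 1" by (rule norm_psi)
  moreover have "of_int c * z + of_int d \<noteq> 0" by (rule moebius_denom_nonzero [OF det z])
  ultimately show ?thesis
    unfolding phi_def Im_moebius [OF det]
    using modular_forms_transform [OF f det _ z] c
    by (simp add: norm_mult norm_power power_mult_distrib power_divide mult_ac flip: power_mult)
qed

text \<open>The norm of \<^term>\<open>phi\<close> to level 1; the factors correspond to the six cosets of
  \<open>Gamma0 5\<close> in \<^term>\<open>SL2Z\<close>.\<close>

definition Phi :: "complex \<Rightarrow> real" where
  "Phi z = phi z * (\<Prod>j<5::nat. phi (- 1 / (z + of_nat j)))"

lemma Phi_eq: "Phi z = phi z * phi (- 1 / z) * phi (- 1 / (z + 1)) * phi (- 1 / (z + 2)) *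
     phi (- 1 / (z + 3)) * phi (- 1 / (z + 4))"
  by (simp add: Phi_def eval_nat_numeral)

lemma Im_neg_inverse_pos: "Im z > 0 \<Longrightarrow> Im (- 1 / z) > 0"
  using Im_moebius [of 0 0 "-1" 1 z] by (auto intro!: divide_pos_pos)

text \<open>Translation moves the coset j to j + 1. It closes up because the cosets 0 and 5 agree
  through the matrix with rows (1, 0), (-5, 1).\<close>

lemma Phi_plus_1:
  assumes z: "Im z > 0"
  shows "Phi (z + 1) = Phi z"
proof -
  have "z \<noteq> 0" "z + 5 \<noteq> 0" using z by (auto simp: complex_eq_iff)
  have "phi (- 1 / z) = phi ((of_int 1 * (- 1 / z) + of_int 0) / (of_int (-5) * (- 1 / z) + of_int 1))"
    by (rule phi_transform [symmetric]) (use Im_neg_inverse_pos [OF z] in auto)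
  also have "(of_int 1 * (- 1 / z) + of_int 0) / (of_int (-5) * (- 1 / z) + of_int 1) = - 1 / (z + 5)"
    using \<open>z \<noteq> 0\<close> \<open>z + 5 \<noteq> 0\<close> by (simp add: divide_simps) (simp add: add_ac)
  finally have "phi (- 1 / z) = phi (- 1 / (z + 5))" .
  moreover have "phi (z + 1) = phi z"
    using phi_transform [of 1 1 1 0 z] z by simp
  ultimately show ?thesis by (simp add: Phi_eq add_ac mult_ac)
qed

text \<open>With S the inversion and T the translation, S T^j S equals a matrix in
  \<open>Gamma0 5\<close> times S T^j' exactly when j j' = -1 modulo 5; the matrix has rows (-j',
  -1), (j j' + 1, j). So inversion swaps 1 with 4 and fixes 2 and 3, while it swaps the trivial
  coset with j = 0.\<close>

lemma phi_coset:
  fixes j j' :: nat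
  assumes z: "Im z > 0" and jj: "5 dvd (int j * int j' + 1)"
  shows "phi (- 1 / (- 1 / z + of_nat j)) = phi (- 1 / (z + of_nat j'))"
proof -
  have w: "Im (z + of_nat j') > 0" using z by simp
  hence nz: "z \<noteq> 0" "z + of_nat j' \<noteq> 0" by (auto simp: complex_eq_iff)
  have "phi (- 1 / (z + of_nat j')) =
     phi ((of_int (- int j') * (- 1 / (z + of_nat j')) + of_int (-1)) /
          (of_int (int j * int j' + 1) * (- 1 / (z + of_nat j')) + of_int (int j)))"
    by (rule phi_transform [symmetric]) (use Im_neg_inverse_pos [OF w] jj in \<open>auto simp: algebra_simps\<close>)
  also have "of_int (- int j') * (- 1 / (z + of_nat j')) + of_int (-1) = - z / (z + of_nat j')"
    using nz by (simp add: field_simps)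
  also have "of_int (int j * int j' + 1) * (- 1 / (z + of_nat j')) + of_int (int j) =
               (of_nat j * z - 1) / (z + of_nat j')"
    using nz by (simp add: field_simps)
  also have "- z / (z + of_nat j') / ((of_nat j * z - 1) / (z + of_nat j')) = - z / (of_nat j * z - 1)"
    using nz by simp
  also have "\<dots> = - 1 / (- 1 / z + of_nat j)"
  proof -
    have "- 1 / z + of_nat j = (of_nat j * z - 1) / z" using nz by (simp add: field_simps)
    thus ?thesis by simp
  qed
  finally show ?thesis by simp
qed

lemma Phi_inversion:
  assumes z: "Im z > 0"
  shows "Phi (- 1 / z) = Phi z"
proof -
  have "z \<noteq> 0" using z by auto
  hence "phi (- 1 / (- 1 / z)) = phi z" by simp
  moreover have "phi (- 1 / (- 1 / z + 1)) = phi (- 1 / (z + 4))"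
    using phi_coset [OF z, of 1 4] by simp
  moreover have "phi (- 1 / (- 1 / z + 2)) = phi (- 1 / (z + 2))"
    using phi_coset [OF z, of 2 2] by simp
  moreover have "phi (- 1 / (- 1 / z + 3)) = phi (- 1 / (z + 3))"
    using phi_coset [OF z, of 3 3] by simp
  moreover have "phi (- 1 / (- 1 / z + 4)) = phi (- 1 / (z + 1))"
    using phi_coset [OF z, of 4 1] by simp
  ultimately show ?thesis unfolding Phi_eq by (simp add: mult_ac)
qed

text \<open>A holomorphic function of weight 6k underlying \<open>Phi\<close>. Invariance is read
  off from \<open>Phi\<close>, from which the values of the character have disappeared; holomorphy
  is read off from \<open>F\<close>.\<close>

definition F :: "complex \<Rightarrow> complex" where
  "F z = f z * (\<Prod>j<5::nat. slash k (0, -1, 1, 0) f (z + of_nat j))"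

lemma slash_S: "slash k (0, -1, 1, 0) f z = f (- 1 / z) / z ^ k"
  by (simp add: slash_def)

lemma f_hol: "f holomorphic_on upper_half_plane"
  using f by (simp add: modular_forms_def)

lemma slash_hol: "(\<lambda>z. slash k (0, -1, 1, 0) f (z + of_nat j)) holomorphic_on upper_half_plane"
proof -
  have nz: "z + of_nat j \<noteq> 0" if "z \<in> upper_half_plane" for z
    using that by (auto simp: upper_half_plane_def complex_eq_iff)
  have "(f \<circ> (\<lambda>z. - 1 / (z + of_nat j))) holomorphic_on upper_half_plane"
  proof (rule holomorphic_on_compose_gen [OF _ f_hol])
    show "(\<lambda>z. - 1 / (z + of_nat j)) ` upper_half_plane \<subseteq> upper_half_plane"
      using Im_neg_inverse_pos by (fastforce simp: upper_half_plane_def)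
  qed (use nz in \<open>auto intro!: holomorphic_intros\<close>)
  thus ?thesis
    unfolding slash_S o_def
    by (intro holomorphic_on_divide holomorphic_intros) (use nz in auto)
qed

lemma F_hol: "F holomorphic_on upper_half_plane"
  unfolding F_def [abs_def] by (intro holomorphic_intros f_hol slash_hol)

lemma Phi_F:
  assumes z: "Im z > 0"
  shows "Phi z = norm (F z) ^ 2 * Im z ^ (6 * k)"
proof -
  have "phi (- 1 / (z + of_nat j)) = norm (slash k (0, -1, 1, 0) f (z + of_nat j)) ^ 2 * Im z ^ k" for j
  proof -
    have "Im (- 1 / (z + of_nat j)) = Im z / norm (z + of_nat j) ^ 2"
      using Im_moebius [of 0 0 "-1" 1 "z + of_nat j"] by simp
    thus ?thesis
      unfolding phi_def slash_S
      by (simp add: norm_divide norm_power power_divide mult_ac flip: power_mult)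
  qed
  hence "Phi z = (norm (f z) ^ 2 * Im z ^ k) *
           (\<Prod>j<5::nat. norm (slash k (0, -1, 1, 0) f (z + of_nat j)) ^ 2 * Im z ^ k)"
    unfolding Phi_def by (simp add: phi_def)
  also have "\<dots> = norm (F z) ^ 2 * (Im z ^ k * (Im z ^ k) ^ 5)"
    by (simp add: F_def prod.distrib norm_mult prod_norm power_mult_distrib mult_ac flip: prod_power_distrib)
  also have "Im z ^ k * (Im z ^ k) ^ 5 = Im z ^ (6 * k)"
    by (simp flip: power_mult power_add)
  finally show ?thesis .
qed

text \<open>The factor f supplies the decay of order m; the other five factors are bounded because f
  is bounded at the cusp 0.\<close>

lemma F_decay:
  assumes "has_fourier_expansion f a" "\<And>n. n < m \<Longrightarrow> a n = 0"
  obtains B C where "\<And>z. B \<le> Im z \<Longrightarrow> norm (F z) \<le> C * exp (- 2 * pi * real m * Im z)"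
proof -
  obtain C where C: "\<And>z. 1 / 2 \<le> Im z \<Longrightarrow> norm (f z) \<le> C * exp (- 2 * pi * real m * Im z)"
    using fourier_expansion_decay [OF assms] by blast
  have "Bfun (slash k (0, -1, 1, 0) f) at_i_infinity"
    using f unfolding modular_forms_def SL2Z_def by auto
  then obtain B K where K: "\<And>z. B \<le> Im z \<Longrightarrow> norm (slash k (0, -1, 1, 0) f z) \<le> K"
    unfolding Bfun_at_i_infinity by blast
  have "norm (F z) \<le> (C * K ^ 5) * exp (- 2 * pi * real m * Im z)" if z: "max B (1 / 2) \<le> Im z" for z
  proof -
    have "norm (F z) = norm (f z) * (\<Prod>j<5::nat. norm (slash k (0, -1, 1, 0) f (z + of_nat j)))"
      by (simp add: F_def norm_mult prod_norm)
    also have "\<dots> \<le> (C * exp (- 2 * pi * real m * Im z)) * (\<Prod>j<5::nat. K)"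
    proof (rule mult_mono)
      show "norm (f z) \<le> C * exp (- 2 * pi * real m * Im z)" using C z by simp
      thus "0 \<le> C * exp (- 2 * pi * real m * Im z)" using norm_ge_zero order.trans by blast
      show "(\<Prod>j<5::nat. norm (slash k (0, -1, 1, 0) f (z + of_nat j))) \<le> (\<Prod>j<5::nat. K)"
        by (intro prod_mono conjI K) (use z in auto)
    qed (auto intro: prod_nonneg)
    finally show ?thesis by (simp add: mult_ac)
  qed
  thus ?thesis by (rule that)
qed

text \<open>Let \<open>G\<close> be \<open>F\<close> divided by the power m' of the nome. It still
  decays at infinity since m' < m, and its squared norm is \<open>Phi\<close> times exp(H(y)).
  \<open>Phi\<close> is maximal at a point of height at least sqrt 3 / 2, where H is increasing; so
  on a slightly lower line \<open>G\<close> is strictly smaller than at that point. Above this line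
  \<open>G\<close> then has an interior maximum, hence is constant, against its decay.\<close>

lemma F_eq_0:
  assumes exp: "has_fourier_expansion f a" "\<And>n. n < m \<Longrightarrow> a n = 0"
    and m: "3 * real k < pi * sqrt 3 * real m"
    and z1: "1 / 2 < Im z1"
  shows "F z1 = 0"
proof (rule ccontr)
  assume nz: "F z1 \<noteq> 0"
  have sqrt3: "sqrt 3 > 1" "sqrt 3 * sqrt 3 = (3 :: real)" by auto
  have "real k * sqrt 3 / pi < real m"
  proof -
    have "(real k * sqrt 3) * sqrt 3 < (pi * real m) * sqrt 3"
      using m sqrt3 by (simp add: algebra_simps)
    hence "real k * sqrt 3 < pi * real m" using sqrt3(1) by (simp only: mult_less_cancel_right_pos)
    thus ?thesis by (simp add: field_simps)
  qed
  \<comment> \<open>A real exponent with slack on both sides: below m for decay of \<open>G\<close>,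
    above the threshold for a positive derivative of H.\<close>
  then obtain m' where m': "real k * sqrt 3 / pi < m'" "m' < real m" using dense by blast
  obtain B C where BC: "\<And>z. B \<le> Im z \<Longrightarrow> norm (F z) \<le> C * exp (- 2 * pi * real m * Im z)"
    using F_decay [OF exp] by blast
  define G where "G = (\<lambda>z. F z * exp (- 2 * of_real pi * \<i> * of_real m' * z))"
  have normG: "norm (G z) = norm (F z) * exp (2 * pi * m' * Im z)" for z
    by (simp add: G_def norm_mult norm_exp_eq_Re)
  have G_hol: "G holomorphic_on upper_half_plane"
    unfolding G_def by (intro holomorphic_intros F_hol)
  have tend: "((\<lambda>y. C * exp (- 2 * pi * (real m - m') * y)) \<longlongrightarrow> 0) at_top"
    using m' by real_asymp
  have G_decay: "\<exists>B. \<forall>z. B \<le> Im z \<longrightarrow> norm (G z) < e" if "e > 0" for e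
  proof -
    have "eventually (\<lambda>y. C * exp (- 2 * pi * (real m - m') * y) < e) at_top"
      by (rule order_tendstoD (2) [OF tend that])
    then obtain B' where B': "\<And>y. y \<ge> B' \<Longrightarrow> C * exp (- 2 * pi * (real m - m') * y) < e"
      unfolding eventually_at_top_linorder by blast
    have "norm (G z) < e" if z: "max B B' \<le> Im z" for z
    proof -
      have "norm (G z) \<le> (C * exp (- 2 * pi * real m * Im z)) * exp (2 * pi * m' * Im z)"
        unfolding normG by (intro mult_right_mono BC) (use z in auto)
      also have "\<dots> = C * exp (- 2 * pi * (real m - m') * Im z)"
        by (simp add: algebra_simps flip: exp_add)
      also have "\<dots> < e" using B' z by simp
      finally show ?thesis .
    qed
    thus ?thesis by blast
  qed
  have "real m > 0" using m' by (smt (verit) divide_nonneg_pos mult_nonneg_nonneg of_nat_0_le_iff pi_gt_zero real_sqrt_ge_0_iff)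
  have tend2: "((\<lambda>y. (C * exp (- 2 * pi * real m * y)) ^ 2 * y ^ (6 * k)) \<longlongrightarrow> 0) at_top"
  proof -
    define c where "c = 4 * pi * real m"
    have c: "c > 0" using \<open>real m > 0\<close> by (simp add: c_def)
    have "filterlim (\<lambda>y. c * y) at_top at_top"
      using c by real_asymp
    from filterlim_compose [OF tendsto_power_div_exp_0 this]
    have "((\<lambda>y. C ^ 2 / c ^ (6 * k) * ((c * y) ^ (6 * k) / exp (c * y))) \<longlongrightarrow> C ^ 2 / c ^ (6 * k) * 0) at_top"
      by (intro tendsto_mult tendsto_const)
    moreover have "C ^ 2 / c ^ (6 * k) * ((c * y) ^ (6 * k) / exp (c * y)) =
        (C * exp (- 2 * pi * real m * y)) ^ 2 * y ^ (6 * k)" for y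
    proof -
      have "exp (- 2 * pi * real m * y) ^ 2 = inverse (exp (c * y))"
        by (simp add: c_def mult_ac flip: exp_of_nat_mult exp_minus)
      thus ?thesis using c by (simp add: power_mult_distrib divide_inverse)
    qed
    ultimately show ?thesis by simp
  qed
  have Phi_decay: "\<exists>B. \<forall>z. B \<le> Im z \<longrightarrow> Phi z < e" if "e > 0" for e
  proof -
    have "eventually (\<lambda>y. (C * exp (- 2 * pi * real m * y)) ^ 2 * y ^ (6 * k) < e) at_top"
      by (rule order_tendstoD (2) [OF tend2 that])
    then obtain B' where B': "\<And>y. y \<ge> B' \<Longrightarrow> (C * exp (- 2 * pi * real m * y)) ^ 2 * y ^ (6 * k) < e"
      unfolding eventually_at_top_linorder by blast
    have "Phi z < e" if z: "max 1 (max B B') \<le> Im z" for z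
    proof -
      have "Phi z = norm (F z) ^ 2 * Im z ^ (6 * k)" by (rule Phi_F) (use z in auto)
      also have "\<dots> \<le> (C * exp (- 2 * pi * real m * Im z)) ^ 2 * Im z ^ (6 * k)"
        by (intro mult_right_mono power_mono BC) (use z in auto)
      also have "\<dots> < e" using B' z by simp
      finally show ?thesis .
    qed
    thus ?thesis by blast
  qed
  have Phi_pos: "Phi z1 > 0" using Phi_F [of z1] nz z1 by simp
  have F_cont: "continuous_on {z. c \<le> Im z} F" if "c > 0" for c
    by (rule continuous_on_subset [OF holomorphic_on_imp_continuous_on [OF F_hol]])
       (use that in \<open>auto simp: upper_half_plane_def\<close>)
  obtain z0 where z0: "1 / 2 \<le> Im z0" "\<bar>Re z0\<bar> \<le> 1 / 2" "Phi z0 > 0"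
      and max0: "\<And>z. 1 / 2 \<le> Im z \<Longrightarrow> Phi z \<le> Phi z0"
  proof (rule periodic_attains_max [of "1/2" Phi z1])
    have "continuous_on {z. 1/2 \<le> Im z} (\<lambda>z. norm (F z) ^ 2 * Im z ^ (6 * k))"
      by (intro continuous_intros F_cont) auto
    thus "continuous_on {z. 1/2 \<le> Im z} Phi"
      by (rule continuous_on_eq) (auto simp: Phi_F)
  qed (use Phi_plus_1 Phi_decay Phi_pos z1 in auto)
  obtain z2 where z2: "sqrt 3 / 2 \<le> Im z2" "Phi z2 = Phi z0"
  proof (cases "sqrt 3 / 2 \<le> Im z0")
    case False
    define y where "y = Im z0"
    have y: "1 / 2 \<le> y" "y \<le> sqrt 3 / 2" using False z0 by (auto simp: y_def)
    have "0 \<le> (y - 1 / 2) * (sqrt 3 / 2 - y)" using y by simp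
    have "\<bar>Re z0\<bar> ^ 2 \<le> (1 / 2) ^ 2" by (rule power_mono) (use z0 in auto)
    hence n: "norm z0 ^ 2 \<le> 1 / 4 + y ^ 2" unfolding cmod_power2 y_def by (simp add: power2_eq_square)
    \<comment> \<open>The quadratic sqrt 3 / 2 * (1/4 + y^2) - y has roots 1 / (2 sqrt 3) and sqrt 3
      / 2. As y >= 1/2 lies between them, a single inversion lifts the point to height at least sqrt
      3 / 2.\<close>
    have "0 \<le> (sqrt 3 / 2 - y) * (y * sqrt 3 - 1 / 2)"
      using y sqrt3 mult_mono [of "1/2" y 1 "sqrt 3"] by (intro mult_nonneg_nonneg) auto
    hence "sqrt 3 / 2 * (1 / 4 + y ^ 2) \<le> y"
      using sqrt3 by (simp add: algebra_simps power2_eq_square)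
    hence "sqrt 3 / 2 * norm z0 ^ 2 \<le> y"
      using n sqrt3 by (smt (verit) mult_left_mono divide_nonneg_pos)
    moreover have "norm z0 ^ 2 > 0" using z0 by auto
    ultimately have "sqrt 3 / 2 \<le> y / norm z0 ^ 2" by (simp add: pos_le_divide_eq)
    also have "\<dots> = Im (- 1 / z0)" using Im_moebius [of 0 0 "-1" 1 z0] by (simp add: y_def)
    finally show ?thesis using that [of "- 1 / z0"] Phi_inversion [of z0] z0 by simp
  qed (use that in blast)
  define y0 where "y0 = Im z2"
  have y0: "y0 > 1 / 2" using z2(1) sqrt3(1) unfolding y0_def by linarith
  \<comment> \<open>The logarithm of the factor relating the squared norm of \<open>G\<close> to
    \<open>Phi\<close>. Its critical point 6k / (4 pi m') lies below sqrt 3 / 2 by the choice of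
    m'.\<close>
  define H where "H = (\<lambda>y. 4 * pi * m' * y - 6 * real k * ln y)"
  have "(H has_real_derivative 4 * pi * m' - 6 * real k * (1 / y0)) (at y0)"
    unfolding H_def using y0 by (auto intro!: derivative_eq_intros simp: field_simps)
  moreover have "0 < 4 * pi * m' - 6 * real k * (1 / y0)"
  proof -
    have "6 * real k * (1 / y0) \<le> 6 * real k * (1 / (sqrt 3 / 2))"
      using z2 sqrt3 y0 by (intro mult_left_mono divide_left_mono) (auto simp: y0_def)
    also have "1 / (sqrt 3 / 2) = 2 * sqrt 3 / 3"
      using sqrt3 by (simp add: field_simps)
    also have "6 * real k * (2 * sqrt 3 / 3) = 4 * (real k * sqrt 3)" by simp
    also have "real k * sqrt 3 < pi * m'" using m'(1) by (simp add: field_simps)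
    finally show ?thesis by simp
  qed
  ultimately obtain d where d: "d > 0" "\<And>h. 0 < h \<Longrightarrow> h < d \<Longrightarrow> H (y0 - h) < H y0"
    using DERIV_pos_inc_left by blast
  \<comment> \<open>The line must be close enough to \<open>y0\<close> for H to be smaller there,
    yet not below 1/2, where the maximality of \<open>Phi z0\<close> is no longer known.\<close>
  define h where "h = min (d / 2) (y0 - 1 / 2)"
  define y1 where "y1 = y0 - h"
  have y1: "1 / 2 \<le> y1" "y1 < y0" "H y1 < H y0"
    using d y0 by (auto simp: y1_def h_def min_def)
  have expH: "exp (H y) = exp (2 * pi * m' * y) ^ 2 / y ^ (6 * k)" if "y > 0" for y
  proof -
    have "exp (6 * real k * ln y) = y ^ (6 * k)"
      using exp_of_nat_mult [of "6 * k" "ln y"] that by simp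
    thus ?thesis by (simp add: H_def exp_diff mult_ac flip: exp_of_nat_mult)
  qed
  have G_Phi: "norm (G z) ^ 2 = Phi z * exp (H (Im z))" if "Im z > 0" for z
    using that by (simp add: normG Phi_F expH power_mult_distrib)
  have Gz2: "norm (G z2) ^ 2 = Phi z0 * exp (H y0)"
    using G_Phi [of z2] z2 y0 by (simp add: y0_def)
  have line: "norm (G z) < norm (G z2)" if "Im z = y1" for z
  proof -
    have "norm (G z) ^ 2 = Phi z * exp (H y1)" using G_Phi [of z] that y1 by simp
    also have "\<dots> \<le> Phi z0 * exp (H y1)" using max0 [of z] that y1 by simp
    also have "\<dots> < norm (G z2) ^ 2" unfolding Gz2 using z0 y1 by simp
    finally show ?thesis by (rule power_less_imp_less_base) simp
  qed
  have perG: "norm (G (z + 1)) = norm (G z)" if "Im z > 0" for z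
  proof (rule power2_eq_imp_eq)
    have "norm (G (z + 1)) ^ 2 = Phi (z + 1) * exp (H (Im (z + 1)))" using that by (intro G_Phi) simp
    also have "\<dots> = norm (G z) ^ 2" using Phi_plus_1 [OF that] G_Phi [OF that] by simp
    finally show "norm (G (z + 1)) ^ 2 = norm (G z) ^ 2" .
  qed auto
  have Gz2_pos: "norm (G z2) > 0"
  proof -
    have "norm (G z2) ^ 2 > 0" unfolding Gz2 using z0 by simp
    thus ?thesis by simp
  qed
  obtain z3 where z3: "y1 \<le> Im z3" "norm (G z3) > 0" and max3: "\<And>z. y1 \<le> Im z \<Longrightarrow> norm (G z) \<le> norm (G z3)"
  proof (rule periodic_attains_max [of y1 "\<lambda>z. norm (G z)" z2])
    show "continuous_on {z. y1 \<le> Im z} (\<lambda>z. norm (G z))"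
      unfolding G_def by (intro continuous_intros F_cont) (use y1 in auto)
  qed (use perG G_decay Gz2_pos y1 in \<open>auto simp: y0_def\<close>)
  have "Im z3 \<noteq> y1" using line [of z3] max3 [of z2] y1 by (force simp: y0_def)
  hence z3': "y1 < Im z3" using z3 by simp
  have "G constant_on {z. y1 < Im z}"
  proof (rule maximum_modulus_principle [of G _ "{z. y1 < Im z}" z3])
    show "G holomorphic_on {z. y1 < Im z}"
      by (rule holomorphic_on_subset [OF G_hol]) (use y1 in \<open>auto simp: upper_half_plane_def\<close>)
    show "connected {z. y1 < Im z}"
      by (intro convex_connected convex_halfspace_Im_gt)
  qed (use z3' max3 in \<open>auto intro!: open_halfspace_Im_gt\<close>)
  then obtain c where c: "\<And>z. y1 < Im z \<Longrightarrow> G z = c" unfolding constant_on_def by auto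
  obtain B' where B': "\<And>z. B' \<le> Im z \<Longrightarrow> norm (G z) < norm (G z3)" using G_decay z3 by blast
  have "norm (G (\<i> * of_real (max B' (y1 + 1)))) < norm (G z3)" by (rule B') simp
  moreover have "G (\<i> * of_real (max B' (y1 + 1))) = c" by (rule c) (auto simp: max_def)
  moreover have "G z3 = c" by (rule c [OF z3'])
  ultimately show False by simp
qed

text \<open>Since \<open>F\<close> vanishes above height 1/2, one of its six factors does. If that
  factor comes from the cusp 0, the inversion carries its zeros to an open set on which f vanishes;
  the identity theorem does the rest. The valence formula would need only k < 2 m instead of the
  bound assumed here.\<close>

theorem sturm:
  assumes exp: "has_fourier_expansion f a" "\<And>n. n < m \<Longrightarrow> a n = 0"
    and m: "3 * real k < pi * sqrt 3 * real m"
    and z: "Im z > 0"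
  shows "f z = 0"
proof -
  define U where "U = {z. 1 / 2 < Im z}"
  have U: "open U" "connected U"
    unfolding U_def by (intro open_halfspace_Im_gt convex_connected convex_halfspace_Im_gt)+
  have "\<i> \<in> U" by (simp add: U_def)
  hence U': "U \<noteq> {}" "U \<subseteq> upper_half_plane"
    by (auto simp: U_def upper_half_plane_def intro!: exI [of _ \<i>])
  define g where "g = (\<lambda>i z. if i = 0 then f z else slash k (0, -1, 1, 0) f (z + of_nat (i - 1)))"
  have g0: "g 0 = f" and gS: "g (Suc j) = (\<lambda>z. slash k (0, -1, 1, 0) f (z + of_nat j))" for j
    by (auto simp: g_def)
  have "\<exists>i\<in>{..<6}. \<forall>z\<in>U. g i z = 0"
  proof (rule prod_holomorphic_eq_0)
    show "g i holomorphic_on U" for i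
      by (cases i) (simp_all add: g0 gS holomorphic_on_subset [OF f_hol U'(2)]
            holomorphic_on_subset [OF slash_hol U'(2)])
    show "(\<Prod>i<6. g i z) = 0" if "z \<in> U" for z
    proof -
      have "(\<Prod>i<Suc 5. g i z) = g 0 z * (\<Prod>i<5. g (Suc i) z)" by (rule prod.lessThan_Suc_shift)
      also have "\<dots> = F z" by (simp only: g0 gS F_def)
      also have "\<dots> = 0" using F_eq_0 [OF exp m] that by (simp add: U_def)
      finally show ?thesis by simp
    qed
  qed (use U U' in auto)
  then obtain i where i: "\<And>z. z \<in> U \<Longrightarrow> g i z = 0" by blast
  obtain W where W: "open W" "W \<noteq> {}" "W \<subseteq> upper_half_plane" "\<And>w. w \<in> W \<Longrightarrow> f w = 0"
  proof (cases i)
    case 0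
    thus ?thesis using that [of U] U U' i g0 by auto
  next
    case (Suc j)
    define W where "W = (\<lambda>w. - 1 / w) -` U \<inter> upper_half_plane"
    have oU: "open upper_half_plane" unfolding upper_half_plane_def by (rule open_halfspace_Im_gt)
    have "continuous_on upper_half_plane (\<lambda>w. - 1 / w)"
      by (intro continuous_intros) (auto simp: upper_half_plane_def)
    hence "open W" unfolding W_def
      using continuous_open_preimage [OF _ oU U(1)] by (simp add: Int_commute)
    moreover have "\<i> \<in> W" by (simp add: W_def U_def upper_half_plane_def)
    moreover have "f w = 0" if w: "w \<in> W" for w
    proof -
      have "w \<noteq> 0" using w by (auto simp: W_def upper_half_plane_def)
      have "- 1 / w - of_nat j \<in> U" using w by (simp add: W_def U_def)
      hence "g (Suc j) (- 1 / w - of_nat j) = 0" using i Suc by blast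
      thus ?thesis unfolding gS slash_S using \<open>w \<noteq> 0\<close> by simp
    qed
    moreover have "W \<subseteq> upper_half_plane" by (simp add: W_def)
    ultimately show ?thesis using that [of W] by blast
  qed
  have "open upper_half_plane" "connected upper_half_plane"
    unfolding upper_half_plane_def
    by (intro open_halfspace_Im_gt convex_connected convex_halfspace_Im_gt)+
  thus ?thesis
    using analytic_continuation_open [of W upper_half_plane f "\<lambda>_. 0" z] W f_hol z
    by (auto simp: upper_half_plane_def)
qed

end

section \<open>Eisenstein lattice sums of level 5\<close>

text \<open>The imaginary part of m z + n controls m, and the triangle inequality then controls n;
  this gives the two quantities in the minimum.\<close>

lemma lattice_lower_bound:
  assumes "Im z > 0"
  obtains \<delta> where "\<delta> > 0" "\<And>m n :: int. \<delta> * max \<bar>of_int m\<bar> \<bar>of_int n\<bar> \<le> norm (of_int m * z + of_int n)"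
proof -
  define \<delta> where "\<delta> = min (Im z) (Im z / (Im z + norm z))"
  have pos: "Im z + norm z > 0" using assms by (simp add: add_pos_nonneg)
  have "\<delta> * max \<bar>of_int m\<bar> \<bar>of_int n\<bar> \<le> norm (of_int m * z + of_int n)" for m n :: int
  proof -
    let ?N = "norm (of_int m * z + of_int n)"
    have "\<bar>Im (of_int m * z + of_int n)\<bar> \<le> ?N" by (rule abs_Im_le_cmod)
    hence m: "Im z * \<bar>of_int m\<bar> \<le> ?N" using assms by (simp add: abs_mult mult.commute)
    have "norm (of_int n :: complex) \<le> ?N + norm (of_int m * z)"
      using norm_triangle_ineq4 [of "of_int m * z + of_int n" "of_int m * z"] by simp
    hence "\<bar>of_int n\<bar> \<le> ?N + \<bar>of_int m\<bar> * norm z" by (simp add: norm_mult)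
    hence "Im z * \<bar>of_int n\<bar> \<le> Im z * (?N + \<bar>of_int m\<bar> * norm z)"
      using assms by (intro mult_left_mono) auto
    also have "\<dots> = Im z * ?N + (Im z * \<bar>of_int m\<bar>) * norm z" by (simp add: algebra_simps)
    also have "\<dots> \<le> Im z * ?N + ?N * norm z" using m by (intro add_left_mono mult_right_mono) auto
    finally have "Im z / (Im z + norm z) * \<bar>of_int n\<bar> \<le> ?N" using pos by (simp add: field_simps)
    moreover have "\<delta> * \<bar>of_int n\<bar> \<le> Im z / (Im z + norm z) * \<bar>of_int n\<bar>" "\<delta> * \<bar>of_int m\<bar> \<le> Im z * \<bar>of_int m\<bar>"
      by (intro mult_right_mono; simp add: \<delta>_def)+
    ultimately show ?thesis using m by (simp add: max_def)
  qed
  moreover have "\<delta> > 0" using assms pos by (simp add: \<delta>_def)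
  ultimately show ?thesis using that by blast
qed

lemma summable_on_int_powr:
  assumes "s < -1"
  shows "(\<lambda>n::int. (1 + \<bar>of_int n\<bar>) powr s :: real) summable_on UNIV"
proof -
  have 1: "summable (\<lambda>n. real (Suc n) powr s)"
    using summable_real_powr_iff [of s] assms by (subst summable_Suc_iff) auto
  hence 2: "summable (\<lambda>n. real (Suc (Suc n)) powr s)"
    by (subst summable_Suc_iff [where f = "\<lambda>n. real (Suc n) powr s"])
  have "(\<lambda>k. (1 + \<bar>of_int (int k)\<bar>) powr s :: real) summable_on UNIV"
    "(\<lambda>k. (1 + \<bar>of_int (- int k - 1)\<bar>) powr s :: real) summable_on UNIV"
    using 1 2 by (auto intro!: norm_summable_imp_summable_on simp: add_ac)
  thus ?thesis
    using has_sum_int_split [of "\<lambda>n. (1 + \<bar>of_int n\<bar>) powr s :: real"]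
    unfolding summable_on_def by blast
qed

text \<open>The cube of the maximum of the absolute values of m and n is bounded below by (1 +
  |m|)^(3/2) * (1 + |n|)^(3/2) / 8. This separates the variables, and the exponent -3/2 is still
  summable, which is why weight 3 is enough.\<close>

lemma abs_summable_lattice:
  assumes z: "Im z > 0" and k: "k \<ge> 3" and \<phi>: "\<And>m n. norm (\<phi> m n) \<le> K"
  shows "(\<lambda>mn. norm (case mn of (m, n) \<Rightarrow> \<phi> m n / (of_int m * z + of_int n) ^ k)) summable_on (UNIV - {(0, 0)})"
proof -
  obtain \<delta> where \<delta>: "\<delta> > 0" "\<And>m n :: int. \<delta> * max \<bar>of_int m\<bar> \<bar>of_int n\<bar> \<le> norm (of_int m * z + of_int n)"
    using lattice_lower_bound [OF z] by blast
  have K: "K \<ge> 0" using \<phi> [of 0 0] norm_ge_zero order.trans by blast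
  define h where "h = (\<lambda>n::int. (1 + \<bar>of_int n\<bar>) powr (- 3 / 2) :: real)"
  have h_nonneg: "h n \<ge> 0" for n by (simp add: h_def)
  have h: "h summable_on UNIV" unfolding h_def by (rule summable_on_int_powr) simp
  have "(\<lambda>(m, n). h m * h n) summable_on (UNIV \<times> UNIV)"
    by (rule summable_on_SigmaI [where g = "\<lambda>m. h m * infsum h UNIV"])
       (use h_nonneg in \<open>auto intro!: has_sum_cmult_right has_sum_infsum h summable_on_cmult_left\<close>)
  hence "(\<lambda>(m, n). h m * h n) summable_on (UNIV - {(0, 0)})"
    by (rule summable_on_subset) auto
  hence "(\<lambda>mn. (K / \<delta> ^ k * 8) * (\<lambda>(m, n). h m * h n) mn) summable_on (UNIV - {(0, 0)})"
    by (rule summable_on_cmult_right)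
  thus ?thesis
  proof (rule Infinite_Sum.abs_summable_on_comparison_test')
    fix mn :: "int \<times> int" assume "mn \<in> UNIV - {(0, 0)}"
    then obtain m n where mn: "mn = (m, n)" "m \<noteq> 0 \<or> n \<noteq> 0" by (cases mn) auto
    define M where "M = max \<bar>real_of_int m\<bar> \<bar>real_of_int n\<bar>"
    have M: "M \<ge> 1" using mn(2) by (auto simp: M_def le_max_iff_disj)
    let ?N = "norm (of_int m * z + of_int n)"
    have N: "?N \<ge> \<delta> * M" using \<delta> unfolding M_def by blast
    have le: "(1 + \<bar>real_of_int m\<bar>) * (1 + \<bar>of_int n\<bar>) \<le> (2 * M) * (2 * M)"
      using M by (intro mult_mono) (auto simp: M_def)
    have "h m * h n = ((1 + \<bar>real_of_int m\<bar>) * (1 + \<bar>of_int n\<bar>)) powr (- 3 / 2)"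
      unfolding h_def by (subst powr_mult) auto
    also have "\<dots> \<ge> ((2 * M) * (2 * M)) powr (- 3 / 2)"
      by (rule powr_mono2') (use le in \<open>auto intro!: mult_pos_pos add_pos_nonneg\<close>)
    also have "((2 * M) * (2 * M)) powr (- 3 / 2) = 1 / (2 * M) ^ 3"
    proof -
      have "((2 * M) * (2 * M)) = (2 * M) powr 2" using M by (subst powr_numeral) (auto simp: power2_eq_square)
      hence "((2 * M) * (2 * M)) powr (- 3 / 2) = (2 * M) powr (- 3)" by (simp add: powr_powr)
      also have "\<dots> = inverse ((2 * M) powr 3)" by (rule powr_minus)
      also have "(2 * M) powr 3 = (2 * M) ^ 3" using M by (intro powr_numeral) auto
      also have "inverse ((2 * M) ^ 3) = 1 / (2 * M) ^ 3" by (rule inverse_eq_divide)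
      finally show ?thesis .
    qed
    finally have hh: "1 / M ^ 3 \<le> 8 * (h m * h n)" using M by (simp add: field_simps)
    have "norm (\<phi> m n / (of_int m * z + of_int n) ^ k) = norm (\<phi> m n) / ?N ^ k"
      by (simp add: norm_divide norm_power)
    also have "\<dots> \<le> K / (\<delta> * M) ^ k"
      using N M \<delta>(1) \<phi> K by (intro frac_le power_mono) auto
    also have "\<dots> = K / \<delta> ^ k * (1 / M ^ k)" by (simp add: power_mult_distrib)
    also have "\<dots> \<le> K / \<delta> ^ k * (1 / M ^ 3)"
      using M K \<delta>(1) k by (intro mult_left_mono divide_left_mono power_increasing) auto
    also have "\<dots> \<le> K / \<delta> ^ k * (8 * (h m * h n))"
      using K \<delta>(1) by (intro mult_left_mono hh) auto
    finally show "norm (case mn of (m, n) \<Rightarrow> \<phi> m n / (of_int m * z + of_int n) ^ k)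
        \<le> (K / \<delta> ^ k * 8) * (case mn of (m, n) \<Rightarrow> h m * h n)"
      by (simp add: mn mult_ac)
  qed
qed

lemma has_sum_mod5:
  fixes g :: "int \<Rightarrow> complex"
  assumes "\<And>a. a < 5 \<Longrightarrow> ((\<lambda>j. g (int a + 5 * j)) has_sum s a) UNIV"
  shows "(g has_sum (\<Sum>a<5. s a)) UNIV"
proof -
  define B where "B = (\<lambda>a. range (\<lambda>j. int a + 5 * j))"
  have B: "x \<in> B a \<longleftrightarrow> x mod 5 = int a" if "a < 5" for x a
  proof
    assume "x mod 5 = int a"
    hence "x = int a + 5 * (x div 5)" using mult_div_mod_eq [of 5 x] by linarith
    thus "x \<in> B a" unfolding B_def by blast
  qed (use that in \<open>auto simp: B_def\<close>)
  have "(g has_sum (\<Sum>a<5. s a)) (\<Union>a\<in>{..<5}. B a)"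
  proof (rule sum_has_sum)
    show "(g has_sum s a) (B a)" if "a \<in> {..<5}" for a
      using assms [of a] that unfolding B_def by (subst has_sum_reindex) (auto simp: o_def inj_on_def)
    show "B a \<inter> B a' = {}" if "a \<in> {..<5}" "a' \<in> {..<5}" "a \<noteq> a'" for a a'
      using B that by fastforce
  qed auto
  also have "(\<Union>a\<in>{..<5}. B a) = UNIV"
  proof -
    have "x \<in> B (nat (x mod 5))" "nat (x mod 5) < 5" for x
      using B [of "nat (x mod 5)" x] by (auto simp: nat_less_iff)
    thus ?thesis by blast
  qed
  finally show ?thesis .
qed

lemma periodic5_shift:
  fixes g :: "int \<Rightarrow> 'a"
  assumes "\<And>n. g (n + 5) = g n"
  shows "g (n + 5 * j) = g n"
proof (induction j rule: int_induct [of _ 0])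
  case (step1 i)
  show ?case using assms [of "n + 5 * i"] step1 by (simp add: algebra_simps)
next
  case (step2 i)
  show ?case using assms [of "n + 5 * (i - 1)"] step2 by (simp add: algebra_simps)
qed simp

definition lipschitz_const :: "nat \<Rightarrow> complex" where
  "lipschitz_const p = (- 2 * of_real pi * \<i>) ^ Suc p / fact p"

text \<open>Split n into residue classes a modulo 5 and apply the Lipschitz formula at (w + a) / 5.
  Non-integrality is demanded only where g is nonzero, so w = 0 is admissible for a character; that
  case evaluates the constant term of the Eisenstein series.\<close>

lemma twisted_lipschitz:
  fixes g :: "int \<Rightarrow> complex"
  assumes per: "\<And>n. g (n + 5) = g n" and p: "p > 0"
    and w: "\<And>a. a < 5 \<Longrightarrow> g (int a) \<noteq> 0 \<Longrightarrow> (w + of_nat a) / 5 \<notin> \<int>"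
  shows "((\<lambda>n. g n / (w + of_int n) ^ Suc p) has_sum
           (lipschitz_const p / 5 ^ Suc p *
            (\<Sum>a<5. g (int a) * poly (lipschitz_poly p) (1 / (1 - nome ((w + of_nat a) / 5)))))) UNIV"
proof -
  have "((\<lambda>n. g n / (w + of_int n) ^ Suc p) has_sum
     (\<Sum>a<5. lipschitz_const p / 5 ^ Suc p *
        (g (int a) * poly (lipschitz_poly p) (1 / (1 - nome ((w + of_nat a) / 5)))))) UNIV"
  proof (rule has_sum_mod5)
    fix a :: nat assume a: "a < 5"
    show "((\<lambda>j. g (int a + 5 * j) / (w + of_int (int a + 5 * j)) ^ Suc p) has_sum
      lipschitz_const p / 5 ^ Suc p * (g (int a) *
        poly (lipschitz_poly p) (1 / (1 - nome ((w + of_nat a) / 5))))) UNIV"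
    proof (cases "g (int a) = 0")
      case False
      let ?u = "(w + of_nat a) / 5"
      have "((\<lambda>j. g (int a) / 5 ^ Suc p * inverse ((?u + of_int j) ^ Suc p)) has_sum
         (g (int a) / 5 ^ Suc p * (lipschitz_const p * poly (lipschitz_poly p) (1 / (1 - nome ?u))))) UNIV"
        unfolding lipschitz_const_def
        by (intro has_sum_cmult_right lipschitz_has_sum w a False p)
      also have "(\<lambda>j. g (int a) / 5 ^ Suc p * inverse ((?u + of_int j) ^ Suc p)) =
                 (\<lambda>j. g (int a + 5 * j) / (w + of_int (int a + 5 * j)) ^ Suc p)"
      proof
        fix j
        have "w + of_int (int a + 5 * j) = 5 * (?u + of_int j)" by simp
        hence "(w + of_int (int a + 5 * j)) ^ Suc p = 5 ^ Suc p * (?u + of_int j) ^ Suc p"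
          by (simp only: power_mult_distrib)
        thus "g (int a) / 5 ^ Suc p * inverse ((?u + of_int j) ^ Suc p) =
              g (int a + 5 * j) / (w + of_int (int a + 5 * j)) ^ Suc p"
          by (simp only: periodic5_shift [of g, OF per] divide_inverse inverse_mult_distrib mult.assoc)
      qed
      finally show ?thesis by (simp only: mult_ac times_divide_eq_left times_divide_eq_right)
    qed (simp add: periodic5_shift [of g, OF per])
  qed
  thus ?thesis by (simp only: sum_distrib_left)
qed

definition dft5 :: "(int \<Rightarrow> complex) \<Rightarrow> nat \<Rightarrow> complex" where
  "dft5 g d = (\<Sum>a<5. g (int a) * nome (of_nat a / 5) ^ d)"

lemma twisted_lipschitz_series:
  fixes g :: "int \<Rightarrow> complex"
  assumes "Im w > 0"
  shows "(\<lambda>d. of_nat d ^ p * dft5 g d * nome (w / 5) ^ d) sums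
          (\<Sum>a<5. g (int a) * poly (lipschitz_poly p) (1 / (1 - nome ((w + of_nat a) / 5))))"
proof -
  have "(\<lambda>d. \<Sum>a<5. g (int a) * (of_nat d ^ p * nome ((w + of_nat a) / 5) ^ d)) sums
          (\<Sum>a<5. g (int a) * poly (lipschitz_poly p) (1 / (1 - nome ((w + of_nat a) / 5))))"
    by (intro sums_sum sums_mult sums_lipschitz_poly norm_nome_less_1) (use assms in auto)
  moreover have "(\<Sum>a<5. g (int a) * (of_nat d ^ p * nome ((w + of_nat a) / 5) ^ d)) =
       of_nat d ^ p * dft5 g d * nome (w / 5) ^ d" for d
    unfolding dft5_def
    by (simp add: add_divide_distrib nome_add power_mult_distrib sum_distrib_left sum_distrib_right mult_ac)
  ultimately show ?thesis by simp
qed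

lemma norm_dft5_le:
  assumes "\<And>n. norm (g n) \<le> K"
  shows "norm (dft5 g d) \<le> 5 * K"
proof -
  have "norm (dft5 g d) \<le> (\<Sum>a<5::nat. K)"
    unfolding dft5_def using assms
    by (intro sum_norm_le) (auto simp: norm_mult norm_power norm_nome)
  thus ?thesis by simp
qed

section \<open>Fourier expansion of lattice sums in q^(1/5)\<close>

definition lattice_sum :: "nat \<Rightarrow> (int \<Rightarrow> int \<Rightarrow> complex) \<Rightarrow> complex \<Rightarrow> complex" where
  "lattice_sum k \<phi> z = (\<Sum>\<^sub>\<infinity>(m, n) \<in> UNIV - {(0, 0)}. \<phi> m n / (of_int m * z + of_int n) ^ k)"

text \<open>Index 0 is the row m = 0. The rows m and -m contribute equally, hence the factor 2, and
  N = m d collects the d-th term of row m.\<close>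

definition lattice_coeff :: "nat \<Rightarrow> (int \<Rightarrow> int \<Rightarrow> complex) \<Rightarrow> nat \<Rightarrow> complex" where
  "lattice_coeff p \<phi> N =
     (if N = 0 then (\<Sum>\<^sub>\<infinity>n\<in>UNIV - {0}. \<phi> 0 n / of_int n ^ Suc p)
      else 2 * lipschitz_const p / 5 ^ Suc p * (\<Sum>d | d dvd N. of_nat d ^ p * dft5 (\<phi> (int (N div d))) d))"

text \<open>For m, d >= 1 one has m + d <= m d + 1, so r^(m d) <= r^m * r^d / r is a majorant with
  separated variables. The division by r is the reason for treating Q = 0 apart.\<close>

lemma summable_divisor_terms:
  fixes Q :: complex and p :: nat
  assumes Q: "norm Q < 1" and b: "\<And>m d. norm (b m d) \<le> K"
  shows "(\<lambda>(m, d). of_nat d ^ p * b m d * (Q ^ m) ^ d) summable_on ({1::nat..} \<times> {1::nat..})"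
proof (cases "Q = 0")
  case True
  have "(\<lambda>(m, d). of_nat d ^ p * b m d * (Q ^ m) ^ d) summable_on ({1::nat..} \<times> {1::nat..}) \<longleftrightarrow>
        (\<lambda>_. 0 :: complex) summable_on ({1::nat..} \<times> {1::nat..})"
    by (rule summable_on_cong) (use True in auto)
  thus ?thesis by simp
next
  case False
  define r where "r = norm Q"
  have r: "0 < r" "r < 1" using Q False by (auto simp: r_def)
  have K: "K \<ge> 0" using b [of 0 0] norm_ge_zero order.trans by blast
  have "summable (\<lambda>m. norm (r ^ m))" using r by (auto intro: summable_geometric)
  hence s1: "(\<lambda>m. r ^ m) summable_on {1..}"
    by (intro summable_on_subset [OF norm_summable_imp_summable_on]) auto
  have "summable (\<lambda>d. norm (real d ^ p * r ^ d))"
  proof -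
    have "summable (\<lambda>d. norm (of_nat d ^ p * (of_real ((r + 1) / 2)) ^ d * (of_real (r / ((r+1)/2))) ^ d :: complex))"
    proof (rule powser_insidea)
      show "summable (\<lambda>d. of_nat d ^ p * (of_real ((r + 1) / 2)) ^ d * (1 :: complex) ^ d)"
        using sums_lipschitz_poly [of "of_real ((r + 1) / 2)" p] r
        by (auto intro!: sums_summable simp del: of_real_divide of_real_add)
    qed (use r in \<open>auto simp: norm_divide field_simps simp flip: of_real_divide of_real_add of_real_mult\<close>)
    moreover have "norm (of_nat d ^ p * (of_real ((r + 1) / 2)) ^ d * (of_real (r / ((r+1)/2))) ^ d :: complex)
         = norm (real d ^ p * r ^ d)" for d
    proof -
      have "norm (of_nat d ^ p * (of_real ((r + 1) / 2)) ^ d * (of_real (r / ((r+1)/2))) ^ d :: complex)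
          = real d ^ p * (((r + 1) / 2) * (r / ((r+1)/2))) ^ d"
        unfolding power_mult_distrib using r
        by (simp add: norm_mult norm_power del: of_real_divide of_real_add)
      also have "((r + 1) / 2) * (r / ((r+1)/2)) = r" using r by (simp add: field_simps)
      finally show ?thesis using r by simp
    qed
    ultimately show ?thesis by simp
  qed
  hence s2: "(\<lambda>d. real d ^ p * r ^ d) summable_on {1..}"
    by (intro summable_on_subset [OF norm_summable_imp_summable_on]) auto
  have "(\<lambda>(m, d). r ^ m * (real d ^ p * r ^ d)) summable_on ({1..} \<times> {1..})"
    by (rule summable_on_SigmaI [where g = "\<lambda>m. r ^ m * infsum (\<lambda>d. real d ^ p * r ^ d) {1..}"])
       (use r in \<open>auto intro!: has_sum_cmult_right has_sum_infsum s1 [simplified] s2 [simplified] summable_on_cmult_left\<close>)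
  hence "(\<lambda>md. (K / r) * (\<lambda>(m, d). r ^ m * (real d ^ p * r ^ d)) md) summable_on ({1..} \<times> {1..})"
    by (rule summable_on_cmult_right)
  hence "(\<lambda>md. norm (case md of (m, d) \<Rightarrow> of_nat d ^ p * b m d * (Q ^ m) ^ d)) summable_on ({1..} \<times> {1..})"
  proof (rule Infinite_Sum.abs_summable_on_comparison_test')
    fix md :: "nat \<times> nat" assume "md \<in> {1..} \<times> {1..}"
    then obtain m d where md: "md = (m, d)" "m \<ge> 1" "d \<ge> 1" by (cases md) auto
    have "m + d \<le> m * d + 1"
      using md by (cases m; cases d) auto
    hence "r ^ (m * d + 1) \<le> r ^ (m + d)" using r by (intro power_decreasing) auto
    hence le: "r ^ (m * d) \<le> r ^ m * r ^ d / r" using r by (simp add: field_simps power_add)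
    have "norm (of_nat d ^ p * b m d * (Q ^ m) ^ d) = real d ^ p * (norm (b m d) * r ^ (m * d))"
      by (simp add: norm_mult norm_power r_def power_mult)
    also have "\<dots> \<le> real d ^ p * (K * (r ^ m * r ^ d / r))"
      using le r b K by (intro mult_left_mono mult_mono) auto
    finally show "norm (case md of (m, d) \<Rightarrow> of_nat d ^ p * b m d * (Q ^ m) ^ d)
        \<le> K / r * (case md of (m, d) \<Rightarrow> r ^ m * (real d ^ p * r ^ d))"
      by (simp add: md mult_ac)
  qed
  thus ?thesis by (rule abs_summable_summable)
qed

lemma has_sum_divisors:
  fixes f :: "nat \<times> nat \<Rightarrow> complex"
  assumes "(f has_sum S) ({1..} \<times> {1..})"
  shows "((\<lambda>N. \<Sum>d | d dvd N. f (N div d, d)) has_sum S) {1..}"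
proof (rule has_sum_SigmaD)
  show "((\<lambda>(N, d). f (N div d, d)) has_sum S) (Sigma {1..} (\<lambda>N. {d. d dvd N}))"
  proof -
    have "N div d > 0" "d > 0" if "d dvd N" "N > 0" for d N :: nat
      using that by (auto elim!: dvdE)
    hence "?thesis \<longleftrightarrow> (f has_sum S) ({1..} \<times> {1..})"
      by (intro has_sum_reindex_bij_witness [of _ "\<lambda>(m, d). (m * d, d)" "\<lambda>(N, d). (N div d, d)"])
         (auto simp: Suc_le_eq)
    with assms show ?thesis by blast
  qed
  show "((\<lambda>d. (\<lambda>(N, d). f (N div d, d)) (N, d)) has_sum (\<Sum>d | d dvd N. f (N div d, d))) {d. d dvd N}"
    if "N \<in> {1..}" for N
  proof -
    have "finite {d. d dvd N}" using that by (intro finite_divisors_nat) auto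
    thus ?thesis using has_sum_finite [of "{d. d dvd N}" "\<lambda>d. f (N div d, d)"] by simp
  qed
qed

text \<open>Absolute convergence allows summation by rows. Parity identifies row -m with row m, each
  row is a twisted Lipschitz sum and hence a power series in Q^m, and the double series is regrouped
  by N = m d.\<close>

theorem lattice_sum_sums:
  assumes z: "Im z > 0" and p: "p \<ge> 2" and bd: "\<And>m n. norm (\<phi> m n) \<le> K"
    and per: "\<And>m n. \<phi> m (n + 5) = \<phi> m n"
    and par: "\<And>m n. \<phi> (- m) (- n) = (- 1) ^ Suc p * \<phi> m n"
  shows "(\<lambda>N. lattice_coeff p \<phi> N * nome (z / 5) ^ N) sums lattice_sum (Suc p) \<phi> z"
proof -
  define f where "f = (\<lambda>(m, n). \<phi> m n / (of_int m * z + of_int n) ^ Suc p)"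
  define Q where "Q = nome (z / 5)"
  have Q: "norm Q < 1" unfolding Q_def by (rule norm_nome_less_1) (use z in auto)
  have sm: "f summable_on (UNIV - {(0, 0)})"
    unfolding f_def by (rule abs_summable_summable [OF abs_summable_lattice]) (use z p bd in auto)
  define C where "C = lipschitz_const p / 5 ^ Suc p"
  define P where "P = (\<lambda>m::nat. \<Sum>a<5. \<phi> (int m) (int a) *
     poly (lipschitz_poly p) (1 / (1 - nome ((of_nat m * z + of_nat a) / 5))))"

  have row0: "(f has_sum lattice_coeff p \<phi> 0) ({0} \<times> (UNIV - {0}))"
  proof -
    have "f summable_on ({0} \<times> (UNIV - {0}))" by (rule summable_on_subset [OF sm]) auto
    hence "(f has_sum infsum f ({0} \<times> (UNIV - {0}))) ({0} \<times> (UNIV - {0}))" by (rule has_sum_infsum)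
    also have "infsum f ({0} \<times> (UNIV - {0})) = (\<Sum>\<^sub>\<infinity>n\<in>UNIV - {0}. \<phi> 0 n / of_int n ^ Suc p)"
      by (rule infsum_reindex_bij_witness [of _ "\<lambda>n. (0, n)" snd]) (auto simp: f_def)
    finally show ?thesis by (simp add: lattice_coeff_def)
  qed

  define S where "S = (\<Sum>\<^sub>\<infinity>(m, n)\<in>{1..} \<times> UNIV. f (int m, n))"
  have S: "((\<lambda>(m, n). f (int m, n)) has_sum S) ({1..} \<times> UNIV)"
  proof -
    have "f summable_on ({1..} \<times> UNIV)" by (rule summable_on_subset [OF sm]) auto
    also have "?this \<longleftrightarrow> (\<lambda>(m, n). f (int m, n)) summable_on ({1..} \<times> UNIV)"
      by (rule summable_on_reindex_bij_witness [of _ "\<lambda>(m, n). (int m, n)" "\<lambda>(m, n). (nat m, n)"]) auto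
    finally show ?thesis unfolding S_def by (simp add: case_prod_unfold)
  qed
  have pos: "(f has_sum S) ({1..} \<times> UNIV)"
    using S by (rule has_sum_reindex_bij_witness [of _ "\<lambda>(m, n). (nat m, n)" "\<lambda>(m, n). (int m, n)", THEN iffD1, rotated -1]) auto
  have neg: "(f has_sum S) ({..-1} \<times> UNIV)"
    using pos
  proof (rule has_sum_reindex_bij_witness [of _ "\<lambda>(m, n). (- m, - n)" "\<lambda>(m, n). (- m, - n)", THEN iffD1, rotated -1])
    fix a :: "int \<times> int"
    obtain m n where a: "a = (m, n)" by (cases a)
    have "(of_int (- m) * z + of_int (- n)) ^ Suc p = ((- 1) * (of_int m * z + of_int n)) ^ Suc p"
      by (simp add: algebra_simps)
    also have "\<dots> = (- 1) ^ Suc p * (of_int m * z + of_int n) ^ Suc p" by (rule power_mult_distrib)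
    finally show "f (case a of (m, n) \<Rightarrow> (- m, - n)) = f a"
      by (simp add: f_def a par del: power_Suc of_int_minus)
  qed auto
  have "(f has_sum (lattice_coeff p \<phi> 0 + (S + S))) (({0} \<times> (UNIV - {0})) \<union> (({1..} \<times> UNIV) \<union> ({..-1} \<times> UNIV)))"
    by (intro has_sum_Un_disjoint row0 pos neg) auto
  also have "(({0} \<times> (UNIV - {0})) \<union> (({1..} \<times> UNIV) \<union> ({..-1} \<times> UNIV))) = UNIV - {(0, 0) :: int \<times> int}"
    by auto
  finally have tot: "lattice_sum (Suc p) \<phi> z = lattice_coeff p \<phi> 0 + (S + S)"
    unfolding lattice_sum_def f_def by (rule infsumI)

  have rows: "((\<lambda>m. C * P m) has_sum S) {1..}"
  proof (rule has_sum_SigmaD [OF S])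
    fix m :: nat assume m: "m \<in> {1..}"
    have "((\<lambda>n. \<phi> (int m) n / (of_nat m * z + of_int n) ^ Suc p) has_sum (C * P m)) UNIV"
      unfolding C_def P_def
    proof (rule twisted_lipschitz)
      fix a :: nat
      have "Im ((of_nat m * z + of_nat a) / 5) \<noteq> 0" using m z by simp
      thus "(of_nat m * z + of_nat a) / 5 \<notin> \<int>" by (auto simp: complex_is_Int_iff)
    qed (use per p in auto)
    thus "((\<lambda>n. (\<lambda>(m, n). f (int m, n)) (m, n)) has_sum C * P m) UNIV"
      by (simp add: f_def)
  qed

  define h where "h = (\<lambda>(m::nat, d). of_nat d ^ p * dft5 (\<phi> (int m)) d * (Q ^ m) ^ d)"
  define T where "T = infsum h ({1..} \<times> {1..})"
  have T: "(h has_sum T) ({1..} \<times> {1..})"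
    unfolding T_def h_def
    by (intro has_sum_infsum summable_divisor_terms Q) (rule norm_dft5_le, rule bd)
  have "(P has_sum T) {1..}"
  proof (rule has_sum_SigmaD [OF T])
    fix m :: nat assume m: "m \<in> {1..}"
    have "h summable_on (Sigma {1..} (\<lambda>_. {1..}))" using T by (rule has_sum_imp_summable)
    hence "(\<lambda>(m, d). h (m, d)) summable_on (Sigma {1..} (\<lambda>_. {1..}))" by simp
    from summable_on_SigmaD1 [OF this m]
    have sd: "(\<lambda>d. h (m, d)) summable_on {1..}" .
    have hs: "((\<lambda>d. h (m, d)) has_sum infsum (\<lambda>d. h (m, d)) {1..}) {1..}"
      using sd by (rule has_sum_infsum)
    \<comment> \<open>Index d = 0 may be added because p > 0 makes its term vanish.\<close>
    have "((\<lambda>d. h (m, d)) has_sum infsum (\<lambda>d. h (m, d)) {1..}) UNIV \<longleftrightarrow>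
          ((\<lambda>d. h (m, d)) has_sum infsum (\<lambda>d. h (m, d)) {1..}) {1..}"
      by (rule has_sum_cong_neutral) (use p in \<open>auto simp: h_def Suc_le_eq\<close>)
    with hs have "(\<lambda>d. h (m, d)) sums infsum (\<lambda>d. h (m, d)) {1..}"
      by (auto dest: has_sum_imp_sums)
    moreover have "(\<lambda>d. h (m, d)) sums P m"
    proof -
      have "nome (of_nat m * z / 5) = Q ^ m"
        using nome_of_nat_mult [of m "z / 5"] by (simp add: Q_def)
      thus ?thesis
        using twisted_lipschitz_series [of "of_nat m * z" p "\<phi> (int m)"] m z
        unfolding h_def P_def by simp
    qed
    ultimately have "infsum (\<lambda>d. h (m, d)) {1..} = P m" by (rule sums_unique2)
    with hs show "((\<lambda>d. h (m, d)) has_sum P m) {1..}" by simp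
  qed
  hence "((\<lambda>m. C * P m) has_sum (C * T)) {1..}" by (rule has_sum_cmult_right)
  with rows have ST: "S = C * T" by (rule has_sum_unique)

  have "((\<lambda>N. 2 * C * (\<Sum>d | d dvd N. h (N div d, d))) has_sum (2 * C * T)) {1..}"
    by (intro has_sum_cmult_right has_sum_divisors T)
  also have "2 * C * T = S + S" by (simp only: ST mult_2 distrib_right)
  also have "((\<lambda>N. 2 * C * (\<Sum>d | d dvd N. h (N div d, d))) has_sum (S + S)) {1..} \<longleftrightarrow>
      ((\<lambda>N. lattice_coeff p \<phi> N * Q ^ N) has_sum (S + S)) {1..}"
  proof (rule has_sum_cong)
    fix N :: nat assume N: "N \<in> {1..}"
    have "(\<Sum>d | d dvd N. h (N div d, d)) = (\<Sum>d | d dvd N. of_nat d ^ p * dft5 (\<phi> (int (N div d))) d * Q ^ N)"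
      by (intro sum.cong refl) (auto simp: h_def dvd_div_mult_self simp flip: power_mult)
    also have "\<dots> = (\<Sum>d | d dvd N. of_nat d ^ p * dft5 (\<phi> (int (N div d))) d) * Q ^ N"
      by (simp only: sum_distrib_right)
    finally show "2 * C * (\<Sum>d | d dvd N. h (N div d, d)) = lattice_coeff p \<phi> N * Q ^ N"
      using N by (simp add: lattice_coeff_def C_def)
  qed
  finally have "((\<lambda>N. lattice_coeff p \<phi> N * Q ^ N) has_sum (S + S)) {1..}" .
  hence "((\<lambda>N. lattice_coeff p \<phi> N * Q ^ N) has_sum (lattice_coeff p \<phi> 0 * Q ^ 0 + (S + S))) (insert 0 {1..})"
    by (subst has_sum_insert) (auto intro!: exI)
  also have "insert 0 {1..} = (UNIV :: nat set)" by auto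
  finally show ?thesis
    unfolding tot Q_def by (intro has_sum_imp_sums) simp
qed

section \<open>Lattice sums as modular forms of level 5\<close>

lemma lattice_sum_slash:
  assumes det: "a * d - b * c = 1" and z: "Im z > 0"
    and nz: "of_int c * z + of_int d \<noteq> 0"
  shows "slash k (a, b, c, d) (lattice_sum k \<phi>) z =
           lattice_sum k (\<lambda>m n. \<phi> (d * m - c * n) (a * n - b * m)) z"
proof -
  let ?w = "(of_int a * z + of_int b) / (of_int c * z + of_int d)"
  have eq: "\<phi> m n / (of_int m * ?w + of_int n) ^ k * inverse ((of_int c * z + of_int d) ^ k) =
        \<phi> m n / (of_int (m * a + n * c) * z + of_int (m * b + n * d)) ^ k" for m n
  proof -
    have "of_int (m * a + n * c) * z + of_int (m * b + n * d) =
            (of_int m * ?w + of_int n) * (of_int c * z + of_int d)"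
      using nz by (simp add: field_simps)
    hence "(of_int (m * a + n * c) * z + of_int (m * b + n * d)) ^ k =
            (of_int m * ?w + of_int n) ^ k * (of_int c * z + of_int d) ^ k"
      by (simp only: power_mult_distrib)
    thus ?thesis by (simp only: divide_inverse inverse_mult_distrib mult.assoc)
  qed
  have "slash k (a, b, c, d) (lattice_sum k \<phi>) z =
      (\<Sum>\<^sub>\<infinity>x\<in>UNIV - {(0, 0)}. (case x of (m, n) \<Rightarrow> \<phi> m n / (of_int m * ?w + of_int n) ^ k) *
         inverse ((of_int c * z + of_int d) ^ k))"
    unfolding lattice_sum_def slash_def by (simp only: infsum_cmult_left' divide_inverse prod.case)
  also have "\<dots> = (\<Sum>\<^sub>\<infinity>(m, n)\<in>UNIV - {(0, 0)}. \<phi> m n / (of_int (m * a + n * c) * z + of_int (m * b + n * d)) ^ k)"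
    by (intro infsum_cong) (simp only: split_beta eq)
  \<comment> \<open>Right multiplication of the row vector (m, n) by the matrix permutes the nonzero
    integer vectors; the coefficient function is composed with the inverse matrix.\<close>
  also have "\<dots> = lattice_sum k (\<lambda>m n. \<phi> (d * m - c * n) (a * n - b * m)) z"
    unfolding lattice_sum_def
  proof (rule infsum_reindex_bij_witness [of _ "\<lambda>(m, n). (d * m - c * n, a * n - b * m)"
             "\<lambda>(m, n). (m * a + n * c, m * b + n * d)"], goal_cases)
    case (1 x)
    obtain m n where x: "x = (m, n)" by (cases x)
    have "d * (m * a + n * c) - c * (m * b + n * d) = m * (a * d - b * c)"
      "a * (m * b + n * d) - b * (m * a + n * c) = n * (a * d - b * c)"
      by (simp_all add: algebra_simps)
    thus ?case by (simp add: x det)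
  next
    case (2 x)
    obtain m n where x: "x = (m, n)" by (cases x)
    have "d * (m * a + n * c) - c * (m * b + n * d) = m * (a * d - b * c)"
      "a * (m * b + n * d) - b * (m * a + n * c) = n * (a * d - b * c)"
      by (simp_all add: algebra_simps)
    hence "m * a + n * c \<noteq> 0 \<or> m * b + n * d \<noteq> 0"
      using 2 det x by auto
    thus ?case by (simp add: x)
  next
    case (3 x)
    obtain m n where x: "x = (m, n)" by (cases x)
    have "(d * m - c * n) * a + (a * n - b * m) * c = m * (a * d - b * c)"
      "(d * m - c * n) * b + (a * n - b * m) * d = n * (a * d - b * c)"
      by (simp_all add: algebra_simps)
    thus ?case by (simp add: x det)
  next
    case (4 x)
    obtain m n where x: "x = (m, n)" by (cases x)
    have "(d * m - c * n) * a + (a * n - b * m) * c = m * (a * d - b * c)"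
      "(d * m - c * n) * b + (a * n - b * m) * d = n * (a * d - b * c)"
      by (simp_all add: algebra_simps)
    hence "d * m - c * n \<noteq> 0 \<or> a * n - b * m \<noteq> 0"
      using 4 det x by auto
    thus ?case by (simp add: x)
  next
    case (5 x)
    obtain m n where x: "x = (m, n)" by (cases x)
    have "d * (m * a + n * c) - c * (m * b + n * d) = m * (a * d - b * c)"
      "a * (m * b + n * d) - b * (m * a + n * c) = n * (a * d - b * c)"
      by (simp_all add: algebra_simps)
    thus ?case by (simp add: x det)
  qed
  finally show ?thesis .
qed

text \<open>The reason for general coefficient functions instead of characters: this class is stable
  under all integral linear substitutions, in particular under \<open>SL2Z\<close> and not just
  \<open>Gamma0 5\<close>, so every cusp can be moved to infinity. The sign condition is what merges
  the rows m and -m.\<close>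

definition level5_fun :: "nat \<Rightarrow> (int \<Rightarrow> int \<Rightarrow> complex) \<Rightarrow> bool" where
  "level5_fun k \<phi> \<longleftrightarrow> (\<exists>K. \<forall>m n. norm (\<phi> m n) \<le> K) \<and>
     (\<forall>m n. \<phi> (m + 5) n = \<phi> m n) \<and> (\<forall>m n. \<phi> m (n + 5) = \<phi> m n) \<and>
     (\<forall>m n. \<phi> (- m) (- n) = (- 1) ^ k * \<phi> m n)"

lemma level5_fun_transform:
  assumes "level5_fun k \<phi>"
  shows "level5_fun k (\<lambda>m n. \<phi> (d * m - c * n) (a * n - b * m))"
proof -
  have 1: "\<phi> (m + 5 * j) n = \<phi> m n" for m n j
    using periodic5_shift [of "\<lambda>m. \<phi> m n"] assms by (auto simp: level5_fun_def)
  have 2: "\<phi> m (n + 5 * j) = \<phi> m n" for m n j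
    using periodic5_shift [of "\<phi> m"] assms by (auto simp: level5_fun_def)
  have "\<phi> (d * (m + 5) - c * n) (a * n - b * (m + 5)) = \<phi> (d * m - c * n) (a * n - b * m)" for m n
    using 1 [of "d * m - c * n" d] 2 [of _ "a * n - b * m" "- b"] by (simp add: algebra_simps)
  moreover have "\<phi> (d * m - c * (n + 5)) (a * (n + 5) - b * m) = \<phi> (d * m - c * n) (a * n - b * m)" for m n
    using 1 [of "d * m - c * n" "- c"] 2 [of _ "a * n - b * m" "a"] by (simp add: algebra_simps)
  moreover have "\<phi> (d * (- m) - c * (- n)) (a * (- n) - b * (- m)) = (- 1) ^ k * \<phi> (d * m - c * n) (a * n - b * m)" for m n
  proof -
    have "\<phi> (- (d * m - c * n)) (- (a * n - b * m)) = (- 1) ^ k * \<phi> (d * m - c * n) (a * n - b * m)"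
      using assms unfolding level5_fun_def by blast
    thus ?thesis by simp
  qed
  moreover have "\<exists>K. \<forall>m n. norm (\<phi> (d * m - c * n) (a * n - b * m)) \<le> K"
    using assms unfolding level5_fun_def by blast
  ultimately show ?thesis unfolding level5_fun_def by blast
qed

lemma lattice_sum_fourier:
  assumes "level5_fun (Suc p) \<phi>" "p \<ge> 2"
  shows "has_fourier_expansion (\<lambda>w. lattice_sum (Suc p) \<phi> (5 * w)) (lattice_coeff p \<phi>)"
  unfolding has_fourier_expansion_nome
proof (intro allI impI)
  fix w assume "Im w > 0"
  obtain K where "\<And>m n. norm (\<phi> m n) \<le> K" using assms(1) unfolding level5_fun_def by blast
  thus "(\<lambda>n. lattice_coeff p \<phi> n * nome w ^ n) sums lattice_sum (Suc p) \<phi> (5 * w)"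
    using lattice_sum_sums [of "5 * w" p \<phi> K] assms \<open>Im w > 0\<close> by (simp add: level5_fun_def)
qed

text \<open>Holomorphy is taken from the power series in the nome, which spares a proof of locally
  uniform convergence of the lattice sum.\<close>

lemma fourier_imp_holomorphic:
  assumes "has_fourier_expansion g a"
  shows "g holomorphic_on upper_half_plane"
proof -
  define G where "G = (\<lambda>q. \<Sum>n. a n * q ^ n)"
  have "(\<lambda>n. a n * (q - 0) ^ n) sums G q" if "q \<in> ball 0 1" for q
  proof (cases "q = 0")
    case True
    thus ?thesis using powser_sums_zero [of a] by (simp add: G_def)
  next
    case False
    have "(\<lambda>n. a n * nome (Ln q / (2 * of_real pi * \<i>)) ^ n) sums g (Ln q / (2 * of_real pi * \<i>))"
      using assms Im_Ln_pos [of q] False that unfolding has_fourier_expansion_nome by simp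
    thus ?thesis unfolding nome_Ln [OF False] G_def by (simp add: sums_iff)
  qed
  hence "G holomorphic_on ball 0 1" by (rule power_series_holomorphic)
  hence "(G \<circ> nome) holomorphic_on upper_half_plane"
    by (rule holomorphic_on_compose_gen [OF holomorphic_on_nome])
       (use norm_nome_less_1 in \<open>auto simp: upper_half_plane_def\<close>)
  moreover have "(G \<circ> nome) z = g z" if "z \<in> upper_half_plane" for z
    using assms that unfolding has_fourier_expansion_nome G_def
    by (auto simp: upper_half_plane_def sums_iff)
  ultimately show ?thesis using holomorphic_transform by blast
qed

lemma lattice_sum_holomorphic:
  assumes "level5_fun (Suc p) \<phi>" "p \<ge> 2"
  shows "lattice_sum (Suc p) \<phi> holomorphic_on upper_half_plane"
proof -
  have "((\<lambda>w. lattice_sum (Suc p) \<phi> (5 * w)) \<circ> (\<lambda>z. z / 5)) holomorphic_on upper_half_plane"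
    by (rule holomorphic_on_compose_gen [OF _ fourier_imp_holomorphic [OF lattice_sum_fourier [OF assms]]])
       (auto intro!: holomorphic_intros simp: upper_half_plane_def)
  thus ?thesis by (simp add: o_def)
qed

lemma lattice_sum_bounded:
  assumes "level5_fun (Suc p) \<phi>" "p \<ge> 2"
  shows "Bfun (lattice_sum (Suc p) \<phi>) at_i_infinity"
proof -
  obtain C where C: "\<And>z. Im z \<ge> 1 / 2 \<Longrightarrow> norm (lattice_sum (Suc p) \<phi> (5 * z)) \<le> C * exp (- 2 * pi * real 0 * Im z)"
    using fourier_expansion_decay [OF lattice_sum_fourier [OF assms], of 0] by auto
  have "norm (lattice_sum (Suc p) \<phi> z) \<le> C" if "5 / 2 \<le> Im z" for z
    using C [of "z / 5"] that by simp
  thus ?thesis unfolding Bfun_at_i_infinity by blast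
qed

text \<open>Slashing gives another lattice sum of level 5, so boundedness at any cusp is boundedness
  at infinity for a different coefficient function.\<close>

lemma lattice_sum_slash_bounded:
  assumes "level5_fun (Suc p) \<phi>" "p \<ge> 2" "\<gamma> \<in> SL2Z"
  shows "Bfun (slash (Suc p) \<gamma> (lattice_sum (Suc p) \<phi>)) at_i_infinity"
proof -
  obtain a b c d where \<gamma>: "\<gamma> = (a, b, c, d)" "a * d - b * c = 1"
    using assms(3) by (auto simp: SL2Z_def)
  let ?\<phi> = "\<lambda>m n. \<phi> (d * m - c * n) (a * n - b * m)"
  have "Bfun (lattice_sum (Suc p) ?\<phi>) at_i_infinity"
    by (intro lattice_sum_bounded level5_fun_transform assms)
  then obtain B K where BK: "\<And>z. B \<le> Im z \<Longrightarrow> norm (lattice_sum (Suc p) ?\<phi> z) \<le> K"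
    unfolding Bfun_at_i_infinity by blast
  have "norm (slash (Suc p) \<gamma> (lattice_sum (Suc p) \<phi>) z) \<le> K" if "max 1 B \<le> Im z" for z
    using that BK [of z] lattice_sum_slash [OF \<gamma>(2) _ moebius_denom_nonzero [OF \<gamma>(2)], of z] \<gamma>(1)
    by simp
  thus ?thesis unfolding Bfun_at_i_infinity by blast
qed

lemma lattice_sum_scale:
  "lattice_sum k (\<lambda>m n. c * \<phi> m n) z = c * lattice_sum k \<phi> z"
  unfolding lattice_sum_def
  by (subst infsum_cmult_right' [symmetric]) (auto intro!: infsum_cong simp: split_beta)

lemma lattice_sum_transform:
  assumes "\<And>m n. \<phi> (d * m - c * n) (a * n - b * m) = \<theta> m n" "a * d - b * c = 1" "Im z > 0"
  shows "slash k (a, b, c, d) (lattice_sum k \<phi>) z = lattice_sum k \<theta> z"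
  using lattice_sum_slash [OF assms(2,3) moebius_denom_nonzero [OF assms(2,3)], of k \<phi>] assms(1)
  by simp

lemma lattice_sum_modular:
  assumes "level5_fun (Suc p) \<phi>" "p \<ge> 2"
    and "\<And>a b c d m n. a * d - b * c = 1 \<Longrightarrow> 5 dvd c \<Longrightarrow> \<phi> (d * m - c * n) (a * n - b * m) = \<psi> d * \<phi> m n"
  shows "lattice_sum (Suc p) \<phi> \<in> modular_forms 5 (Suc p) \<psi>"
proof -
  have "slash (Suc p) (a, b, c, d) (lattice_sum (Suc p) \<phi>) z = \<psi> d * lattice_sum (Suc p) \<phi> z"
    if "(a, b, c, d) \<in> Gamma0 5" "z \<in> upper_half_plane" for a b c d z
    using lattice_sum_transform [of \<phi> d c a b "\<lambda>m n. \<psi> d * \<phi> m n" z "Suc p"] assms(3) [of a d b c] that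
    by (auto simp: Gamma0_def SL2Z_def upper_half_plane_def lattice_sum_scale)
  thus ?thesis
    using lattice_sum_holomorphic [OF assms(1,2)] lattice_sum_slash_bounded [OF assms(1,2)]
    by (auto simp: modular_forms_def)
qed

section \<open>Products and linear combinations of modular forms\<close>

lemma slash_mult: "slash (k + l) \<gamma> (\<lambda>z. f z * g z) z = slash k \<gamma> f z * slash l \<gamma> g z"
  by (cases \<gamma>) (simp add: slash_def power_add)

lemma slash_add: "slash k \<gamma> (\<lambda>z. f z + g z) z = slash k \<gamma> f z + slash k \<gamma> g z"
  by (cases \<gamma>) (simp add: slash_def add_divide_distrib)

lemma slash_cmult: "slash k \<gamma> (\<lambda>z. c * f z) z = c * slash k \<gamma> f z"
  by (cases \<gamma>) (simp add: slash_def)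

lemma Bfun_mult_at_i_infinity:
  fixes f g :: "complex \<Rightarrow> complex"
  assumes "Bfun f at_i_infinity" "Bfun g at_i_infinity"
  shows "Bfun (\<lambda>z. f z * g z) at_i_infinity"
proof -
  obtain B K B' K' where "\<And>z. B \<le> Im z \<Longrightarrow> norm (f z) \<le> K" "\<And>z. B' \<le> Im z \<Longrightarrow> norm (g z) \<le> K'"
    using assms unfolding Bfun_at_i_infinity by blast
  hence "norm (f z * g z) \<le> K * K'" if "max B B' \<le> Im z" for z
    using that unfolding norm_mult
    by (intro mult_mono) (auto intro: order.trans [OF norm_ge_zero])
  thus ?thesis unfolding Bfun_at_i_infinity by blast
qed

lemma Bfun_add_at_i_infinity:
  fixes f g :: "complex \<Rightarrow> complex"
  assumes "Bfun f at_i_infinity" "Bfun g at_i_infinity"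
  shows "Bfun (\<lambda>z. f z + g z) at_i_infinity"
proof -
  obtain B K B' K' where "\<And>z. B \<le> Im z \<Longrightarrow> norm (f z) \<le> K" "\<And>z. B' \<le> Im z \<Longrightarrow> norm (g z) \<le> K'"
    using assms unfolding Bfun_at_i_infinity by blast
  hence "norm (f z + g z) \<le> K + K'" if "max B B' \<le> Im z" for z
    using that by (intro norm_triangle_mono) auto
  thus ?thesis unfolding Bfun_at_i_infinity by blast
qed

lemma modular_forms_mult:
  assumes f: "f \<in> modular_forms N k \<psi>" and g: "g \<in> modular_forms N l \<psi>'"
  shows "(\<lambda>z. f z * g z) \<in> modular_forms N (k + l) (\<lambda>d. \<psi> d * \<psi>' d)"
proof -
  have "slash (k + l) (a, b, c, d) (\<lambda>z. f z * g z) z = \<psi> d * \<psi>' d * (f z * g z)"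
    if "(a, b, c, d) \<in> Gamma0 N" "z \<in> upper_half_plane" for a b c d z
  proof -
    have "slash k (a, b, c, d) f z = \<psi> d * f z" "slash l (a, b, c, d) g z = \<psi>' d * g z"
      using f g that unfolding modular_forms_def by blast+
    thus ?thesis by (simp add: slash_mult)
  qed
  moreover have "Bfun (slash (k + l) \<gamma> (\<lambda>z. f z * g z)) at_i_infinity" if "\<gamma> \<in> SL2Z" for \<gamma>
    unfolding slash_mult [abs_def]
    using f g that by (intro Bfun_mult_at_i_infinity) (auto simp: modular_forms_def)
  ultimately show ?thesis
    using f g by (auto simp: modular_forms_def intro!: holomorphic_intros)
qed

lemma modular_forms_add:
  assumes f: "f \<in> modular_forms N k \<psi>" and g: "g \<in> modular_forms N k \<psi>"
  shows "(\<lambda>z. f z + g z) \<in> modular_forms N k \<psi>"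
proof -
  have "slash k (a, b, c, d) (\<lambda>z. f z + g z) z = \<psi> d * (f z + g z)"
    if "(a, b, c, d) \<in> Gamma0 N" "z \<in> upper_half_plane" for a b c d z
  proof -
    have "slash k (a, b, c, d) f z = \<psi> d * f z" "slash k (a, b, c, d) g z = \<psi> d * g z"
      using f g that unfolding modular_forms_def by blast+
    thus ?thesis by (simp add: slash_add distrib_left)
  qed
  moreover have "Bfun (slash k \<gamma> (\<lambda>z. f z + g z)) at_i_infinity" if "\<gamma> \<in> SL2Z" for \<gamma>
    unfolding slash_add [abs_def]
    using f g that by (intro Bfun_add_at_i_infinity) (auto simp: modular_forms_def)
  ultimately show ?thesis
    using f g by (auto simp: modular_forms_def intro!: holomorphic_intros)
qed

lemma modular_forms_cmult:
  assumes f: "f \<in> modular_forms N k \<psi>"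
  shows "(\<lambda>z. c * f z) \<in> modular_forms N k \<psi>"
proof -
  have "slash k (a, b, c', d) (\<lambda>z. c * f z) z = \<psi> d * (c * f z)"
    if "(a, b, c', d) \<in> Gamma0 N" "z \<in> upper_half_plane" for a b c' d z
  proof -
    have "slash k (a, b, c', d) f z = \<psi> d * f z"
      using f that unfolding modular_forms_def by blast
    thus ?thesis by (simp add: slash_cmult)
  qed
  moreover have "Bfun (slash k \<gamma> (\<lambda>z. c * f z)) at_i_infinity" if "\<gamma> \<in> SL2Z" for \<gamma>
    unfolding slash_cmult [abs_def]
    using f that by (intro Bfun_mult_at_i_infinity Bfun_const) (auto simp: modular_forms_def)
  ultimately show ?thesis
    using f by (auto simp: modular_forms_def intro!: holomorphic_intros)
qed

lemma modular_forms_diff: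
  assumes "f \<in> modular_forms N k \<psi>" "g \<in> modular_forms N k \<psi>"
  shows "(\<lambda>z. f z - g z) \<in> modular_forms N k \<psi>"
  using modular_forms_add [OF assms(1) modular_forms_cmult [OF assms(2), of "-1"]] by simp

section \<open>The quadratic character modulo 5 and the Eisenstein series\<close>

lemma chi5_eq:
  "chi5 n = (if n mod 5 = 0 then 0 else if n mod 5 = 1 \<or> n mod 5 = 4 then 1 else - 1)"
proof -
  have sq: "y ^ 2 mod 5 \<in> {0, 1, 4}" for y :: int
  proof -
    have "y mod 5 \<in> {0, 1, 2, 3, 4}" by auto
    moreover have "y ^ 2 mod 5 = (y mod 5) ^ 2 mod 5" by (simp add: power_mod)
    ultimately show ?thesis by auto
  qed
  have "QuadRes 5 n \<longleftrightarrow> n mod 5 \<in> {0, 1, 4}"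
  proof
    assume "QuadRes 5 n"
    then obtain y where "y ^ 2 mod 5 = n mod 5" by (auto simp: QuadRes_def cong_def)
    thus "n mod 5 \<in> {0, 1, 4}" using sq [of y] by simp
  next
    assume "n mod 5 \<in> {0, 1, 4}"
    thus "QuadRes 5 n" unfolding QuadRes_def cong_def
      by (auto intro: exI [of _ 0] exI [of _ 1] exI [of _ 2])
  qed
  moreover have "n mod 5 \<in> {0, 1, 2, 3, 4}" by auto
  ultimately show ?thesis by (auto simp: chi5_def Legendre_def cong_def)
qed

lemma mod5_cases:
  fixes n :: int
  obtains "n mod 5 = 0" | "n mod 5 = 1" | "n mod 5 = 2" | "n mod 5 = 3" | "n mod 5 = 4"
proof -
  have "n mod 5 \<in> {0, 1, 2, 3, 4}" by auto
  thus ?thesis using that by auto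
qed

lemma chi5_mult: "chi5 (m * n) = chi5 m * chi5 n"
proof -
  have "m * n mod 5 = (m mod 5) * (n mod 5) mod 5" by (simp add: mod_mult_eq)
  thus ?thesis
    by (cases m rule: mod5_cases; cases n rule: mod5_cases) (simp_all add: chi5_eq)
qed

lemma chi5_periodic: "chi5 (n + 5 * j) = chi5 n"
  by (simp add: chi5_eq)

lemma chi5_minus: "chi5 (- n) = chi5 n"
  using chi5_mult [of "-1" n] by (simp add: chi5_eq [of "-1"])

lemma norm_chi5_le: "norm (chi5 n) \<le> 1"
  by (simp add: chi5_eq)

lemma norm_chi5: "\<not> 5 dvd n \<Longrightarrow> norm (chi5 n) = 1"
  by (simp add: chi5_eq dvd_eq_mod_eq_0)

lemma chi5_square: "\<not> 5 dvd n \<Longrightarrow> chi5 n * chi5 n = 1"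
  by (simp add: chi5_eq dvd_eq_mod_eq_0)

lemma Gamma0_5_not_dvd:
  fixes a b c d :: int
  assumes "a * d - b * c = 1" "5 dvd c"
  shows "\<not> 5 dvd a" "\<not> 5 dvd d"
proof -
  have "5 dvd b * c" using assms by simp
  hence "\<not> 5 dvd a * d" using assms(1) dvd_diff [of 5 "a * d" "b * c"] by auto
  thus "\<not> 5 dvd a" "\<not> 5 dvd d" by auto
qed

text \<open>Here a d = 1 modulo 5, and a quadratic character equals its inverse.\<close>

lemma chi5_Gamma0:
  assumes "a * d - b * c = 1" "5 dvd c"
  shows "chi5 a = chi5 d"
proof -
  have "a * d = 1 + 5 * (b * (c div 5))" using assms by auto
  hence "chi5 (a * d) = 1" using chi5_periodic [of 1] by (simp add: chi5_eq [of 1])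
  hence "chi5 a * chi5 d = 1" by (simp add: chi5_mult)
  thus ?thesis using chi5_square [OF Gamma0_5_not_dvd(2) [OF assms]]
    by (metis mult_cancel_right mult_zero_right zero_neq_one)
qed

subsection \<open>Fifth roots of unity\<close>

definition zeta5 :: complex where "zeta5 = nome (1 / 5)"

lemma nome_fifth: "nome (of_nat a / 5) = zeta5 ^ a"
  using nome_of_nat_mult [of a "1/5"] by (simp add: zeta5_def)

lemma zeta5_power5: "zeta5 ^ 5 = 1"
  using nome_fifth [of 5] nome_eq_1_iff [of 1] by simp

lemma zeta5_power_neq_1:
  assumes "\<not> 5 dvd a"
  shows "zeta5 ^ a \<noteq> 1"
proof
  assume "zeta5 ^ a = 1"
  hence "of_nat a / 5 \<in> (\<int> :: complex set)" unfolding nome_fifth [symmetric] nome_eq_1_iff .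
  then obtain k where "of_nat a / 5 = (of_int k :: complex)" by (auto elim: Ints_cases)
  hence "of_int (int a) = (of_int (5 * k) :: complex)" by simp
  hence "int a = 5 * k" by (simp only: of_int_eq_iff)
  hence "5 dvd int a" by simp
  hence "int 5 dvd int a" by simp
  hence "5 dvd a" by (simp only: int_dvd_int_iff)
  with assms show False by simp
qed

lemma zeta5_sum: "zeta5 ^ 4 = - (zeta5 ^ 3) - zeta5 ^ 2 - zeta5 - 1"
proof -
  have "(zeta5 - 1) * (zeta5 ^ 4 + zeta5 ^ 3 + zeta5 ^ 2 + zeta5 + 1) = zeta5 ^ 5 - 1"
    by (simp add: algebra_simps eval_nat_numeral)
  also have "\<dots> = 0" by (simp add: zeta5_power5)
  finally have "zeta5 ^ 4 + zeta5 ^ 3 + zeta5 ^ 2 + zeta5 + 1 = 0"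
    using zeta5_power_neq_1 [of 1] by simp
  thus ?thesis by (simp add: algebra_simps eq_neg_iff_add_eq_0)
qed

abbreviation sqrt5 :: complex where "sqrt5 \<equiv> of_real (sqrt 5)"

lemma sqrt5_square: "sqrt5 * sqrt5 = 5"
  by (simp flip: of_real_mult)

text \<open>The sum is a root of t^2 + t - 1. Which root it is follows from the positivity of cos(2
  pi / 5), and this decides the sign of the Gauss sum.\<close>

lemma zeta5_plus_inverse: "zeta5 + zeta5 ^ 4 = (sqrt5 - 1) / 2"
proof -
  define t where "t = 2 * cos (2 * pi / 5)"
  have z: "zeta5 = cis (2 * pi / 5)"
    by (simp add: zeta5_def nome_def cis_conv_exp mult_ac)
  have "zeta5 * zeta5 ^ 4 = 1" using zeta5_power5 by (simp add: eval_nat_numeral)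
  hence "zeta5 ^ 4 = inverse zeta5" using inverse_unique by metis
  also have "\<dots> = cis (- (2 * pi / 5))" by (simp add: z)
  finally have z4: "zeta5 ^ 4 = cis (- (2 * pi / 5))" .
  have t: "zeta5 + zeta5 ^ 4 = of_real t"
    by (simp only: z4) (simp add: z t_def complex_eq_iff)
  have "(zeta5 + zeta5 ^ 4) ^ 2 + (zeta5 + zeta5 ^ 4) - 1 =
     zeta5 ^ 2 + 2 * zeta5 ^ 5 + zeta5 ^ 5 * zeta5 ^ 3 + zeta5 + zeta5 ^ 4 - 1"
    by (simp add: algebra_simps eval_nat_numeral)
  also have "\<dots> = 0" by (simp add: zeta5_power5 zeta5_sum)
  finally have "of_real (t ^ 2 + t - 1) = (0 :: complex)" unfolding t by simp
  hence "t ^ 2 + t - 1 = 0" by (simp only: of_real_eq_0_iff)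
  hence "(2 * t + 1) ^ 2 = 5" by (simp add: power2_eq_square algebra_simps)
  moreover have "t > 0" unfolding t_def by (intro mult_pos_pos cos_gt_zero) auto
  ultimately have "2 * t + 1 = sqrt 5" by (intro real_sqrt_unique [symmetric]) auto
  hence "t = (sqrt 5 - 1) / 2" by simp
  thus ?thesis unfolding t by (simp only: of_real_divide of_real_diff of_real_1 of_real_numeral)
qed

lemma gauss_sum_5: "zeta5 - zeta5 ^ 2 - zeta5 ^ 3 + zeta5 ^ 4 = sqrt5"
proof -
  have "zeta5 - zeta5 ^ 2 - zeta5 ^ 3 + zeta5 ^ 4 = 2 * (zeta5 + zeta5 ^ 4) + 1"
    unfolding zeta5_sum by (simp add: algebra_simps)
  thus ?thesis by (simp add: zeta5_plus_inverse)
qed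

lemma dft5_zeta5: "dft5 g d = (\<Sum>a<5. g (int a) * zeta5 ^ (a * d mod 5))"
proof -
  have "zeta5 ^ k = zeta5 ^ (k mod 5)" for k
  proof -
    have "zeta5 ^ k = zeta5 ^ (5 * (k div 5) + k mod 5)" by simp
    also have "\<dots> = zeta5 ^ (k mod 5)" by (simp only: power_add power_mult zeta5_power5) simp
    finally show ?thesis .
  qed
  thus ?thesis unfolding dft5_def nome_fifth power_mult [symmetric]
    by (intro sum.cong refl) metis
qed

lemma mod5_cases_nat:
  fixes n :: nat
  obtains "n mod 5 = 0" | "n mod 5 = 1" | "n mod 5 = 2" | "n mod 5 = 3" | "n mod 5 = 4"
proof -
  have "n mod 5 < 5" by simp
  hence "n mod 5 \<in> {0, 1, 2, 3, 4}" by auto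
  thus ?thesis using that by auto
qed

lemma dft5_chi5: "dft5 chi5 d = sqrt5 * chi5 (int d)"
proof -
  have m: "a * d mod 5 = a * (d mod 5) mod 5" for a :: nat by (simp add: mod_mult_right_eq)
  have i: "int d mod 5 = int (d mod 5)" by (simp add: zmod_int)
  show ?thesis unfolding gauss_sum_5 [symmetric] dft5_zeta5
    by (cases d rule: mod5_cases_nat)
       (simp_all add: m lessThan_nat_numeral i chi5_eq algebra_simps power2_eq_square)
qed

lemma dft5_const: "dft5 (\<lambda>_. c) d = (if 5 dvd d then 5 * c else 0)"
proof -
  have m: "a * d mod 5 = a * (d mod 5) mod 5" for a :: nat by (simp add: mod_mult_right_eq)
  have s: "c * (zeta5 ^ 4 + zeta5 ^ 3 + zeta5 ^ 2 + zeta5 + 1) = 0"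
    by (simp add: zeta5_sum)
  show ?thesis using s unfolding dft5_zeta5
    by (cases d rule: mod5_cases_nat)
       (simp_all add: m lessThan_nat_numeral dvd_eq_mod_eq_0 algebra_simps power2_eq_square)
qed


subsection \<open>The Eisenstein series\<close>

text \<open>Summing over 5 m z + n is summing over all m z + n with a weight supported on multiples
  of 5, which brings the series under the general lattice sums.\<close>

definition eisenstein_fun :: "int \<Rightarrow> int \<Rightarrow> complex" where
  "eisenstein_fun m n = (if 5 dvd m then chi5 n else 0)"

lemma level5_eisenstein_fun: "level5_fun 6 eisenstein_fun"
  unfolding level5_fun_def eisenstein_fun_def
  using norm_chi5_le by (auto simp: chi5_minus chi5_periodic [of _ 1, simplified] intro: exI [of _ 1])

lemma lipschitz_const_nonzero [simp]: "lipschitz_const p \<noteq> 0"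
  by (simp add: lipschitz_const_def)

lemma eisenstein6_lattice_sum:
  "eisenstein6_chi5 z = inverse (2 * sqrt5 * lipschitz_const 5 / 5 ^ 6) * lattice_sum 6 eisenstein_fun z"
proof -
  have "(\<Sum>\<^sub>\<infinity>(m, n) \<in> UNIV - {(0, 0)}. chi5 n / (5 * of_int m * z + of_int n) ^ 6) =
    (\<Sum>\<^sub>\<infinity>(m, n) \<in> {m. 5 dvd m} \<times> UNIV - {(0, 0)}. eisenstein_fun m n / (of_int m * z + of_int n) ^ 6)"
    by (rule infsum_reindex_bij_witness [of _ "\<lambda>(m, n). (m div 5, n)" "\<lambda>(m, n). (5 * m, n)"])
       (auto simp: eisenstein_fun_def)
  also have "\<dots> = lattice_sum 6 eisenstein_fun z"
    unfolding lattice_sum_def by (rule infsum_cong_neutral) (auto simp: eisenstein_fun_def split: if_splits)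
  finally show ?thesis
    by (simp add: eisenstein6_chi5_def lipschitz_const_def eval_nat_numeral)
qed

lemma eisenstein6_modular: "eisenstein6_chi5 \<in> modular_forms 5 6 chi5"
proof -
  have "lattice_sum (Suc 5) eisenstein_fun \<in> modular_forms 5 (Suc 5) chi5"
  proof (rule lattice_sum_modular)
    fix a b c d m n :: int
    assume det: "a * d - b * c = 1" and c: "5 dvd c"
    have "5 dvd d * m - c * n \<longleftrightarrow> 5 dvd d * m"
      using c by (metis dvd_diff_left_iff dvd_mult2)
    also have "\<dots> \<longleftrightarrow> 5 dvd m"
      using Gamma0_5_not_dvd(2) [OF det c] prime_dvd_mult_iff [of "5 :: int" d m] by auto
    finally have *: "5 dvd d * m - c * n \<longleftrightarrow> 5 dvd m" .
    have "chi5 (a * n - b * m) = chi5 d * chi5 n" if "5 dvd m"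
    proof -
      have "a * n - b * m = a * n + 5 * (- (b * (m div 5)))" using that by auto
      thus ?thesis by (simp only: chi5_periodic chi5_mult chi5_Gamma0 [OF det c])
    qed
    thus "eisenstein_fun (d * m - c * n) (a * n - b * m) = chi5 d * eisenstein_fun m n"
      by (simp add: eisenstein_fun_def *)
  qed (use level5_eisenstein_fun in auto)
  hence "(\<lambda>z. inverse (2 * sqrt5 * lipschitz_const 5 / 5 ^ 6) * lattice_sum 6 eisenstein_fun z) \<in> modular_forms 5 6 chi5"
    by (intro modular_forms_cmult) simp
  also have "(\<lambda>z. inverse (2 * sqrt5 * lipschitz_const 5 / 5 ^ 6) * lattice_sum 6 eisenstein_fun z) = eisenstein6_chi5"
    by (intro ext) (simp only: eisenstein6_lattice_sum)
  finally show ?thesis .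
qed

text \<open>A level 5 lattice sum is a priori a power series in \<open>q\<^bsup>1/5\<^esup>\<close>.\<close>

lemma lattice_sum_fourier_level1:
  assumes "level5_fun (Suc p) \<phi>" "p \<ge> 2" "\<And>N. \<not> 5 dvd N \<Longrightarrow> lattice_coeff p \<phi> N = 0"
  shows "has_fourier_expansion (lattice_sum (Suc p) \<phi>) (\<lambda>N. lattice_coeff p \<phi> (5 * N))"
  unfolding has_fourier_expansion_nome
proof (intro allI impI)
  fix z assume z: "Im z > 0"
  have "(\<lambda>N. lattice_coeff p \<phi> N * nome (z / 5) ^ N) sums lattice_sum (Suc p) \<phi> (5 * (z / 5))"
    using lattice_sum_fourier [OF assms(1,2), unfolded has_fourier_expansion_nome, rule_format, of "z / 5"] z
    by simp
  also have "?this \<longleftrightarrow> (\<lambda>N. lattice_coeff p \<phi> (5 * N) * nome (z / 5) ^ (5 * N)) sums lattice_sum (Suc p) \<phi> (5 * (z / 5))"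
    by (rule sums_mono_reindex [symmetric, where g = "\<lambda>N. 5 * N" and f = "\<lambda>N. lattice_coeff p \<phi> N * nome (z / 5) ^ N"])
       (auto simp: strict_mono_def assms(3) dvd_def image_iff)
  finally have "(\<lambda>N. lattice_coeff p \<phi> (5 * N) * nome (z / 5) ^ (5 * N)) sums lattice_sum (Suc p) \<phi> (5 * (z / 5))" .
  moreover have "nome (z / 5) ^ (5 * N) = nome z ^ N" for N
    using nome_of_nat_mult [of 5 "z / 5"] by (simp add: power_mult)
  ultimately show "(\<lambda>N. lattice_coeff p \<phi> (5 * N) * nome z ^ N) sums lattice_sum (Suc p) \<phi> z"
    by simp
qed

lemma lipschitz_poly_5:
  "poly (lipschitz_poly 5) w = 120 * (w ^ 2 - w) ^ 3 + 30 * (w ^ 2 - w) ^ 2 + (w ^ 2 - w)"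
  by (simp add: eval_nat_numeral pderiv_pCons algebra_simps)

text \<open>The row m = 0 is the twisted Lipschitz sum at w = 0. The polynomial depends only on w^2
  - w with w = 1 / (1 - x), and this equals 1 / (x + 1/x - 2), so the residues a and -a give the
  same value. Two values \<open>A\<close> and \<open>B\<close> remain, conjugate in Q(sqrt 5), and
  the character takes their difference. Dividing by 2 sqrt 5 afterwards turns -134 / sqrt 5 into
  -67/5.\<close>

lemma eisenstein_constant_term: "lattice_coeff 5 eisenstein_fun 0 = lipschitz_const 5 / 5 ^ 6 * (- 134 / sqrt5)"
proof -
  let ?S = "\<Sum>a<5. chi5 (int a) * poly (lipschitz_poly 5) (1 / (1 - zeta5 ^ a))"
  have "((\<lambda>n. chi5 n / (0 + of_int n) ^ Suc 5) has_sum (lipschitz_const 5 / 5 ^ Suc 5 *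
            (\<Sum>a<5. chi5 (int a) * poly (lipschitz_poly 5) (1 / (1 - nome ((0 + of_nat a) / 5)))))) UNIV"
  proof (rule twisted_lipschitz)
    fix a :: nat assume a: "a < 5" "chi5 (int a) \<noteq> 0"
    have "\<not> 5 dvd a" using a by (auto simp: chi5_eq dvd_def)
    thus "(0 + of_nat a) / 5 \<notin> (\<int> :: complex set)"
      using zeta5_power_neq_1 [of a] by (simp add: nome_fifth flip: nome_eq_1_iff)
  qed (auto simp: chi5_periodic [of _ 1, simplified])
  hence "infsum (\<lambda>n. chi5 n / of_int n ^ 6) UNIV = lipschitz_const 5 / 5 ^ 6 * ?S"
    by (simp add: infsumI nome_fifth)
  also have "infsum (\<lambda>n. chi5 n / of_int n ^ 6) UNIV = lattice_coeff 5 eisenstein_fun 0"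
    unfolding lattice_coeff_def by (simp add: eisenstein_fun_def) (rule infsum_cong_neutral, auto)
  also have "?S = - 134 / sqrt5"
  proof -
    have v: "(1 / (1 - x)) ^ 2 - 1 / (1 - x) = 1 / (x + y - 2)" if "x * y = 1" "x \<noteq> 1" for x y :: complex
    proof -
      have x: "x \<noteq> 0" using that by auto
      have "(1 - x) ^ 2 = x ^ 2 + 1 - 2 * x" by (simp add: power2_eq_square algebra_simps)
      also have "\<dots> = (x + y - 2) * x"
        unfolding that(1) [symmetric] by (simp add: power2_eq_square algebra_simps)
      finally have "x + y - 2 = (1 - x) ^ 2 / x" using x by simp
      hence "1 / (x + y - 2) = x / (1 - x) ^ 2" by simp
      also have "\<dots> = (1 / (1 - x)) ^ 2 - 1 / (1 - x)"
        using that(2) by (simp add: divide_simps) (simp add: power2_eq_square algebra_simps)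
      finally show ?thesis ..
    qed
    have z23: "zeta5 ^ 2 + zeta5 ^ 3 = (- sqrt5 - 1) / 2"
    proof -
      have "zeta5 ^ 2 + zeta5 ^ 3 = - 1 - (zeta5 + zeta5 ^ 4)" unfolding zeta5_sum by simp
      thus ?thesis unfolding zeta5_plus_inverse by (simp add: diff_divide_distrib)
    qed
    have p: "zeta5 * zeta5 ^ 4 = 1" "zeta5 ^ 2 * zeta5 ^ 3 = 1"
      "zeta5 ^ 3 * zeta5 ^ 2 = 1" "zeta5 ^ 4 * zeta5 = 1"
      using zeta5_power5 by (simp_all flip: power_Suc power_Suc2 power_add)
    have ne: "zeta5 \<noteq> 1" "zeta5 ^ 2 \<noteq> 1" "zeta5 ^ 3 \<noteq> 1" "zeta5 ^ 4 \<noteq> 1"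
      using zeta5_power_neq_1 [of 1] zeta5_power_neq_1 [of 2] zeta5_power_neq_1 [of 3] zeta5_power_neq_1 [of 4]
      by auto
    define A where "A = 1 / ((sqrt5 - 1) / 2 - 2)"
    define B where "B = 1 / ((- sqrt5 - 1) / 2 - 2)"
    have w: "(1 / (1 - zeta5)) ^ 2 - 1 / (1 - zeta5) = A"
      "(1 / (1 - zeta5 ^ 2)) ^ 2 - 1 / (1 - zeta5 ^ 2) = B"
      "(1 / (1 - zeta5 ^ 3)) ^ 2 - 1 / (1 - zeta5 ^ 3) = B"
      "(1 / (1 - zeta5 ^ 4)) ^ 2 - 1 / (1 - zeta5 ^ 4) = A"
      unfolding A_def B_def zeta5_plus_inverse [symmetric] z23 [symmetric]
      using v [OF p(1) ne(1)] v [OF p(2) ne(2)] v [OF p(3) ne(3)] v [OF p(4) ne(4)]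
      by (simp_all only: add.commute)
    have s5: "sqrt5 \<noteq> 0" by simp
    have A: "A = - (5 + sqrt5) / 10"
    proof -
      have "((sqrt5 - 1) / 2 - 2) * (- (5 + sqrt5) / 10) = 1"
        using sqrt5_square by (simp add: field_simps)
      thus ?thesis unfolding A_def by (metis divide_eq_eq mult.commute mult_eq_0_iff zero_neq_one)
    qed
    have B: "B = - (5 - sqrt5) / 10"
    proof -
      have "((- sqrt5 - 1) / 2 - 2) * (- (5 - sqrt5) / 10) = 1"
        using sqrt5_square by (simp add: field_simps)
      thus ?thesis unfolding B_def by (metis divide_eq_eq mult.commute mult_eq_0_iff zero_neq_one)
    qed
    have "?S = 2 * (120 * A ^ 3 + 30 * A ^ 2 + A) - 2 * (120 * B ^ 3 + 30 * B ^ 2 + B)"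
      by (simp add: lessThan_nat_numeral chi5_eq lipschitz_poly_5 w [unfolded One_nat_def] del: lipschitz_poly.simps)
    also have "\<dots> = - 134 / sqrt5"
    proof -
      have "A ^ 2 = (3 + sqrt5) / 10" "B ^ 2 = (3 - sqrt5) / 10"
        unfolding A B power2_eq_square using sqrt5_square by (simp_all add: field_simps)
      moreover have "A ^ 3 = A ^ 2 * A" "B ^ 3 = B ^ 2 * B" by (simp_all add: eval_nat_numeral)
      moreover have "(3 + sqrt5) / 10 * (- (5 + sqrt5) / 10) = - (20 + 8 * sqrt5) / 100"
        "(3 - sqrt5) / 10 * (- (5 - sqrt5) / 10) = - (20 - 8 * sqrt5) / 100"
        using sqrt5_square by (simp_all add: field_simps)
      ultimately have pw: "A ^ 3 = - (20 + 8 * sqrt5) / 100" "B ^ 3 = - (20 - 8 * sqrt5) / 100"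
         "A ^ 2 = (3 + sqrt5) / 10" "B ^ 2 = (3 - sqrt5) / 10" by (simp_all only: A B)
      have "2 * (120 * A ^ 3 + 30 * A ^ 2 + A) - 2 * (120 * B ^ 3 + 30 * B ^ 2 + B) = - 134 / 5 * sqrt5"
        unfolding pw unfolding A B by (simp add: field_simps)
      also have "\<dots> = - 134 / sqrt5" using sqrt5_square s5 by (simp add: field_simps)
      finally show ?thesis .
    qed
    finally show ?thesis .
  qed
  finally show ?thesis .
qed

definition eisenstein_coeff :: "nat \<Rightarrow> complex" where
  "eisenstein_coeff n = (if n = 0 then - 67 / 5 else \<Sum>d | d dvd n. chi5 (int d) * of_nat d ^ 5)"

theorem eisenstein6_fourier: "has_fourier_expansion eisenstein6_chi5 eisenstein_coeff"
proof -
  have dft: "dft5 (eisenstein_fun m) d = (if 5 dvd m then sqrt5 * chi5 (int d) else 0)" for m d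
    using dft5_chi5 by (auto simp: eisenstein_fun_def [abs_def] dft5_def)
  have "lattice_coeff 5 eisenstein_fun N = 0" if "\<not> 5 dvd N" for N
  proof -
    have "\<not> 5 dvd N div d" if "d dvd N" for d
      using that \<open>\<not> 5 dvd N\<close> by (metis dvd_div_mult_self dvd_mult2)
    hence "\<not> 5 dvd int (N div d)" if "d dvd N" for d
      using that int_dvd_int_iff [of 5 "N div d"] by simp
    moreover have "N \<noteq> 0" using that by (cases "N = 0") auto
    ultimately show ?thesis by (auto simp: lattice_coeff_def dft intro!: sum.neutral)
  qed
  hence "has_fourier_expansion (lattice_sum (Suc 5) eisenstein_fun) (\<lambda>N. lattice_coeff 5 eisenstein_fun (5 * N))"
    by (intro lattice_sum_fourier_level1) (use level5_eisenstein_fun in auto)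
  hence "has_fourier_expansion (\<lambda>z. inverse (2 * sqrt5 * lipschitz_const 5 / 5 ^ 6) * lattice_sum 6 eisenstein_fun z)
     (\<lambda>N. inverse (2 * sqrt5 * lipschitz_const 5 / 5 ^ 6) * lattice_coeff 5 eisenstein_fun (5 * N))"
    by (intro fourier_cmult) simp
  also have "(\<lambda>z. inverse (2 * sqrt5 * lipschitz_const 5 / 5 ^ 6) * lattice_sum 6 eisenstein_fun z) = eisenstein6_chi5"
    by (intro ext) (simp only: eisenstein6_lattice_sum)
  also have "(\<lambda>N. inverse (2 * sqrt5 * lipschitz_const 5 / 5 ^ 6) * lattice_coeff 5 eisenstein_fun (5 * N)) = eisenstein_coeff"
  proof
    fix N
    show "inverse (2 * sqrt5 * lipschitz_const 5 / 5 ^ 6) * lattice_coeff 5 eisenstein_fun (5 * N) = eisenstein_coeff N"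
    proof (cases "N = 0")
      case True
      have "inverse (2 * sqrt5 * lipschitz_const 5 / 5 ^ 6) * (lipschitz_const 5 / 5 ^ 6 * (- 134 / sqrt5)) = - 67 / (sqrt5 * sqrt5)"
        by (simp add: field_simps del: of_real_mult)
      moreover have "lattice_coeff 5 eisenstein_fun (5 * N) = lipschitz_const 5 / 5 ^ 6 * (- 134 / sqrt5)"
        using True eisenstein_constant_term by simp
      moreover have "eisenstein_coeff N = - 67 / 5" using True by (simp add: eisenstein_coeff_def)
      ultimately show ?thesis by (simp only: sqrt5_square)
    next
      case False
      \<comment> \<open>5 divides 5 N / d exactly when d divides N, so only the divisors of N
        survive.\<close>
      have "(\<Sum>d | d dvd 5 * N. of_nat d ^ 5 * dft5 (eisenstein_fun (int (5 * N div d))) d) =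
            (\<Sum>d | d dvd N. sqrt5 * (chi5 (int d) * of_nat d ^ 5))"
      proof (rule sum.mono_neutral_cong_right)
        show "finite {d. d dvd 5 * N}" using False by (intro finite_divisors_nat) auto
        show "\<forall>d\<in>{d. d dvd 5 * N} - {d. d dvd N}. of_nat d ^ 5 * dft5 (eisenstein_fun (int (5 * N div d))) d = 0"
        proof
          fix d assume d: "d \<in> {d. d dvd 5 * N} - {d. d dvd N}"
          hence d: "d dvd 5 * N" "\<not> d dvd N" by auto
          have "\<not> 5 dvd 5 * N div d"
          proof
            assume "5 dvd 5 * N div d"
            then obtain k where "5 * N div d = 5 * k" by (elim dvdE)
            hence "5 * N = 5 * k * d" using d(1) by (metis dvd_div_mult_self)
            hence "N = k * d" by simp
            thus False using d(2) by simp
          qed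
          hence "\<not> 5 dvd int (5 * N div d)" using int_dvd_int_iff [of 5 "5 * N div d"] by simp
          thus "of_nat d ^ 5 * dft5 (eisenstein_fun (int (5 * N div d))) d = 0" by (simp add: dft)
        qed
        fix d assume "d \<in> {d. d dvd N}"
        hence "5 * N div d = 5 * (N div d)" by (auto simp: div_mult_swap)
        hence "5 dvd int (5 * N div d)" by simp
        thus "of_nat d ^ 5 * dft5 (eisenstein_fun (int (5 * N div d))) d = sqrt5 * (chi5 (int d) * of_nat d ^ 5)"
          by (simp add: dft)
      qed (auto)
      also have "\<dots> = sqrt5 * eisenstein_coeff N"
        using False by (simp add: eisenstein_coeff_def sum_distrib_left)
      finally have "lattice_coeff 5 eisenstein_fun (5 * N) = 2 * lipschitz_const 5 / 5 ^ 6 * (sqrt5 * eisenstein_coeff N)"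
        using False by (simp add: lattice_coeff_def)
      also have "\<dots> = (2 * sqrt5 * lipschitz_const 5 / 5 ^ 6) * eisenstein_coeff N" by simp
      finally have eq: "lattice_coeff 5 eisenstein_fun (5 * N) =
         (2 * sqrt5 * lipschitz_const 5 / 5 ^ 6) * eisenstein_coeff N" .
      have "inverse K * (K * e) = e" if "K \<noteq> 0" for K e :: complex
        using that by simp
      thus ?thesis unfolding eq by this simp
    qed
  qed
  finally show ?thesis .
qed

section \<open>Forms with integral coefficients\<close>

text \<open>The coefficient depends on m only, so \<open>u 0 = 0\<close> kills the whole row m = 0:
  such an Eisenstein series vanishes at infinity and has no transcendental constant term.\<close>

definition eis_inf :: "nat \<Rightarrow> (int \<Rightarrow> complex) \<Rightarrow> complex \<Rightarrow> complex" where
  "eis_inf p u z = inverse (2 * lipschitz_const p) * lattice_sum (Suc p) (\<lambda>m n. u m) z"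

definition eis_inf_coeff :: "nat \<Rightarrow> (int \<Rightarrow> complex) \<Rightarrow> nat \<Rightarrow> complex" where
  "eis_inf_coeff p u n = (if n = 0 then 0 else \<Sum>d | d dvd n. u (int (n div d)) * of_nat d ^ p)"

text \<open>The finite Fourier transform of a constant lives on multiples of 5, so d = 5 e. This
  makes the exponents of q integral, and the factor 5 from the transform times 5^p from d^p cancels
  the denominator 5^(p+1).\<close>

lemma eis_inf_fourier:
  assumes "level5_fun (Suc p) (\<lambda>m n. u m)" "p \<ge> 2" "u 0 = 0"
  shows "has_fourier_expansion (eis_inf p u) (eis_inf_coeff p u)"
proof -
  have z: "lattice_coeff p (\<lambda>m n. u m) N = 0" if "\<not> 5 dvd N" for N
  proof -
    have "\<not> 5 dvd d" if "d dvd N" for d using that \<open>\<not> 5 dvd N\<close> by auto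
    moreover have "N \<noteq> 0" using that by (cases "N = 0") auto
    ultimately show ?thesis by (auto simp: lattice_coeff_def dft5_const intro!: sum.neutral)
  qed
  have "has_fourier_expansion (\<lambda>z. inverse (2 * lipschitz_const p) * lattice_sum (Suc p) (\<lambda>m n. u m) z)
     (\<lambda>N. inverse (2 * lipschitz_const p) * lattice_coeff p (\<lambda>m n. u m) (5 * N))"
    by (intro fourier_cmult lattice_sum_fourier_level1 assms z)
  also have "(\<lambda>z. inverse (2 * lipschitz_const p) * lattice_sum (Suc p) (\<lambda>m n. u m) z) = eis_inf p u"
    by (intro ext) (simp add: eis_inf_def)
  also have "(\<lambda>N. inverse (2 * lipschitz_const p) * lattice_coeff p (\<lambda>m n. u m) (5 * N)) = eis_inf_coeff p u"
  proof
    fix N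
    show "inverse (2 * lipschitz_const p) * lattice_coeff p (\<lambda>m n. u m) (5 * N) = eis_inf_coeff p u N"
    proof (cases "N = 0")
      case True
      thus ?thesis by (simp add: lattice_coeff_def eis_inf_coeff_def assms)
    next
      case False
      have "(\<Sum>d | d dvd 5 * N. of_nat d ^ p * dft5 (\<lambda>n. u (int (5 * N div d))) d) =
            (\<Sum>d\<in>{d. d dvd 5 * N} \<inter> {d. 5 dvd d}. of_nat d ^ p * (5 * u (int (5 * N div d))))"
        by (subst sum.inter_restrict)
           (use False in \<open>auto simp: dft5_const intro!: sum.cong finite_divisors_nat\<close>)
      also have "\<dots> = (\<Sum>d | d dvd N. 5 ^ Suc p * (u (int (N div d)) * of_nat d ^ p))"
      proof (rule sum.reindex_bij_witness [of _ "\<lambda>d. 5 * d" "\<lambda>d. d div 5"])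
        fix d assume "d \<in> {d. d dvd 5 * N} \<inter> {d. 5 dvd d}"
        then obtain e where e: "d = 5 * e" "5 * e dvd 5 * N" by auto
        thus "5 * (d div 5) = d" "d div 5 \<in> {d. d dvd N}" by auto
        show "5 ^ Suc p * (u (int (N div (d div 5))) * of_nat (d div 5) ^ p) =
             of_nat d ^ p * (5 * u (int (5 * N div d)))"
          unfolding e(1) by (simp add: power_mult_distrib)
      qed auto
      also have "\<dots> = 5 ^ Suc p * eis_inf_coeff p u N"
        using False by (simp add: eis_inf_coeff_def sum_distrib_left)
      finally have "lattice_coeff p (\<lambda>m n. u m) (5 * N) = 2 * lipschitz_const p / 5 ^ Suc p * (5 ^ Suc p * eis_inf_coeff p u N)"
        using False by (simp add: lattice_coeff_def)
      thus ?thesis by simp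
    qed
  qed
  finally show ?thesis .
qed

lemma eis_inf_minus: "eis_inf p (\<lambda>m. - u m) z = - eis_inf p u z"
  using lattice_sum_scale [of "Suc p" "-1" "\<lambda>m n. u m" z] by (simp add: eis_inf_def)

lemma eis_inf_holomorphic:
  assumes "level5_fun (Suc p) (\<lambda>m n. u m)" "p \<ge> 2"
  shows "eis_inf p u holomorphic_on upper_half_plane"
  unfolding eis_inf_def [abs_def] by (intro holomorphic_intros lattice_sum_holomorphic assms)

lemma eis_inf_slash_bounded:
  assumes "level5_fun (Suc p) (\<lambda>m n. u m)" "p \<ge> 2" "\<gamma> \<in> SL2Z"
  shows "Bfun (slash (Suc p) \<gamma> (eis_inf p u)) at_i_infinity"
  unfolding eis_inf_def [abs_def] slash_cmult [abs_def]
  by (intro Bfun_mult_at_i_infinity Bfun_const lattice_sum_slash_bounded assms)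

lemma eis_inf_slash:
  assumes "level5_fun (Suc p) (\<lambda>m n. u m)" "a * d - b * c = 1" "5 dvd c" "Im z > 0"
  shows "slash (Suc p) (a, b, c, d) (eis_inf p u) z = eis_inf p (\<lambda>m. u (d * m)) z"
proof -
  have "u (d * m - c * n) = u (d * m)" for m n
  proof -
    have "d * m - c * n = d * m + 5 * (- (c div 5) * n)" using assms(3) by auto
    thus ?thesis using periodic5_shift [of u] assms(1) unfolding level5_fun_def by metis
  qed
  hence "slash (Suc p) (a, b, c, d) (lattice_sum (Suc p) (\<lambda>m n. u m)) z = lattice_sum (Suc p) (\<lambda>m n. u (d * m)) z"
    by (intro lattice_sum_transform assms)
  thus ?thesis unfolding eis_inf_def [abs_def] slash_cmult by simp
qed

section \<open>Three forms vanishing at infinity to orders 1, 2, 3\<close>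

definition u1 :: "int \<Rightarrow> complex" where
  "u1 n = (if n mod 5 = 1 then 1 else if n mod 5 = 4 then - 1 else 0)"

text \<open>\<open>u1\<close> and \<open>u2\<close> are the real and imaginary parts of the quartic
  character modulo 5 that sends 2 to i. It is odd, as weight 3 requires, and multiplication of the
  argument by d acts on the pair as a power of a quarter turn.\<close>

definition u2 :: "int \<Rightarrow> complex" where
  "u2 n = (if n mod 5 = 2 then 1 else if n mod 5 = 3 then - 1 else 0)"

lemma minus_mod5: "(- n) mod 5 = (if n mod 5 = 0 then 0 else 5 - n mod (5 :: int))"
  by (simp add: zmod_zminus1_eq_if)

lemma level5_u1: "level5_fun (Suc 2) (\<lambda>m n. u1 m)"
proof -
  have "u1 (- m) = - u1 m" for m
    by (cases m rule: mod5_cases) (simp_all add: u1_def minus_mod5)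
  moreover have "norm (u1 m) \<le> 1" for m by (simp add: u1_def)
  ultimately show ?thesis unfolding level5_fun_def by (auto simp: u1_def intro: exI [of _ 1])
qed

lemma level5_u2: "level5_fun (Suc 2) (\<lambda>m n. u2 m)"
proof -
  have "u2 (- m) = - u2 m" for m
    by (cases m rule: mod5_cases) (simp_all add: u2_def minus_mod5)
  moreover have "norm (u2 m) \<le> 1" for m by (simp add: u2_def)
  ultimately show ?thesis unfolding level5_fun_def by (auto simp: u2_def intro: exI [of _ 1])
qed

lemma level5_chi5: "level5_fun (Suc 5) (\<lambda>m n. chi5 m)"
  unfolding level5_fun_def
  using norm_chi5_le by (auto simp: chi5_minus chi5_periodic [of _ 1, simplified] intro: exI [of _ 1])

lemma u_mult:
  shows "d mod 5 = 1 \<Longrightarrow> u1 (d * m) = u1 m" "d mod 5 = 1 \<Longrightarrow> u2 (d * m) = u2 m"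
    and "d mod 5 = 2 \<Longrightarrow> u1 (d * m) = - u2 m" "d mod 5 = 2 \<Longrightarrow> u2 (d * m) = u1 m"
    and "d mod 5 = 3 \<Longrightarrow> u1 (d * m) = u2 m" "d mod 5 = 3 \<Longrightarrow> u2 (d * m) = - u1 m"
    and "d mod 5 = 4 \<Longrightarrow> u1 (d * m) = - u1 m" "d mod 5 = 4 \<Longrightarrow> u2 (d * m) = - u2 m"
proof -
  have "d * m mod 5 = (d mod 5) * (m mod 5) mod 5" by (simp add: mod_mult_eq)
  thus "d mod 5 = 1 \<Longrightarrow> u1 (d * m) = u1 m" "d mod 5 = 1 \<Longrightarrow> u2 (d * m) = u2 m"
    "d mod 5 = 2 \<Longrightarrow> u1 (d * m) = - u2 m" "d mod 5 = 2 \<Longrightarrow> u2 (d * m) = u1 m"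
    "d mod 5 = 3 \<Longrightarrow> u1 (d * m) = u2 m" "d mod 5 = 3 \<Longrightarrow> u2 (d * m) = - u1 m"
    "d mod 5 = 4 \<Longrightarrow> u1 (d * m) = - u1 m" "d mod 5 = 4 \<Longrightarrow> u2 (d * m) = - u2 m"
    by (cases m rule: mod5_cases; simp add: u1_def u2_def)+
qed

definition X1 :: "complex \<Rightarrow> complex" where "X1 = eis_inf 5 chi5"

text \<open>With E the weight 3 series of the quartic character, E^2 = \<open>X2\<close> + 2 i
  \<open>X3\<close>. The square of that character, and of its conjugate, is \<open>chi5\<close>, so
  both parts have this character. As the two series begin with q and q^2, the orders are 2 and
  3.\<close>

definition X2 :: "complex \<Rightarrow> complex" where
  "X2 z = eis_inf 2 u1 z * eis_inf 2 u1 z - eis_inf 2 u2 z * eis_inf 2 u2 z"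

definition X3 :: "complex \<Rightarrow> complex" where
  "X3 z = eis_inf 2 u1 z * eis_inf 2 u2 z"

lemma X1_modular: "X1 \<in> modular_forms 5 6 chi5"
proof -
  have "lattice_sum (Suc 5) (\<lambda>m n. chi5 m) \<in> modular_forms 5 (Suc 5) chi5"
  proof (rule lattice_sum_modular)
    fix a b c d m n :: int
    assume "5 dvd c"
    hence "d * m - c * n = d * m + 5 * (- (c div 5) * n)" by auto
    thus "chi5 (d * m - c * n) = chi5 d * chi5 m" by (simp only: chi5_periodic chi5_mult)
  qed (use level5_chi5 in auto)
  from modular_forms_cmult [OF this, of "inverse (2 * lipschitz_const 5)"]
  show ?thesis by (simp add: X1_def eis_inf_def [abs_def])
qed

lemma slash_diff: "slash k \<gamma> (\<lambda>z. f z - g z) z = slash k \<gamma> f z - slash k \<gamma> g z"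
  by (cases \<gamma>) (simp add: slash_def diff_divide_distrib)

lemma Bfun_diff_at_i_infinity:
  fixes f g :: "complex \<Rightarrow> complex"
  assumes "Bfun f at_i_infinity" "Bfun g at_i_infinity"
  shows "Bfun (\<lambda>z. f z - g z) at_i_infinity"
  using Bfun_add_at_i_infinity [OF assms(1) Bfun_mult_at_i_infinity [OF Bfun_const [of "-1"] assms(2)]]
  by simp

lemma X_slash:
  "slash 6 \<gamma> X2 z = slash 3 \<gamma> (eis_inf 2 u1) z * slash 3 \<gamma> (eis_inf 2 u1) z -
      slash 3 \<gamma> (eis_inf 2 u2) z * slash 3 \<gamma> (eis_inf 2 u2) z"
  "slash 6 \<gamma> X3 z = slash 3 \<gamma> (eis_inf 2 u1) z * slash 3 \<gamma> (eis_inf 2 u2) z"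
  using slash_mult [of 3 3] by (simp_all add: X2_def [abs_def] X3_def [abs_def] slash_diff)

lemma X_transform:
  assumes det: "a * d - b * c = 1" and c: "5 dvd c" and z: "Im z > 0"
  shows "slash 6 (a, b, c, d) X2 z = chi5 d * X2 z" "slash 6 (a, b, c, d) X3 z = chi5 d * X3 z"
proof -
  have 1: "slash 3 (a, b, c, d) (eis_inf 2 u1) z = eis_inf 2 (\<lambda>m. u1 (d * m)) z"
    using eis_inf_slash [OF level5_u1 det c z] by simp
  have 2: "slash 3 (a, b, c, d) (eis_inf 2 u2) z = eis_inf 2 (\<lambda>m. u2 (d * m)) z"
    using eis_inf_slash [OF level5_u2 det c z] by simp
  have "d mod 5 \<noteq> 0" using Gamma0_5_not_dvd(2) [OF det c] by (simp add: dvd_eq_mod_eq_0)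
  thus "slash 6 (a, b, c, d) X2 z = chi5 d * X2 z" "slash 6 (a, b, c, d) X3 z = chi5 d * X3 z"
    unfolding X_slash 1 2
    by (cases d rule: mod5_cases; simp add: u_mult eis_inf_minus chi5_eq X2_def X3_def)+
qed

lemma X_modular: "X2 \<in> modular_forms 5 6 chi5" "X3 \<in> modular_forms 5 6 chi5"
proof -
  have hol: "X2 holomorphic_on upper_half_plane" "X3 holomorphic_on upper_half_plane"
    unfolding X2_def [abs_def] X3_def [abs_def]
    by (intro holomorphic_intros eis_inf_holomorphic level5_u1 level5_u2; simp)+
  have b: "Bfun (slash 3 \<gamma> (eis_inf 2 u1)) at_i_infinity" "Bfun (slash 3 \<gamma> (eis_inf 2 u2)) at_i_infinity"
    if "\<gamma> \<in> SL2Z" for \<gamma>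
    using eis_inf_slash_bounded [OF level5_u1 _ that] eis_inf_slash_bounded [OF level5_u2 _ that]
    by simp_all
  have bd: "Bfun (slash 6 \<gamma> X2) at_i_infinity" "Bfun (slash 6 \<gamma> X3) at_i_infinity" if "\<gamma> \<in> SL2Z" for \<gamma>
    unfolding X_slash [abs_def]
    by (intro Bfun_diff_at_i_infinity Bfun_mult_at_i_infinity b that)+
  show "X2 \<in> modular_forms 5 6 chi5" "X3 \<in> modular_forms 5 6 chi5"
    using hol bd X_transform by (auto simp: modular_forms_def Gamma0_def SL2Z_def upper_half_plane_def)
qed

section \<open>Fourier coefficients of the three forms\<close>

definition conv :: "(nat \<Rightarrow> complex) \<Rightarrow> (nat \<Rightarrow> complex) \<Rightarrow> nat \<Rightarrow> complex" where
  "conv a b n = (\<Sum>i\<le>n. a i * b (n - i))"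

lemma fourier_conv:
  assumes "has_fourier_expansion f a" "has_fourier_expansion g b"
  shows "has_fourier_expansion (\<lambda>z. f z * g z) (conv a b)"
  using fourier_mult [OF assms] by (simp add: conv_def [abs_def])

definition x1 :: "nat \<Rightarrow> complex" where "x1 = eis_inf_coeff 5 chi5"

definition x2 :: "nat \<Rightarrow> complex" where
  "x2 n = conv (eis_inf_coeff 2 u1) (eis_inf_coeff 2 u1) n - conv (eis_inf_coeff 2 u2) (eis_inf_coeff 2 u2) n"

definition x3 :: "nat \<Rightarrow> complex" where
  "x3 = conv (eis_inf_coeff 2 u1) (eis_inf_coeff 2 u2)"

lemma X1_fourier: "has_fourier_expansion X1 x1"
  unfolding X1_def x1_def by (rule eis_inf_fourier [OF level5_chi5]) (auto simp: chi5_eq)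

lemma X_fourier: "has_fourier_expansion X2 x2" "has_fourier_expansion X3 x3"
proof -
  have 1: "has_fourier_expansion (eis_inf 2 u1) (eis_inf_coeff 2 u1)"
    by (rule eis_inf_fourier [OF level5_u1]) (auto simp: u1_def)
  have 2: "has_fourier_expansion (eis_inf 2 u2) (eis_inf_coeff 2 u2)"
    by (rule eis_inf_fourier [OF level5_u2]) (auto simp: u2_def)
  show "has_fourier_expansion X2 x2" "has_fourier_expansion X3 x3"
    unfolding X2_def [abs_def] X3_def [abs_def] x2_def [abs_def] x3_def
    by (intro fourier_diff fourier_conv 1 2)+
qed

lemma conv_Ints: "(\<And>n. a n \<in> \<int>) \<Longrightarrow> (\<And>n. b n \<in> \<int>) \<Longrightarrow> conv a b n \<in> \<int>"
  unfolding conv_def by (intro Ints_sum Ints_mult)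

lemma eis_inf_coeff_Ints: "(\<And>n. u n \<in> \<int>) \<Longrightarrow> eis_inf_coeff p u n \<in> \<int>"
  unfolding eis_inf_coeff_def by (auto intro!: Ints_sum Ints_mult Ints_power)

lemma integral_coeffs: "x1 n \<in> \<int>" "x2 n \<in> \<int>" "x3 n \<in> \<int>"
proof -
  have "chi5 n \<in> \<int>" "u1 n \<in> \<int>" "u2 n \<in> \<int>" for n
    by (auto simp: chi5_eq u1_def u2_def)
  thus "x1 n \<in> \<int>" "x2 n \<in> \<int>" "x3 n \<in> \<int>"
    unfolding x1_def x2_def x3_def by (auto intro!: Ints_diff conv_Ints eis_inf_coeff_Ints)
qed

text \<open>Makes divisor sums computable by rewriting; the divisor 1 is split off so that the list
  bounds are numerals.\<close>

lemma sum_divisors_conv_list: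
  fixes f :: "nat \<Rightarrow> 'a :: comm_monoid_add"
  assumes "n > 0"
  shows "(\<Sum>d | d dvd n. f d) = f 1 + sum_list (map f (filter (\<lambda>d. d dvd n) [2..<n + 1]))"
proof -
  have "{d. d dvd n} = set (filter (\<lambda>d. d dvd n) [1..<n + 1])"
    using assms by (auto dest: dvd_imp_le intro: Suc_leI dvd_pos_nat)
  hence "(\<Sum>d | d dvd n. f d) = sum_list (map f (filter (\<lambda>d. d dvd n) [1..<n + 1]))"
    by (simp add: sum_list_distinct_conv_sum_set)
  also have "[1..<n + 1] = 1 # [2..<n + 1]"
    using assms by (subst upt_conv_Cons) (auto simp: numeral_2_eq_2)
  finally show ?thesis by simp
qed

lemma x1_values: "x1 0 = 0" "x1 1 = 1" "x1 2 = 31" "x1 3 = 242" "x1 4 = 993" "x1 5 = 3125"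
  by (simp_all add: x1_def eis_inf_coeff_def sum_divisors_conv_list upt_rec_numeral chi5_eq)

lemma u1_values: "eis_inf_coeff 2 u1 0 = 0" "eis_inf_coeff 2 u1 1 = 1" "eis_inf_coeff 2 u1 2 = 4"
  "eis_inf_coeff 2 u1 3 = 9" "eis_inf_coeff 2 u1 4 = 15" "eis_inf_coeff 2 u1 5 = 25" "eis_inf_coeff 2 u1 6 = 37"
  by (simp_all add: eis_inf_coeff_def sum_divisors_conv_list upt_rec_numeral u1_def)

lemma u2_values: "eis_inf_coeff 2 u2 0 = 0" "eis_inf_coeff 2 u2 1 = 0" "eis_inf_coeff 2 u2 2 = 1"
  "eis_inf_coeff 2 u2 3 = - 1" "eis_inf_coeff 2 u2 4 = 4" "eis_inf_coeff 2 u2 5 = 0" "eis_inf_coeff 2 u2 6 = 5"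
  by (simp_all add: eis_inf_coeff_def sum_divisors_conv_list upt_rec_numeral u2_def)

lemma conv_values:
  "conv a b 0 = a 0 * b 0"
  "conv a b 1 = a 0 * b 1 + a 1 * b 0"
  "conv a b 2 = a 0 * b 2 + a 1 * b 1 + a 2 * b 0"
  "conv a b 3 = a 0 * b 3 + a 1 * b 2 + a 2 * b 1 + a 3 * b 0"
  "conv a b 4 = a 0 * b 4 + a 1 * b 3 + a 2 * b 2 + a 3 * b 1 + a 4 * b 0"
  "conv a b 5 = a 0 * b 5 + a 1 * b 4 + a 2 * b 3 + a 3 * b 2 + a 4 * b 1 + a 5 * b 0"
  "conv a b 6 = a 0 * b 6 + a 1 * b 5 + a 2 * b 4 + a 3 * b 3 + a 4 * b 2 + a 5 * b 1 + a 6 * b 0"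
  by (simp_all add: conv_def eval_nat_numeral)

lemma x2_values: "x2 0 = 0" "x2 1 = 0" "x2 2 = 1" "x2 3 = 8" "x2 4 = 33" "x2 5 = 104" "x2 6 = 242"
  unfolding x2_def conv_values u1_values u2_values by simp_all

lemma x3_values: "x3 0 = 0" "x3 1 = 0" "x3 2 = 0" "x3 3 = 1" "x3 4 = 3" "x3 5 = 9" "x3 6 = 22"
  unfolding x3_def conv_values u1_values u2_values by simp_all

lemma eisenstein_coeff_values:
  assumes "n \<le> 10"
  shows "eisenstein_coeff n = [- 67 / 5, 1, - 31, - 242, 993, 1, 7502, - 16806, - 31775, 58807, - 31] ! n"
proof -
  have "n = 0 \<or> n = 1 \<or> n = 2 \<or> n = 3 \<or> n = 4 \<or> n = 5 \<or> n = 6 \<or> n = 7 \<or> n = 8 \<or> n = 9 \<or> n = 10"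
    using assms by presburger
  thus ?thesis
    by (elim disjE) (simp_all add: eisenstein_coeff_def sum_divisors_conv_list upt_rec_numeral chi5_eq)
qed

section \<open>The prime ideal above 67\<close>

lemma alpha_eq: "alpha = - (\<i> * of_real (sqrt 44))"
  unfolding alpha_def by simp

lemma alpha_square: "alpha * alpha = - 44"
  unfolding alpha_eq by (simp add: algebra_simps flip: of_real_mult)

lemma Im_Rats: "x \<in> \<rat> \<Longrightarrow> Im x = 0"
  by (elim Rats_cases') (simp add: Im_divide)

section \<open>The order Z[alpha] and the field Q(alpha)\<close>

definition Zalpha :: "complex set" where
  "Zalpha = {of_int u + of_int v * alpha | u v. True}"

lemma ZalphaI: "x = of_int u + of_int v * alpha \<Longrightarrow> x \<in> Zalpha"
  by (auto simp: Zalpha_def)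

lemma Zalpha_of_int: "of_int u \<in> Zalpha"
  by (rule ZalphaI [of _ u 0]) simp

lemma Zalpha_add: "x \<in> Zalpha \<Longrightarrow> y \<in> Zalpha \<Longrightarrow> x + y \<in> Zalpha"
  unfolding Zalpha_def
proof safe
  fix u v u' v' :: int
  show "\<exists>u'' v''. of_int u + of_int v * alpha + (of_int u' + of_int v' * alpha) = of_int u'' + of_int v'' * alpha \<and> True"
    by (rule exI [of _ "u + u'"], rule exI [of _ "v + v'"]) (simp add: algebra_simps)
qed

lemma Zalpha_mult_eq:
  "(of_int u + of_int v * alpha) * (of_int u' + of_int v' * alpha) =
     of_int (u * u' - 44 * v * v') + of_int (u * v' + u' * v) * alpha"
proof -
  have "(of_int u + of_int v * alpha) * (of_int u' + of_int v' * alpha) =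
     of_int u * of_int u' + of_int v * of_int v' * (alpha * alpha) + (of_int u * of_int v' + of_int u' * of_int v) * alpha"
    by (simp add: algebra_simps)
  thus ?thesis by (simp add: alpha_square)
qed

lemma Zalpha_mult: "x \<in> Zalpha \<Longrightarrow> y \<in> Zalpha \<Longrightarrow> x * y \<in> Zalpha"
  unfolding Zalpha_def using Zalpha_mult_eq by blast

lemma Zalpha_power: "x \<in> Zalpha \<Longrightarrow> x ^ n \<in> Zalpha"
  using Zalpha_of_int [of 1] by (induction n) (auto intro: Zalpha_mult)

lemma Zalpha_sum: "(\<And>i. i \<in> I \<Longrightarrow> f i \<in> Zalpha) \<Longrightarrow> sum f I \<in> Zalpha"
  using Zalpha_of_int [of 0] by (induction I rule: infinite_finite_induct) (auto intro: Zalpha_add)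

lemma Zalpha_cnj: "x \<in> Zalpha \<Longrightarrow> cnj x \<in> Zalpha"
  unfolding Zalpha_def
proof safe
  fix u v :: int
  show "\<exists>u' v'. cnj (of_int u + of_int v * alpha) = of_int u' + of_int v' * alpha \<and> True"
    by (rule exI [of _ u], rule exI [of _ "- v"]) (simp add: alpha_eq)
qed

lemma Zalpha_Int_Rats: "x \<in> Zalpha \<Longrightarrow> x \<in> \<rat> \<Longrightarrow> x \<in> \<int>"
proof -
  assume "x \<in> Zalpha" "x \<in> \<rat>"
  then obtain u v where x: "x = of_int u + of_int v * alpha" by (auto simp: Zalpha_def)
  have "Im x = 0" using \<open>x \<in> \<rat>\<close> by (rule Im_Rats)
  hence "v = 0" by (simp add: x alpha_eq)
  thus ?thesis by (simp add: x)
qed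

text \<open>The set of such combinations is closed under the field operations; inverses come from
  the conjugate and the norm a^2 + 44 b^2, which vanishes only at 0.\<close>

lemma rat_adjoin_alphaD:
  assumes "x \<in> rat_adjoin alpha"
  shows "\<exists>a\<in>\<rat>. \<exists>b\<in>\<rat>. x = a + b * alpha"
proof -
  interpret T: field "ring_of_type_algebra :: complex ring" by (rule field_from_type_algebra)
  note simps = ring_of_type_algebra_def
  have inv: "inv\<^bsub>ring_of_type_algebra\<^esub> h = inverse h" if "h \<noteq> 0" for h :: complex
    by (rule T.comm_inv_char) (use that in \<open>auto simp: simps\<close>)
  have minus: "\<ominus>\<^bsub>ring_of_type_algebra\<^esub> h = - h" for h :: complex
    by (rule T.minus_equality) (auto simp: simps)
  show ?thesis
    using assms unfolding rat_adjoin_def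
  proof (induction rule: generate_field.induct)
    case one
    show ?case by (rule bexI [of _ 1], rule bexI [of _ 0]) (auto simp: simps)
  next
    case (incl h)
    thus ?case by (intro bexI [of _ 0] bexI [of _ 1]) auto
  next
    case (a_inv h)
    then obtain a b where "a \<in> \<rat>" "b \<in> \<rat>" "h = a + b * alpha" by blast
    thus ?case unfolding minus by (intro bexI [of _ "- a"] bexI [of _ "- b"]) auto
  next
    case (m_inv h)
    then obtain a b where ab: "a \<in> \<rat>" "b \<in> \<rat>" "h = a + b * alpha" by blast
    have h: "h \<noteq> 0" using m_inv by (simp add: simps)
    define N where "N = a * a + 44 * b * b"
    have "h * (a - b * alpha) = a * a - b * b * (alpha * alpha)"
      by (simp add: ab algebra_simps)
    also have "\<dots> = N" by (simp add: N_def alpha_square)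
    finally have N: "h * (a - b * alpha) = N" .
    have "N \<noteq> 0"
    proof
      assume "N = 0"
      have "Re N = Re a * Re a + 44 * (Re b * Re b)"
        using Im_Rats [OF ab(1)] Im_Rats [OF ab(2)] by (simp add: N_def)
      hence "Re a * Re a + 44 * (Re b * Re b) = 0" using \<open>N = 0\<close> by simp
      hence "Re a = 0" "Re b = 0"
        by (smt (verit) mult_eq_0_iff zero_le_square)+
      hence "a = 0" "b = 0"
        using Im_Rats [OF ab(1)] Im_Rats [OF ab(2)] by (auto simp: complex_eq_iff)
      with h ab show False by simp
    qed
    have "inverse h = (a - b * alpha) / N"
      using N h \<open>N \<noteq> 0\<close> by (simp add: field_simps)
    also have "\<dots> = a / N + (- b / N) * alpha" by (simp add: diff_divide_distrib)
    finally have "inverse h = a / N + (- b / N) * alpha" .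
    moreover have "N \<in> \<rat>" using ab by (auto simp: N_def)
    ultimately show ?case
      unfolding inv [OF h] using ab by (intro bexI [of _ "a / N"] bexI [of _ "- b / N"]) auto
  next
    case (eng_add h1 h2)
    then obtain a b a' b' where "a \<in> \<rat>" "b \<in> \<rat>" "h1 = a + b * alpha" "a' \<in> \<rat>" "b' \<in> \<rat>" "h2 = a' + b' * alpha"
      by blast
    thus ?case
      by (intro bexI [of _ "a + a'"] bexI [of _ "b + b'"]) (auto simp: simps algebra_simps)
  next
    case (eng_mult h1 h2)
    then obtain a b a' b' where h: "a \<in> \<rat>" "b \<in> \<rat>" "h1 = a + b * alpha" "a' \<in> \<rat>" "b' \<in> \<rat>" "h2 = a' + b' * alpha"
      by blast
    have "h1 * h2 = (a * a' + b * b' * (alpha * alpha)) + (a * b' + b * a') * alpha"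
      by (simp add: h algebra_simps)
    also have "\<dots> = (a * a' - 44 * b * b') + (a * b' + b * a') * alpha"
      by (simp add: alpha_square)
    finally have "h1 \<otimes>\<^bsub>ring_of_type_algebra\<^esub> h2 = (a * a' - 44 * b * b') + (a * b' + b * a') * alpha"
      by (simp add: simps)
    thus ?case using h
      by (intro bexI [of _ "a * a' - 44 * b * b'"] bexI [of _ "a * b' + b * a'"]) auto
  qed
qed

lemma rat_adjoin_closed:
  shows "x \<in> rat_adjoin w \<Longrightarrow> y \<in> rat_adjoin w \<Longrightarrow> x + y \<in> rat_adjoin w"
    and "x \<in> rat_adjoin w \<Longrightarrow> y \<in> rat_adjoin w \<Longrightarrow> x * y \<in> rat_adjoin w"
    and "x \<in> rat_adjoin w \<Longrightarrow> - x \<in> rat_adjoin w"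
    and "1 \<in> rat_adjoin w" "w \<in> rat_adjoin w"
proof -
  interpret T: field "ring_of_type_algebra :: complex ring" by (rule field_from_type_algebra)
  note simps = ring_of_type_algebra_def
  have minus: "\<ominus>\<^bsub>ring_of_type_algebra\<^esub> h = - h" for h :: complex
    by (rule T.minus_equality) (auto simp: simps)
  show "x \<in> rat_adjoin w \<Longrightarrow> y \<in> rat_adjoin w \<Longrightarrow> x + y \<in> rat_adjoin w"
    using generate_field.eng_add [of x ring_of_type_algebra "{w}" y] by (simp add: rat_adjoin_def simps)
  show "x \<in> rat_adjoin w \<Longrightarrow> y \<in> rat_adjoin w \<Longrightarrow> x * y \<in> rat_adjoin w"
    using generate_field.eng_mult [of x ring_of_type_algebra "{w}" y] by (simp add: rat_adjoin_def simps)
  show "x \<in> rat_adjoin w \<Longrightarrow> - x \<in> rat_adjoin w"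
    using generate_field.a_inv [of x ring_of_type_algebra "{w}"] by (simp add: rat_adjoin_def minus)
  show "1 \<in> rat_adjoin w"
    using generate_field.one [of ring_of_type_algebra "{w}"] by (simp add: rat_adjoin_def simps)
  show "w \<in> rat_adjoin w"
    unfolding rat_adjoin_def by (rule generate_field.incl) simp
qed

lemma Zalpha_subset_rat_adjoin: "x \<in> Zalpha \<Longrightarrow> x \<in> rat_adjoin alpha"
proof -
  have nat: "of_nat n \<in> rat_adjoin alpha" for n
  proof (induction n)
    case 0
    have "1 + - 1 \<in> rat_adjoin alpha" by (intro rat_adjoin_closed)
    thus ?case by simp
  qed (auto intro: rat_adjoin_closed)
  have int: "of_int n \<in> rat_adjoin alpha" for n
  proof (cases n)
    case (nonneg m)
    thus ?thesis using nat by simp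
  next
    case (neg m)
    thus ?thesis using rat_adjoin_closed(3) [OF nat [of "Suc m"]] by (simp del: of_nat_Suc)
  qed
  assume "x \<in> Zalpha"
  thus ?thesis unfolding Zalpha_def using int by (auto intro!: rat_adjoin_closed)
qed

section \<open>Integrality through bounded denominators\<close>

lemma Rats_common_denominator:
  assumes "a \<in> \<rat>" "b \<in> \<rat>"
  obtains d :: int where "d > 0" "of_int d * a \<in> (\<int> :: complex set)" "of_int d * b \<in> \<int>"
proof -
  obtain p q where a: "q > 0" "a = of_int p / of_int q" using assms(1) by (elim Rats_cases') auto
  obtain p' q' where b: "q' > 0" "b = of_int p' / of_int q'" using assms(2) by (elim Rats_cases') auto
  have "of_int (q * q') * a = of_int (p * q')" "of_int (q * q') * b = of_int (p' * q)"
    using a b by simp_all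
  thus ?thesis using that [of "q * q'"] a b by (metis Ints_of_int mult_pos_pos)
qed

text \<open>In lowest terms q^j divides D for every j. If q >= 2, the choice j = D contradicts D <
  2^D.\<close>

lemma Rats_bounded_denominators:
  fixes r :: complex and D :: int
  assumes "r \<in> \<rat>" "D > 0" "\<And>j. of_int D * r ^ j \<in> \<int>"
  shows "r \<in> \<int>"
proof -
  obtain p q where r: "q > 0" "coprime p q" "r = of_int p / of_int q"
    using assms(1) by (elim Rats_cases') auto
  have dvd: "q ^ j dvd D" for j
  proof -
    obtain k where k: "of_int D * r ^ j = of_int k" using assms(3) [of j] by (elim Ints_cases)
    have "of_int (D * p ^ j) = (of_int (k * q ^ j) :: complex)"
      using k r(1) by (simp add: r(3) power_divide field_simps)
    hence "D * p ^ j = k * q ^ j" by (simp only: of_int_eq_iff)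
    hence "q ^ j dvd D * p ^ j" by simp
    moreover have "coprime (q ^ j) (p ^ j)" using r(2) by (simp add: coprime_commute)
    ultimately show ?thesis by (simp add: coprime_dvd_mult_left_iff)
  qed
  have "q = 1"
  proof (rule ccontr)
    assume "q \<noteq> 1"
    hence "q \<ge> 2" using r(1) by simp
    have "int (2 ^ nat D) = 2 ^ nat D" by simp
    also have "\<dots> \<le> q ^ nat D" using \<open>q \<ge> 2\<close> by (intro power_mono) auto
    also have "\<dots> \<le> D" using dvd assms(2) by (intro zdvd_imp_le) auto
    finally have "int (2 ^ nat D) \<le> D" .
    moreover have "int (nat D) < int (2 ^ nat D)" using less_exp [of "nat D"] by (simp only: of_nat_less_iff)
    moreover have "int (nat D) = D" using assms(2) by simp
    ultimately show False by linarith
  qed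
  thus ?thesis using r by simp
qed

text \<open>For elements of the quadratic field, being integral over the integers amounts to the powers
  having bounded denominators; this criterion is visibly stable under sums and products.\<close>

definition bounded_powers :: "complex \<Rightarrow> bool" where
  "bounded_powers x \<longleftrightarrow> (\<exists>D::int. D > 0 \<and> (\<forall>j. of_int D * x ^ j \<in> Zalpha))"

lemma bounded_powers_mult:
  assumes "bounded_powers x" "bounded_powers y"
  shows "bounded_powers (x * y)"
proof -
  obtain D D' :: int where D: "D > 0" "\<And>j. of_int D * x ^ j \<in> Zalpha"
    and D': "D' > 0" "\<And>j. of_int D' * y ^ j \<in> Zalpha"
    using assms unfolding bounded_powers_def by blast
  have "of_int (D * D') * (x * y) ^ j \<in> Zalpha" for j
    using Zalpha_mult [OF D(2) D'(2), of j j] by (simp add: power_mult_distrib mult_ac)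
  thus ?thesis unfolding bounded_powers_def using D(1) D'(1) by (intro exI [of _ "D * D'"]) auto
qed

lemma bounded_powers_add:
  assumes "bounded_powers x" "bounded_powers y"
  shows "bounded_powers (x + y)"
proof -
  obtain D D' :: int where D: "D > 0" "\<And>j. of_int D * x ^ j \<in> Zalpha"
    and D': "D' > 0" "\<And>j. of_int D' * y ^ j \<in> Zalpha"
    using assms unfolding bounded_powers_def by blast
  have "of_int (D * D') * (x + y) ^ j \<in> Zalpha" for j
  proof -
    have "of_int (D * D') * (x + y) ^ j =
            (\<Sum>k\<le>j. of_int (int (j choose k)) * ((of_int D * x ^ k) * (of_int D' * y ^ (j - k))))"
      by (simp add: binomial_ring sum_distrib_left mult_ac)
    also have "\<dots> \<in> Zalpha"
      by (intro Zalpha_sum Zalpha_mult Zalpha_of_int D(2) D'(2))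
    finally show ?thesis .
  qed
  thus ?thesis unfolding bounded_powers_def using D(1) D'(1) by (intro exI [of _ "D * D'"]) auto
qed

lemma bounded_powers_cnj: "bounded_powers x \<Longrightarrow> bounded_powers (cnj x)"
  unfolding bounded_powers_def using Zalpha_cnj by (metis complex_cnj_mult complex_cnj_of_int complex_cnj_power)

text \<open>A monic equation of degree n rewrites x^j for j >= n by lower powers with integer
  coefficients, so the denominator d^n that serves the powers below n serves all of them.\<close>

lemma algebraic_int_imp_bounded_powers:
  assumes x: "x = a + b * alpha" "a \<in> \<rat>" "b \<in> \<rat>" and int: "algebraic_int x"
  shows "bounded_powers x"
proof -
  obtain p :: "int poly" where p: "poly (map_poly of_int p) x = 0" "Polynomial.lead_coeff p = 1"
    using int unfolding algebraic_int_altdef_ipoly by blast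
  define n where "n = Polynomial.degree p"
  obtain d :: int where d: "d > 0" "of_int d * a \<in> \<int>" "of_int d * b \<in> \<int>"
    using Rats_common_denominator x by blast
  have dx: "of_int d * x \<in> Zalpha"
  proof -
    have "of_int d * x = of_int d * a + of_int d * b * alpha" by (simp add: x(1) algebra_simps)
    thus ?thesis using d(2,3) by (auto elim!: Ints_cases intro: ZalphaI)
  qed
  have sum0: "(\<Sum>i\<le>n. of_int (Polynomial.coeff p i) * x ^ i) = 0"
    using p(1) by (simp add: poly_altdef n_def coeff_map_poly degree_map_poly)
  have xn: "x ^ n = - (\<Sum>i<n. of_int (Polynomial.coeff p i) * x ^ i)"
  proof -
    have "(\<Sum>i\<le>n. of_int (Polynomial.coeff p i) * x ^ i) = (\<Sum>i<n. of_int (Polynomial.coeff p i) * x ^ i) + x ^ n"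
      using p(2) by (simp add: n_def flip: lessThan_Suc_atMost)
    with sum0 show ?thesis by (simp add: eq_neg_iff_add_eq_0 add.commute)
  qed
  have "of_int (d ^ n) * x ^ j \<in> Zalpha" for j
  proof (induction j rule: less_induct)
    case (less j)
    show ?case
    proof (cases "j < n")
      case True
      have "of_int (d ^ n) * x ^ j = of_int (d ^ (n - j)) * (of_int d * x) ^ j"
        using True by (simp add: power_mult_distrib flip: power_add mult.assoc)
      thus ?thesis using dx by (auto intro!: Zalpha_mult Zalpha_of_int Zalpha_power)
    next
      case False
      have "x ^ j = x ^ (j - n) * x ^ n" using False by (simp flip: power_add)
      hence "of_int (d ^ n) * x ^ j = (\<Sum>i<n. of_int (- Polynomial.coeff p i) * (of_int (d ^ n) * x ^ (j - n + i)))"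
        unfolding xn by (simp add: sum_distrib_left power_add mult_ac flip: sum_negf)
      also have "\<dots> \<in> Zalpha"
        using False by (intro Zalpha_sum Zalpha_mult Zalpha_of_int less) auto
      finally show ?thesis .
    qed
  qed
  thus ?thesis unfolding bounded_powers_def using d(1) by (intro exI [of _ "d ^ n"]) auto
qed

lemma bounded_powers_Rats:
  assumes "bounded_powers x" "x \<in> \<rat>"
  shows "x \<in> \<int>"
proof -
  obtain D :: int where D: "D > 0" "\<And>j. of_int D * x ^ j \<in> Zalpha"
    using assms(1) unfolding bounded_powers_def by blast
  have "of_int D * x ^ j \<in> \<int>" for j
    using D(2) [of j] assms(2) by (intro Zalpha_Int_Rats) auto
  thus ?thesis using Rats_bounded_denominators assms(2) D(1) by blast
qed

text \<open>Trace and norm are the sum and product of x with its complex conjugate; they are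
  rational and have bounded powers, hence are integers.\<close>

lemma bounded_powers_trace_norm:
  assumes x: "x = a + b * alpha" "a \<in> \<rat>" "b \<in> \<rat>" and bd: "bounded_powers x"
  shows "2 * a \<in> \<int>" "a * a + 44 * b * b \<in> \<int>"
proof -
  have ca: "cnj a = a" "cnj b = b"
    using Im_Rats [OF x(2)] Im_Rats [OF x(3)] by (auto simp: complex_eq_iff)
  have cx: "cnj x = a - b * alpha" by (simp add: x(1) ca) (simp add: alpha_eq)
  have "x + cnj x = 2 * a" by (simp add: cx) (simp add: x(1))
  moreover have "bounded_powers (x + cnj x)" by (intro bounded_powers_add bounded_powers_cnj bd)
  ultimately show "2 * a \<in> \<int>" using bounded_powers_Rats [of "2 * a"] x(2) by auto
  have "x * cnj x = a * a - b * b * (alpha * alpha)" unfolding cx unfolding x(1) by (simp add: algebra_simps)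
  hence "x * cnj x = a * a + 44 * b * b" by (simp add: alpha_square)
  moreover have "bounded_powers (x * cnj x)" by (intro bounded_powers_mult bounded_powers_cnj bd)
  ultimately show "a * a + 44 * b * b \<in> \<int>"
    using bounded_powers_Rats [of "a * a + 44 * b * b"] x(2,3) by auto
qed

lemma bounded_powers_imp_algebraic_int:
  assumes x: "x = a + b * alpha" "a \<in> \<rat>" "b \<in> \<rat>" and bd: "bounded_powers x"
  shows "algebraic_int x"
proof -
  define p where "p = [:a * a + 44 * b * b, - (2 * a), 1:]"
  show ?thesis
  proof (rule algebraic_int.intros [of p])
    show "Polynomial.lead_coeff p = 1" by (simp add: p_def)
    have tn: "a * a + 44 * b * b \<in> \<int>" "- (2 * a) \<in> \<int>"
      using bounded_powers_trace_norm [OF assms] Ints_minus by blast+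
    have "Polynomial.coeff p i \<in> {a * a + 44 * b * b, - (2 * a), 1, 0}" for i
      by (simp add: p_def coeff_pCons split: nat.splits)
    thus "\<forall>i. Polynomial.coeff p i \<in> \<int>"
      using tn by (metis insertE singletonD Ints_0 Ints_1)
    have "x * x = a * a + 2 * a * b * alpha + b * b * (alpha * alpha)" by (simp add: x(1) algebra_simps)
    hence xx: "x * x = a * a + 2 * a * b * alpha - 44 * b * b" by (simp add: alpha_square)
    have "poly p x = a * a + 44 * b * b - 2 * a * x + x * x" by (simp add: p_def algebra_simps)
    also have "\<dots> = 0" unfolding xx unfolding x(1) by (simp add: algebra_simps)
    finally show "poly p x = 0" .
  qed
qed

text \<open>With integral trace 2 a and norm N, the number 176 b^2 = 4 N - (2 a)^2 is an integer; a
  further factor 176 makes it the square of 176 b, a rational root of a monic integer polynomial and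
  so an integer. The multiplier 352 is not optimal, but it is prime to 67.\<close>

lemma bounded_powers_multiple:
  assumes x: "x = a + b * alpha" "a \<in> \<rat>" "b \<in> \<rat>" and bd: "bounded_powers x"
  shows "352 * x \<in> Zalpha"
proof -
  note tn = bounded_powers_trace_norm [OF assms]
  have "176 * b \<in> \<int>"
  proof (rule bounded_powers_Rats)
    have "(176 * b) * (176 * b) = 176 * (4 * (a * a + 44 * b * b) - (2 * a) * (2 * a))"
      by (simp add: algebra_simps)
    also have "\<dots> \<in> \<int>" using tn by (metis Ints_mult Ints_diff Ints_numeral)
    finally obtain s where s: "(176 * b) * (176 * b) = of_int s" by (elim Ints_cases)
    show "176 * b \<in> \<rat>" using x by auto
    show "bounded_powers (176 * b)"
    proof (rule algebraic_int_imp_bounded_powers [of _ "176 * b" 0])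
      show "algebraic_int (176 * b)"
        by (rule algebraic_int.intros [of "[:- of_int s, 0, 1:]"])
           (use s in \<open>auto simp: coeff_pCons algebra_simps split: nat.splits\<close>)
    qed (use x in auto)
  qed
  then obtain t w where "2 * a = of_int t" "176 * b = of_int w" using tn(1) by (auto elim!: Ints_cases)
  moreover have "352 * x = 176 * (2 * a) + 2 * (176 * b) * alpha" by (simp add: x(1) algebra_simps)
  ultimately show ?thesis by (intro ZalphaI [of _ "176 * t" "2 * w"]) simp
qed

section \<open>The ring of integers and the prime ideal\<close>

definition OK :: "complex set" where
  "OK = {x \<in> rat_adjoin alpha. algebraic_int x}"

text \<open>Transfers closure under sums and products from bounded powers to algebraic integers of
  the field.\<close>

lemma OK_iff: "x \<in> OK \<longleftrightarrow> x \<in> rat_adjoin alpha \<and> bounded_powers x"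
  unfolding OK_def
  using rat_adjoin_alphaD [of x] algebraic_int_imp_bounded_powers bounded_powers_imp_algebraic_int by blast

lemma Zalpha_subset_OK: "x \<in> Zalpha \<Longrightarrow> x \<in> OK"
  unfolding OK_iff bounded_powers_def
  using Zalpha_subset_rat_adjoin Zalpha_power by (auto intro!: exI [of _ 1])

lemma OK_closed:
  "x \<in> OK \<Longrightarrow> y \<in> OK \<Longrightarrow> x + y \<in> OK" "x \<in> OK \<Longrightarrow> y \<in> OK \<Longrightarrow> x * y \<in> OK"
  "x \<in> OK \<Longrightarrow> - x \<in> OK" "of_int n \<in> OK"
proof -
  show "x \<in> OK \<Longrightarrow> y \<in> OK \<Longrightarrow> x + y \<in> OK" "x \<in> OK \<Longrightarrow> y \<in> OK \<Longrightarrow> x * y \<in> OK"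
    unfolding OK_iff by (auto intro: rat_adjoin_closed bounded_powers_add bounded_powers_mult)
  show "x \<in> OK \<Longrightarrow> - x \<in> OK" by (auto simp: OK_def intro: rat_adjoin_closed)
  show "of_int n \<in> OK" by (intro Zalpha_subset_OK Zalpha_of_int)
qed

lemma OK_multiple: "x \<in> OK \<Longrightarrow> 352 * x \<in> Zalpha"
  using rat_adjoin_alphaD [of x] bounded_powers_multiple unfolding OK_iff by blast

text \<open>Reduction modulo the prime sends \<^const>\<open>alpha\<close> to -31; the factor 352 clears
  denominators and is invertible modulo 67.\<close>

definition prime67 :: "complex set" where
  "prime67 = {x \<in> OK. \<exists>u v. 352 * x = of_int u + of_int v * alpha \<and> 67 dvd u - 31 * v}"

lemma ring_of_integers_simps:
  "carrier (ring_of_integers (rat_adjoin alpha)) = OK"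
  "x \<otimes>\<^bsub>ring_of_integers (rat_adjoin alpha)\<^esub> y = x * y"
  "x \<oplus>\<^bsub>ring_of_integers (rat_adjoin alpha)\<^esub> y = x + y"
  "\<one>\<^bsub>ring_of_integers (rat_adjoin alpha)\<^esub> = 1"
  "\<zero>\<^bsub>ring_of_integers (rat_adjoin alpha)\<^esub> = 0"
  by (simp_all add: ring_of_integers_def ring_of_type_algebra_def OK_def)

lemma cring_ring_of_integers: "cring (ring_of_integers (rat_adjoin alpha))"
proof (rule cringI)
  show "abelian_group (ring_of_integers (rat_adjoin alpha))"
  proof (rule abelian_groupI, unfold ring_of_integers_simps)
    show "\<exists>y\<in>OK. y + x = 0" if "x \<in> OK" for x
      using OK_closed(3) [OF that] by (intro bexI [of _ "- x"]) auto
  qed (use OK_closed(4) [of 0] in \<open>auto intro: OK_closed\<close>)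
  show "comm_monoid (ring_of_integers (rat_adjoin alpha))"
    by (rule comm_monoidI, unfold ring_of_integers_simps) (use OK_closed(4) [of 1] in \<open>auto intro: OK_closed\<close>)
qed (auto simp: ring_of_integers_simps algebra_simps)

lemma int_combination_alpha_eq_iff:
  "of_int u + of_int v * alpha = of_int u' + of_int v' * alpha \<longleftrightarrow> u = u' \<and> v = v'"
  by (auto simp: complex_eq_iff alpha_eq)

text \<open>Reduction of u + v alpha to u - 31 v is multiplicative modulo 67 because 31^2 + 44 =
  1005 = 15 * 67. One factor 352 remains since both x and y were scaled but x y only once.\<close>

lemma prime67_residue:
  assumes "352 * x = of_int u + of_int v * alpha" "352 * y = of_int u' + of_int v' * alpha"
    and "352 * (x * y) = of_int u'' + of_int v'' * alpha"
  shows "67 dvd 352 * (u'' - 31 * v'') - (u - 31 * v) * (u' - 31 * v')"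
proof -
  have "of_int (352 * u'') + of_int (352 * v'') * alpha = 352 * (352 * (x * y))"
    unfolding assms(3) by (simp add: algebra_simps)
  also have "\<dots> = (352 * x) * (352 * y)" by simp
  also have "\<dots> = of_int (u * u' - 44 * v * v') + of_int (u * v' + u' * v) * alpha"
    unfolding assms(1,2) by (rule Zalpha_mult_eq)
  finally have "352 * u'' = u * u' - 44 * v * v'" "352 * v'' = u * v' + u' * v"
    unfolding int_combination_alpha_eq_iff by auto
  hence "352 * (u'' - 31 * v'') - (u - 31 * v) * (u' - 31 * v') = 67 * (- 15 * (v * v'))"
    by (simp add: algebra_simps)
  thus ?thesis by simp
qed

lemma OK_residueE:
  assumes "x \<in> OK"
  obtains u v where "352 * x = of_int u + of_int v * alpha"
  using OK_multiple [OF assms] unfolding Zalpha_def by blast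

lemma prime67_iff:
  assumes "x \<in> OK" "352 * x = of_int u + of_int v * alpha"
  shows "x \<in> prime67 \<longleftrightarrow> 67 dvd u - 31 * v"
  using assms int_combination_alpha_eq_iff unfolding prime67_def by auto

text \<open>The two directions are the two properties of a prime ideal: absorption of multiples and
  primality. Both reduce to 67 being prime in the integers.\<close>

lemma prime67_mult_iff:
  assumes x: "x \<in> OK" and y: "y \<in> OK"
  shows "x * y \<in> prime67 \<longleftrightarrow> x \<in> prime67 \<or> y \<in> prime67"
proof -
  obtain u v where u: "352 * x = of_int u + of_int v * alpha" using OK_residueE [OF x] .
  obtain u' v' where u': "352 * y = of_int u' + of_int v' * alpha" using OK_residueE [OF y] .
  obtain u'' v'' where u'': "352 * (x * y) = of_int u'' + of_int v'' * alpha"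
    using OK_residueE [OF OK_closed(2) [OF x y]] .
  have p67: "Factorial_Ring.prime (67 :: int)" by simp
  have "coprime (67 :: int) 352" by (simp add: coprime_iff_gcd_eq_1 gcd_non_0_int)
  hence "67 dvd u'' - 31 * v'' \<longleftrightarrow> 67 dvd 352 * (u'' - 31 * v'')"
    by (rule coprime_dvd_mult_right_iff [symmetric])
  also have "\<dots> \<longleftrightarrow> 67 dvd (u - 31 * v) * (u' - 31 * v')"
    using prime67_residue [OF u u' u''] by (metis dvd_diff_right_iff dvd_diff_left_iff)
  also have "\<dots> \<longleftrightarrow> 67 dvd u - 31 * v \<or> 67 dvd u' - 31 * v'"
    by (rule prime_dvd_mult_iff [OF p67])
  finally show ?thesis
    using prime67_iff [OF x u] prime67_iff [OF y u'] prime67_iff [OF OK_closed(2) [OF x y] u''] by blast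
qed

lemma prime67_add:
  assumes "x \<in> prime67" "y \<in> prime67"
  shows "x + y \<in> prime67"
proof -
  obtain u v u' v' where uv: "x \<in> OK" "y \<in> OK" "352 * x = of_int u + of_int v * alpha" "67 dvd u - 31 * v"
    "352 * y = of_int u' + of_int v' * alpha" "67 dvd u' - 31 * v'"
    using assms unfolding prime67_def by blast
  have "352 * (x + y) = of_int (u + u') + of_int (v + v') * alpha"
    using uv(3,5) by (simp add: algebra_simps)
  moreover have "67 dvd (u + u') - 31 * (v + v')"
    using dvd_add [OF uv(4,6)] by (simp add: algebra_simps)
  ultimately show ?thesis using prime67_iff OK_closed(1) uv(1,2) by blast
qed

lemma Zalpha_prime67_iff: "of_int u + of_int v * alpha \<in> prime67 \<longleftrightarrow> 67 dvd u - 31 * v"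
proof -
  have "352 * (of_int u + of_int v * alpha) = of_int (352 * u) + of_int (352 * v) * alpha"
    by (simp add: algebra_simps)
  moreover have "of_int u + of_int v * alpha \<in> OK" by (intro Zalpha_subset_OK ZalphaI [OF refl])
  ultimately have "of_int u + of_int v * alpha \<in> prime67 \<longleftrightarrow> 67 dvd 352 * u - 31 * (352 * v)"
    using prime67_iff by blast
  also have "352 * u - 31 * (352 * v) = 352 * (u - 31 * v)" by simp
  also have "67 dvd 352 * (u - 31 * v) \<longleftrightarrow> 67 dvd u - 31 * v"
    by (rule coprime_dvd_mult_right_iff) (simp add: coprime_iff_gcd_eq_1 gcd_non_0_int)
  finally show ?thesis .
qed

lemma of_int_prime67_iff: "of_int u \<in> prime67 \<longleftrightarrow> 67 dvd u"
  using Zalpha_prime67_iff [of u 0] by simp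

lemma prime67_primeideal: "primeideal prime67 (ring_of_integers (rat_adjoin alpha))"
proof (rule primeidealI)
  interpret R: cring "ring_of_integers (rat_adjoin alpha)" by (rule cring_ring_of_integers)
  have sub: "prime67 \<subseteq> OK" by (auto simp: prime67_def)
  have mult: "x * a \<in> prime67" "a * x \<in> prime67" if "a \<in> prime67" "x \<in> OK" for a x
    using that sub prime67_mult_iff by blast+
  show "ideal prime67 (ring_of_integers (rat_adjoin alpha))"
  proof (rule idealI)
    show "ring (ring_of_integers (rat_adjoin alpha))" by (rule R.ring_axioms)
    show "subgroup prime67 (add_monoid (ring_of_integers (rat_adjoin alpha)))"
    proof (rule group.subgroupI)
      show "group (add_monoid (ring_of_integers (rat_adjoin alpha)))" by (rule R.a_group)
      show "prime67 \<noteq> {}" using of_int_prime67_iff [of 0] by auto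
      show "inv\<^bsub>add_monoid (ring_of_integers (rat_adjoin alpha))\<^esub> a \<in> prime67" if "a \<in> prime67" for a
      proof -
        have "\<ominus>\<^bsub>ring_of_integers (rat_adjoin alpha)\<^esub> a = - a"
          by (rule R.minus_equality) (use that sub OK_closed(3) in \<open>auto simp: ring_of_integers_simps\<close>)
        thus ?thesis using mult(1) [OF that OK_closed(4) [of "-1"]] by (simp add: a_inv_def)
      qed
    qed (use sub prime67_add in \<open>auto simp: ring_of_integers_simps\<close>)
  qed (use mult in \<open>auto simp: ring_of_integers_simps\<close>)
  have "1 \<notin> prime67" using of_int_prime67_iff [of 1] by simp
  thus "carrier (ring_of_integers (rat_adjoin alpha)) \<noteq> prime67"
    using OK_closed(4) [of 1] by (auto simp: ring_of_integers_simps)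
qed (use prime67_mult_iff cring_ring_of_integers in \<open>auto simp: ring_of_integers_simps\<close>)

text \<open>The witness s = 5 absorbs the denominator of the constant term and is a unit at the
  prime because 67 does not divide 5.\<close>

lemma cong_mod_prime67I:
  assumes "5 * (x - y) = of_int u + of_int v * alpha" "67 dvd u - 31 * v"
  shows "cong_mod_prime (ring_of_integers (rat_adjoin alpha)) prime67 x y"
  unfolding cong_mod_prime_def
proof (rule bexI)
  show "5 * (x - y) \<in> prime67" unfolding assms(1) Zalpha_prime67_iff by (rule assms(2))
  show "5 \<in> carrier (ring_of_integers (rat_adjoin alpha)) - prime67"
    using of_int_prime67_iff [of 5] OK_closed(4) [of 5] by (simp add: ring_of_integers_simps)
qed

section \<open>The congruence\<close>

text \<open>The part of \<open>prime67\<close> inside Z[alpha]; the coefficients of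
  \<open>5 * (f - E)\<close> will be found there, so that no factor 352 is needed in the power
  series argument.\<close>

definition residue67 :: "complex set" where
  "residue67 = {of_int u + of_int v * alpha | u v. 67 dvd u - 31 * v}"

lemma residue67I: "67 dvd u - 31 * v \<Longrightarrow> of_int u + of_int v * alpha \<in> residue67"
  by (auto simp: residue67_def)

lemma residue67_add: "x \<in> residue67 \<Longrightarrow> y \<in> residue67 \<Longrightarrow> x + y \<in> residue67"
  unfolding residue67_def
proof safe
  fix u v u' v' :: int
  assume d: "67 dvd u - 31 * v" "67 dvd u' - 31 * v'"
  show "\<exists>u'' v''. of_int u + of_int v * alpha + (of_int u' + of_int v' * alpha) = of_int u'' + of_int v'' * alpha \<and>
      67 dvd u'' - 31 * v''"
    using dvd_add [OF d]
    by (intro exI [of _ "u + u'"] exI [of _ "v + v'"]) (simp add: algebra_simps)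
qed

lemma residue67_mult_Ints: "c \<in> \<int> \<Longrightarrow> x \<in> residue67 \<Longrightarrow> x * c \<in> residue67"
  unfolding residue67_def
proof safe
  fix u v :: int
  assume c: "c \<in> \<int>" and d: "67 dvd u - 31 * v"
  obtain k where k: "c = of_int k" using c by (elim Ints_cases)
  show "\<exists>u' v'. (of_int u + of_int v * alpha) * c = of_int u' + of_int v' * alpha \<and> 67 dvd u' - 31 * v'"
    using dvd_mult2 [OF d, of k]
    by (intro exI [of _ "u * k"] exI [of _ "v * k"]) (simp add: k algebra_simps)
qed

lemma residue67_diff: "x \<in> residue67 \<Longrightarrow> y \<in> residue67 \<Longrightarrow> x - y \<in> residue67"
  using residue67_add [of x "y * (-1)"] residue67_mult_Ints [of "-1" y] by simp

lemma residue67_sum: "(\<And>i. i \<in> I \<Longrightarrow> f i \<in> residue67) \<Longrightarrow> sum f I \<in> residue67"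
proof (induction I rule: infinite_finite_induct)
  case (insert i I)
  thus ?case by (auto intro: residue67_add)
qed (use residue67I [of 0 0] in auto)

text \<open>Division of power series by one with integer coefficients and leading coefficient 1 at
  index m: the coefficient of index n + m of the product isolates \<open>d n\<close> up to integer
  multiples of earlier d.\<close>

lemma residue67_cancel:
  assumes x: "\<And>n. x n \<in> \<int>" "\<And>n. n < m \<Longrightarrow> x n = 0" "x m = 1"
    and "\<And>n. conv d x n \<in> residue67"
  shows "d n \<in> residue67"
proof (induction n rule: less_induct)
  case (less n)
  have "conv d x (n + m) = (\<Sum>i\<le>n + m. d i * x (n + m - i))" by (simp add: conv_def)
  also have "\<dots> = (\<Sum>i\<le>n. d i * x (n + m - i))"
    by (rule sum.mono_neutral_right) (auto intro!: x(2))
  also have "\<dots> = (\<Sum>i<n. d i * x (n + m - i)) + d n"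
    by (simp add: x(3) flip: lessThan_Suc_atMost)
  finally have "d n = conv d x (n + m) - (\<Sum>i<n. d i * x (n + m - i))" by simp
  also have "\<dots> \<in> residue67"
    by (intro residue67_diff residue67_sum residue67_mult_Ints x(1) assms(4) less) auto
  finally show ?case .
qed

text \<open>\<open>fourier_coeff\<close> is a definite description, so existence of an expansion
  must be shown before the given coefficients say anything about f.\<close>

lemma modular_form_fourier:
  assumes "f \<in> modular_forms 5 k chi5"
  shows "has_fourier_expansion f (fourier_coeff f)"
proof -
  have per: "f (z + 1) = f z" if "Im z > 0" for z
    using modular_forms_transform [OF assms, of 1 1 1 0 z] that by (simp add: chi5_eq)
  have "(1, 0, 0, 1) \<in> SL2Z" by (simp add: SL2Z_def)
  hence "Bfun (slash k (1, 0, 0, 1) f) at_i_infinity"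
    using assms by (auto simp: modular_forms_def)
  hence "Bfun f at_i_infinity" by (simp add: slash_def)
  moreover have "f holomorphic_on upper_half_plane" using assms by (simp add: modular_forms_def)
  ultimately obtain a where "has_fourier_expansion f a"
    using fourier_expansion_exists [of f] per by blast
  thus ?thesis using fourier_coeff_eq by metis
qed

theorem theorem4p5:
  fixes f :: "complex \<Rightarrow> complex"
  assumes "f \<in> cusp_forms 5 6 chi5"
    and "\<forall>n\<le>10. fourier_coeff f n =
      [0, 1, alpha, - 3 * alpha, - 12, 5 * alpha - 45, 132, - 9 * alpha, 20 * alpha, - 153,
       - 45 * alpha - 220] ! n"
  shows "eisenstein6_chi5 \<in> modular_forms 5 6 chi5 \<and>
    (\<forall>n\<le>10. fourier_coeff eisenstein6_chi5 n =
      [- 67 / 5, 1, - 31, - 242, 993, 1, 7502, - 16806, - 31775, 58807, - 31] ! n) \<and>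
    (\<exists>P. primeideal P (ring_of_integers (rat_adjoin alpha)) \<and> 67 \<in> P \<and>
      forms_cong_mod_prime (ring_of_integers (rat_adjoin alpha)) P f eisenstein6_chi5)"
proof -
  define a where "a = fourier_coeff f"
  have f_mod: "f \<in> modular_forms 5 6 chi5" using assms(1) by (simp add: cusp_forms_def)
  have f_exp: "has_fourier_expansion f a" unfolding a_def by (rule modular_form_fourier [OF f_mod])
  have E_coeff: "fourier_coeff eisenstein6_chi5 = eisenstein_coeff"
    by (rule fourier_coeff_eq [OF eisenstein6_fourier])
  \<comment> \<open>The factor 5 clears the denominator of the constant term, giving
    \<open>d 0 = 67\<close>.\<close>
  define d where "d n = 5 * (a n - eisenstein_coeff n)" for n
  define D where "D z = 5 * (f z - eisenstein6_chi5 z)" for z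
  have D_mod: "D \<in> modular_forms 5 6 chi5"
    unfolding D_def by (intro modular_forms_cmult modular_forms_diff f_mod eisenstein6_modular)
  have D_exp: "has_fourier_expansion D d"
    unfolding D_def d_def by (intro fourier_cmult fourier_diff f_exp eisenstein6_fourier)
  \<comment> \<open>These four suffice: \<open>x3\<close> starts at index 3, so the coefficients of
    \<open>D * X3\<close> below index 7 involve only \<open>d 0\<close> to
    \<open>d 3\<close>.\<close>
  have d_values: "d 0 = 67" "d 1 = 0" "d 2 = 5 * alpha + 155" "d 3 = - 15 * alpha + 1210"
    unfolding d_def a_def using assms(2) by (simp_all add: eisenstein_coeff_values numeral_3_eq_3 nth_Cons')

  \<comment> \<open>The constants are solved for one after another from the coefficients of index 3,
    4, 5, 6. The first is \<open>d 0\<close>; the second is 3 * 67 - 39 * 67, where 39 is the next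
    coefficient of \<open>X1 * X2\<close>.\<close>
  define T where "T n = 67 * conv x1 x2 n + (- 2412) * conv x2 x2 n +
     (4309 + 5 * alpha) * conv x2 x3 n + (- 2442 - 55 * alpha) * conv x3 x3 n" for n
  define G where "G z = D z * X3 z - (67 * (X1 z * X2 z) + (- 2412) * (X2 z * X2 z) +
     (4309 + 5 * alpha) * (X2 z * X3 z) + (- 2442 - 55 * alpha) * (X3 z * X3 z))" for z
  have mult: "(\<lambda>z. g z * h z) \<in> modular_forms 5 12 (\<lambda>d. chi5 d * chi5 d)"
    if "g \<in> modular_forms 5 6 chi5" "h \<in> modular_forms 5 6 chi5" for g h
    using modular_forms_mult [OF that] by simp
  have G_mod: "G \<in> modular_forms 5 12 (\<lambda>d. chi5 d * chi5 d)"
    unfolding G_def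
    by (intro modular_forms_diff modular_forms_add modular_forms_cmult mult D_mod X1_modular X_modular)
  have G_exp: "has_fourier_expansion G (\<lambda>n. conv d x3 n - T n)"
    unfolding G_def T_def
    by (intro fourier_diff fourier_add fourier_cmult fourier_conv D_exp X1_fourier X_fourier)
  have G_small: "conv d x3 n - T n = 0" if "n < 7" for n
  proof -
    have "n = 0 \<or> n = 1 \<or> n = 2 \<or> n = 3 \<or> n = 4 \<or> n = 5 \<or> n = 6" using that by presburger
    thus ?thesis
      unfolding T_def
      by (elim disjE; simp only: conv_values x2_values x3_values x1_values d_values) (simp_all add: algebra_simps)
  qed
  interpret sturm5 G 12 "\<lambda>d. chi5 d * chi5 d"
    by unfold_locales (use G_mod norm_chi5 in \<open>auto simp: norm_mult\<close>)
  \<comment> \<open>7 pi sqrt 3 is about 38.1, just above 36; order 6 would give only 32.6.\<close>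
  have bound: "3 * real 12 < pi * sqrt 3 * real 7"
  proof -
    have "sqrt 3 > 173 / 100" by (rule real_less_rsqrt) (simp add: power2_eq_square)
    hence "(314 / 100) * (173 / 100) < pi * sqrt 3"
      using pi_approx by (intro mult_strict_mono) auto
    thus ?thesis by simp
  qed
  have "G z = 0" if "Im z > 0" for z
    by (rule sturm [OF G_exp G_small bound that])
  hence "has_fourier_expansion G (\<lambda>_. 0)"
    by (simp add: has_fourier_expansion_nome)
  from fourier_expansion_unique [OF G_exp this]
  have conv_eq: "conv d x3 n = T n" for n by (metis eq_iff_diff_eq_0)

  have T_res: "T n \<in> residue67" for n
  proof -
    \<comment> \<open>The residues u - 31 v are 67, -36 * 67, 4309 - 155 = 62 * 67 and -2442 + 1705
      = -11 * 67.\<close>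
    have c: "67 \<in> residue67" "- 2412 \<in> residue67" "4309 + 5 * alpha \<in> residue67" "- 2442 - 55 * alpha \<in> residue67"
      using residue67I [of 67 0] residue67I [of "- 2412" 0]
        residue67I [of 4309 5] residue67I [of "- 2442" "- 55"] by simp_all
    show ?thesis unfolding T_def
      by (intro residue67_add residue67_mult_Ints c conv_Ints integral_coeffs)
  qed
  have d_res: "d n \<in> residue67" for n
  proof (rule residue67_cancel [of x3 3])
    show "x3 k = 0" if "k < 3" for k
    proof -
      have "k = 0 \<or> k = 1 \<or> k = 2" using that by presburger
      thus ?thesis using x3_values by auto
    qed
  qed (use T_res conv_eq integral_coeffs x3_values in auto)
  have "cong_mod_prime (ring_of_integers (rat_adjoin alpha)) prime67 (a n) (eisenstein_coeff n)" for n
  proof -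
    obtain u v where "d n = of_int u + of_int v * alpha" "67 dvd u - 31 * v"
      using d_res unfolding residue67_def by blast
    thus ?thesis unfolding d_def by (rule cong_mod_prime67I)
  qed
  hence "forms_cong_mod_prime (ring_of_integers (rat_adjoin alpha)) prime67 f eisenstein6_chi5"
    unfolding forms_cong_mod_prime_def E_coeff a_def by blast
  moreover have "67 \<in> prime67" using of_int_prime67_iff [of 67] by simp
  ultimately show ?thesis
    using eisenstein6_modular prime67_primeideal eisenstein_coeff_values E_coeff by auto
qed

end
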